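(* Let $\mathbb F$ be an algebraically closed field. Let $H(s)\in\mathbb F[s]^{m\times n}$ be a matrix pencil with Weyr characteristic $(\mathbf W,\mathbf r_*,\mathbf s_* )$, and let $P(s)\in\mathbb F[s]^{m\times n}$ be a matrix pencil with $\operatorname{rank}(P(s))=1$. Let $(\widehat{\mathbf W},\widehat{\mathbf r}_*,\widehat{\mathbf s}_* )$ be the Weyr characteristic of $H(s)+P(s)$. Then: 1. If $\operatorname{rank}(H(s)+P(s))=\operatorname{rank}(H(s))$, then - $-1\le \widehat w_i(\lambda)-w_i(\lambda)\le 1$ for all $i\ge 1$, $\lambda\in\overline{\mathbb F}$; - if $\mathbf r=(0)$, then $0\le \widehat r_i-r_i\le 2$ for all $i\ge 0$; if $\mathbf r\ne(0)$, then for all $i\ge 0$ $$\min\left\{-\left[\sqrt{|\mathbf r|}\right]-1,\,-\left[\sqrt{|\mathbf r_*|}\right]\right\}\le \widehat r_i-r_i\le \max\left\{\left[\sqrt{|\mathbf r|-1}\right]+2,\,\left[\sqrt{|\mathbf r_*|}\right]\right\};$$ - if $\mathbf s=(0)$, then $0\le \widehat s_i-s_i\le 2$ for all $i\ge 0$; if $\mathbf s\ne(0)$, then for all $i\ge 0$ $$\min\left\{-\left[\sqrt{|\mathbf s|}\right]-1,\,-\left[\sqrt{|\mathbf s_*|}\right]\right\}\le \widehat s_i-s_i\le \max\left\{\left[\sqrt{|\mathbf s|-1}\right]+2,\,\left[\sqrt{|\mathbf s_*|}\right]\right\}.$$ 2. If $\operatorname{rank}(H(s)+P(s))=\operatorname{rank}(H(s))-1$,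 then - $-2\le \widehat w_i(\lambda)-w_i(\lambda)\le 0$ for all $i\ge 1$, $\lambda\in\overline{\mathbb F}$; - $\min\left\{1-\left[\sqrt{|\mathbf r_*|+1}\right],\,-\left[\sqrt{|\mathbf r|}\right]\right\}\le \widehat r_i-r_i\le 1$ for all $i\ge 0$; - $\min\left\{1-\left[\sqrt{|\mathbf s_*|+1}\right],\,-\left[\sqrt{|\mathbf s|}\right]\right\}\le \widehat s_i-s_i\le 1$ for all $i\ge 0$. 3. If $\operatorname{rank}(H(s)+P(s))=\operatorname{rank}(H(s))+1$, then - $0\le \widehat w_i(\lambda)-w_i(\lambda)\le 2$ for all $i\ge 1$, $\lambda\in\overline{\mathbb F}$; - $-1\le \widehat r_i-r_i\le \max\left\{-1+\left[\sqrt{|\mathbf r_*|}\right],\,\left[\sqrt{|\mathbf r|+1}\right]\right\}$ for all $i\ge 0$; - $-1\le \widehat s_i-s_i\le \max\left\{-1+\left[\sqrt{|\mathbf s_*|}\right],\,\left[\sqrt{|\mathbf s|+1}\right]\right\}$ for all $i\ge 0$.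
   Context: Notation. $\overline{\mathbb F}=\mathbb F\cup\{\infty\}$; $[x]$ is the integer part of a real number $x$. A matrix pencil is a polynomial matrix $H(s)=H_0+sH_1\in\mathbb F[s]^{m\times n}$ of degree at most one; its rank is its normal rank (order of the largest minor that is not identically zero). Partitions. A partition is an infinite nonincreasing sequence of nonnegative integers, almost all zero; $|\mathbf a|$ is the sum of the components of $\mathbf a$; $(0)$ is the zero partition. The conjugate of a partition or finite nonincreasing sequence $\mathbf c=(c_1,c_2,\dots)$ of nonnegative integers is the partition $\overline{\mathbf c}=(r_1,r_2,\dots)$, $r_k=\#\{i:c_i\ge k\}$, $k\ge1$. For a partition written with a star and indexed from $0$, $\mathbf r_*=(r_0,r_1,r_2,\dots)$, one writes $\mathbf r=(r_1,r_2,\dots)$, so $|\mathbf r_*|=r_0+|\mathbf r|$. Weyr characteristic. Let $H(s)\in\mathbb F[s]^{m\times n}$ have rank $\rho$, homogeneous invariant factors $\pi_1(s,t)\mid\dots\mid\pi_\rho(s,t)$, column minimal indices $\mathbf c=(c_1\ge\dots\ge c_{n-\rho})$ and row minimal indices $\mathbf u=(u_1\ge\dots\ge u_{m-\rho})$ (the Kronecker invariants). The partial multiplicities $\mathbf z(\lambda)=(z_1(\lambda),z_2(\lambda),\dots)$ at $\lambda\in\overline{\mathbb F}$ are defined by $\pi_{\rho-i+1}(s,t)=t^{z_i(\infty)}\prod_{\lambda\in\mathbb F}(s-\lambda t)^{z_i(\lambda)}$ for $1\le i\le\rho$ (up to nonzero constants), and $z_i(\lambda)=0$ for $i>\rho$.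 The Weyr characteristic at $\lambda$ is $\mathbf w(\lambda)=\overline{\mathbf z(\lambda)}=(w_1(\lambda),w_2(\lambda),\dots)$. The Weyr characteristic of the regular part is the collection $\mathbf W$ of the $\mathbf w(\lambda)$ over the (finitely many) eigenvalues $\lambda\in\overline{\mathbb F}$ ($\mathbf w(\lambda)=(0)$ at all other $\lambda$). The column Brunovsky partition is $\mathbf r_*=(r_0,r_1,\dots)$ with $r_0=n-\rho$, $(r_1,r_2,\dots)=\overline{\mathbf c}$; the row Brunovsky partition is $\mathbf s_*=(s_0,s_1,\dots)$ with $s_0=m-\rho$, $(s_1,s_2,\dots)=\overline{\mathbf u}$. The Weyr characteristic of $H(s)$ is $(\mathbf W,\mathbf r_*,\mathbf s_* )$; decorated symbols ($\widehat w_i(\lambda)$, $\widehat r_i$, $\widehat s_i$) denote the components of the correspondingly decorated Weyr characteristic. *)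

theory Defs
  imports
    "HOL-Computational_Algebra.Computational_Algebra"
    "Jordan_Normal_Form.Determinant"
    "Jordan_Normal_Form.Matrix_Kernel"
    "Jordan_Normal_Form.DL_Submatrix"
begin

definition is_pencil :: "nat \<Rightarrow> nat \<Rightarrow> 'a::field poly mat \<Rightarrow> bool" where
  "is_pencil m n H \<longleftrightarrow>
     H \<in> carrier_mat m n \<and> (\<forall>i<m. \<forall>j<n. degree (H $$ (i, j)) \<le> 1)"

definition minors :: "nat \<Rightarrow> 'r::comm_ring_1 mat \<Rightarrow> 'r set" where
  "minors k A = {det (submatrix A I J) | I J.
     I \<subseteq> {..<dim_row A} \<and> J \<subseteq> {..<dim_col A} \<and> card I = k \<and> card J = k}"

text \<open>The only minor of order 0 is the empty determinant 1, so the maximum below exists.\<close>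

definition normal_rank :: "'a::field poly mat \<Rightarrow> nat" where
  "normal_rank H = Max {k. \<exists>d \<in> minors k H. d \<noteq> 0}"

text \<open>
  Polynomials in \<open>s\<close>, \<open>t\<close> are of type \<^typ>\<open>'a poly poly\<close>, where the outer variable is \<open>s\<close>
  and the inner one is \<open>t\<close>. The pencil entry \<open>a + b s\<close> is homogenized to \<open>a t + b s\<close>.
\<close>

definition homogenize :: "'a::field poly mat \<Rightarrow> 'a poly poly mat" where
  "homogenize H = map_mat (\<lambda>p. [: [:0, coeff p 0:], [:coeff p 1:] :]) H"

definition is_gcd_of :: "'r::comm_ring_1 \<Rightarrow> 'r set \<Rightarrow> bool" where
  "is_gcd_of d S \<longleftrightarrow> (\<forall>x\<in>S. d dvd x) \<and> (\<forall>e. (\<forall>x\<in>S. e dvd x) \<longrightarrow> e dvd d)"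

text \<open>
  The product of the first \<open>k\<close> homogeneous invariant factors is the \<open>k\<close>-th determinantal
  divisor of the homogenized pencil; this determines the factors up to nonzero constants.
\<close>

definition homogeneous_invariant_factors ::
    "'a::field poly mat \<Rightarrow> (nat \<Rightarrow> 'a poly poly) \<Rightarrow> bool" where
  "homogeneous_invariant_factors H \<pi> \<longleftrightarrow>
     (\<forall>k \<le> normal_rank H. is_gcd_of (\<Prod>i=1..k. \<pi> i) (minors k (homogenize H)))"

datatype 'a point = Fin 'a | Infty

fun linear_form :: "'a::field point \<Rightarrow> 'a poly poly" where
  "linear_form (Fin l) = [: [:0, - l:], 1 :]"
| "linear_form Infty = [: [:0, 1:] :]"

text \<open>
  Sequences are functions on \<^typ>\<open>nat\<close>; sequences without a star start at index 1, and their
  value at 0 is irrelevant.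
\<close>

definition partial_multiplicities ::
    "'a::field poly mat \<Rightarrow> ('a point \<Rightarrow> nat \<Rightarrow> nat) \<Rightarrow> bool" where
  "partial_multiplicities H z \<longleftrightarrow>
     (\<exists>\<pi>. homogeneous_invariant_factors H \<pi> \<and>
        (\<forall>i \<in> {1..normal_rank H}.
           finite {x. z x i \<noteq> 0} \<and>
           (\<exists>c. c \<noteq> 0 \<and>
              \<pi> (normal_rank H - i + 1) =
                [: [:c:] :] * (\<Prod>x | z x i \<noteq> 0. linear_form x ^ z x i)))) \<and>
     (\<forall>x. \<forall>i > normal_rank H. z x i = 0)"

definition conjugate_seq :: "(nat \<Rightarrow> nat) \<Rightarrow> nat \<Rightarrow> nat" where
  "conjugate_seq a k = card {i. i \<ge> 1 \<and> a i \<ge> k}"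

definition conjugate_list :: "nat list \<Rightarrow> nat \<Rightarrow> nat" where
  "conjugate_list c k = card {i. i < length c \<and> c ! i \<ge> k}"

definition vec_degree :: "'a::field poly vec \<Rightarrow> nat" where
  "vec_degree v = Max ((\<lambda>i. degree (v $ i)) ` {..<dim_vec v})"

text \<open>
  Bases, consisting of polynomial vectors, of the null space of \<open>H\<close> over the field of rational
  functions.
\<close>

definition polynomial_null_basis :: "'a::field poly mat \<Rightarrow> 'a poly vec list \<Rightarrow> bool" where
  "polynomial_null_basis H bs \<longleftrightarrow>
     set bs \<subseteq> carrier_vec (dim_col H) \<and> distinct bs \<and>
     vectorspace.basis class_ring
       (module_vec TYPE('a poly fract) (dim_col H)\<lparr>carrier := mat_kernel (map_mat to_fract H)\<rparr>)
       (map_vec to_fract ` set bs)"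

definition minimal_null_basis :: "'a::field poly mat \<Rightarrow> 'a poly vec list \<Rightarrow> bool" where
  "minimal_null_basis H bs \<longleftrightarrow>
     polynomial_null_basis H bs \<and>
     (\<forall>bs'. polynomial_null_basis H bs' \<longrightarrow>
        sum_list (map vec_degree bs) \<le> sum_list (map vec_degree bs'))"

definition column_minimal_indices :: "'a::field poly mat \<Rightarrow> nat list \<Rightarrow> bool" where
  "column_minimal_indices H c \<longleftrightarrow>
     (\<exists>bs. minimal_null_basis H bs \<and> c = rev (sort (map vec_degree bs)))"

definition row_minimal_indices :: "'a::field poly mat \<Rightarrow> nat list \<Rightarrow> bool" where
  "row_minimal_indices H u \<longleftrightarrow> column_minimal_indices (transpose_mat H) u"

definition brunovsky :: "nat \<Rightarrow> nat list \<Rightarrow> nat \<Rightarrow> nat" where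
  "brunovsky d c k = (if k = 0 then d else conjugate_list c k)"

text \<open>
  The conjugate at index 0 plays no role in \<open>W\<close>; \<open>r\<close> and \<open>s\<close> are the starred partitions.
\<close>

definition weyr_characteristic ::
    "'a::field poly mat \<Rightarrow> ('a point \<Rightarrow> nat \<Rightarrow> nat) \<Rightarrow> (nat \<Rightarrow> nat) \<Rightarrow> (nat \<Rightarrow> nat) \<Rightarrow> bool" where
  "weyr_characteristic H W r s \<longleftrightarrow>
     (\<exists>z. partial_multiplicities H z \<and> (\<forall>x. \<forall>i\<ge>1. W x i = conjugate_seq (z x) i)) \<and>
     (\<exists>c. column_minimal_indices H c \<and> r = brunovsky (dim_col H - normal_rank H) c) \<and>
     (\<exists>u. row_minimal_indices H u \<and> s = brunovsky (dim_row H - normal_rank H) u)"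

text \<open>
  For a starred partition \<open>a = (a\<^sub>0, a\<^sub>1, \<dots>)\<close>, the size of \<open>(a\<^sub>1, a\<^sub>2, \<dots>)\<close> and that of \<open>a\<close>.
\<close>

definition partition_size :: "(nat \<Rightarrow> nat) \<Rightarrow> nat" where
  "partition_size a = (\<Sum>i | i \<ge> 1 \<and> a i \<noteq> 0. a i)"

definition starred_size :: "(nat \<Rightarrow> nat) \<Rightarrow> nat" where
  "starred_size a = a 0 + partition_size a"

definition isqrt :: "real \<Rightarrow> int" where
  "isqrt x = \<lfloor>sqrt x\<rfloor>"

end

theory Submission
  imports Defs "Jordan_Normal_Form.Column_Operations" "HOL-Library.Function_Algebras"
begin

text \<open>
  A pencil \<open>P\<close> of rank one factors as \<open>P = u v\<^sup>T\<close> with polynomial vectors \<open>u\<close> and \<open>v\<close>, one of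
  which is constant. All bounds come from this factorization; write \<open>\<rho>\<close>, \<open>\<rho>'\<close> for the ranks of \<open>H\<close>
  and \<open>H + P\<close>.

  Regular part. Fix a point of the projective line and let \<open>p\<close> be its linear form. Row and column
  transformations with determinants prime to \<open>p\<close> bring the homogenized pencil to a diagonal matrix
  with entries \<open>p\<close> to the power \<open>e i\<close> times something prime to \<open>p\<close>
  (\<open>local_smith_form_exists\<close>). Such transformations do not change which powers of \<open>p\<close> divide all
  minors of a given order, so the exponents are the partial multiplicities, and the \<open>k\<close>-th entry of
  the Weyr characteristic is \<open>\<rho>\<close> minus the number \<open>\<nu>\<close> of exponents below \<open>k\<close>. Up to a factor prime
  to \<open>p\<close> and modulo \<open>p\<close> to the power \<open>k\<close>, the matrix is a product with inner dimension \<open>\<nu>\<close>, and no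
  smaller inner dimension is possible. Adding \<open>u v\<^sup>T\<close> raises the inner dimension by at most one, so
  \<open>\<nu>\<close> changes by at most one (\<open>rank_one_perturbation_local_smith_form\<close>). This bounds the change of
  the Weyr characteristic by one after the ranks have been subtracted, which is the claim in all
  three cases.

  Column minimal indices. Let \<open>a k\<close> be the number of column minimal indices of \<open>H\<close> that are at
  most \<open>k\<close>; then \<open>r (k + 1) = r 0 - a k\<close>. An exchange argument in a minimal basis identifies
  \<open>a k\<close> with the growth, at degree \<open>k\<close>, of the dimension over the ground field of the polynomial
  kernel vectors of bounded degree (\<open>minimal_rational_basis_top_dim\<close>). If \<open>u\<close> is constant, the
  kernels of \<open>H\<close> and \<open>H + P\<close> are cut out of one common module by one functional each, of
  degree at most one; if \<open>v\<close> is constant, the two kernels have a common submodule that the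
  functional \<open>v\<close> cuts out of each of them. Restricting a module to the kernel of a functional
  \<open>\<phi>\<close> lowers the dimension of the part of degree at most \<open>k\<close> by the dimension of its image under
  \<open>\<phi>\<close>. This number is at most \<open>k + 1\<close> plus the degree of \<open>\<phi>\<close>, and it increases strictly once it is
  positive. These constraints alone imply that if the counts \<open>a k\<close> and \<open>b k\<close> of the two pencils
  differ by \<open>x\<close>, then the sum of \<open>r 1\<close> to \<open>r (k + 1)\<close> is at least of the order of \<open>x\<close> squared
  (\<open>count_change_bounds_common_supermodule\<close>, \<open>count_change_bounds_common_submodule\<close>), whence the
  square roots.

  The bounds for the row minimal indices are those for the transposed pencils.
\<close>

hide_const (open) module.smult

section \<open>Counting sequences that drop under one functional\<close>

text \<open>
  Let \<open>K\<close> be the kernel of a functional \<open>\<phi>\<close> of degree \<open>d\<close> on a polynomial module \<open>M\<close>, and let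
  \<open>f k\<close> be the amount by which passing from \<open>M\<close> to \<open>K\<close> lowers the growth of the dimension at degree
  \<open>k\<close>. The partial sums of \<open>f\<close> are the dimensions of the images under \<open>\<phi>\<close> of the elements of degree
  at most \<open>k\<close>. There are \<open>k + 1 + d\<close> coefficients for such an image; and if it is nonzero,
  multiplication by the indeterminate makes it grow at every further degree.
\<close>

definition corank_one_drop :: "int \<Rightarrow> (nat \<Rightarrow> int) \<Rightarrow> bool" where
  "corank_one_drop d f \<longleftrightarrow>
     (\<forall>k. 0 \<le> f k) \<and> (\<forall>j k. j \<le> k \<longrightarrow> 1 \<le> f j \<longrightarrow> 1 \<le> f k) \<and>
     (\<forall>k. (\<Sum>j\<le>k. f j) \<le> int k + 1 + d)"

lemma corank_one_drop_term_le_sum: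
  assumes "corank_one_drop d f"
  shows "f k \<le> (\<Sum>j\<le>k. f j)"
  by (rule member_le_sum) (use assms in \<open>auto simp: corank_one_drop_def\<close>)

text \<open>
  Otherwise the partial sums would eventually have slope two, but their bound has slope one.
\<close>

lemma corank_one_drop_often_le_one:
  assumes "corank_one_drop d f"
  shows "\<exists>j\<ge>k. f j \<le> 1"
proof (rule ccontr)
  assume "\<not> ?thesis"
  then have big: "2 \<le> f j" if "j \<ge> k" for j
    using that by force
  \<comment> \<open>Far enough that \<open>2 * (K + 1 - k)\<close> exceeds \<open>K + 1 + d\<close>.\<close>
  define K where "K = 2 * k + nat (\<bar>d\<bar>) + 2"
  have "2 * (int K + 1 - int k) = (\<Sum>j\<in>{k..K}. 2)"
    by (simp add: K_def)
  also have "\<dots> \<le> (\<Sum>j\<in>{k..K}. f j)"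
    by (rule sum_mono) (use big in auto)
  also have "\<dots> \<le> (\<Sum>j\<le>K. f j)"
    by (rule sum_mono2) (use assms in \<open>auto simp: corank_one_drop_def\<close>)
  also have "\<dots> \<le> int K + 1 + d"
    using assms by (simp add: corank_one_drop_def)
  finally show False
    by (simp add: K_def)
qed

text \<open>
  The sequences \<open>a\<close> and \<open>b\<close> count the minimal indices up to \<open>k\<close> of two pencils, \<open>p\<close> and \<open>p'\<close> are the
  total numbers of these indices, and \<open>S\<close> is the sum of the indices of the first pencil.
\<close>

definition count_change_bounds :: "int \<Rightarrow> int \<Rightarrow> int \<Rightarrow> (nat \<Rightarrow> int) \<Rightarrow> (nat \<Rightarrow> int) \<Rightarrow> bool" where
  "count_change_bounds p p' S a b \<longleftrightarrow>
     (p' = p + 1 \<longrightarrow> (\<forall>k. a k \<le> b k)) \<and>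
     (p' = p - 1 \<longrightarrow> (\<forall>k. b k \<le> a k)) \<and>
     (\<forall>k. 1 \<le> b k - a k \<longrightarrow> (b k - a k - 1)\<^sup>2 \<le> S) \<and>
     (\<forall>k. 1 \<le> a k - b k \<longrightarrow>
        (a k - b k - 1)\<^sup>2 \<le> S + 1 \<or>
        p' = p \<and> (a k - b k) * (a k - b k - 1) \<le> S \<and> a k - b k \<le> p)"

text \<open>
  If \<open>b\<close> ever falls below \<open>m\<close>, it stays below. But \<open>m\<close> exceeds \<open>a\<close> by at most one infinitely often,
  so \<open>b\<close> would not exceed \<open>p\<close> in the limit.
\<close>

lemma no_drop_from_above:
  fixes a b m :: "nat \<Rightarrow> int"
  assumes drop_a: "corank_one_drop d (\<lambda>k. m k - a k)"
    and drop_b: "corank_one_drop d (\<lambda>k. m k - b k)"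
    and a_le: "\<And>k. a k \<le> p" and b_ev: "\<And>k. k \<ge> L \<Longrightarrow> b k = p + 1"
  shows "b k = m k"
proof (rule ccontr)
  assume "b k \<noteq> m k"
  then have "1 \<le> m k - b k"
    using drop_b by (fastforce simp: corank_one_drop_def dest: spec[of _ k])
  then have pos: "1 \<le> m j - b j" if "j \<ge> k" for j
    using drop_b that unfolding corank_one_drop_def by blast
  obtain j where "j \<ge> max k L" "m j - a j \<le> 1"
    using corank_one_drop_often_le_one[OF drop_a] by blast
  with pos[of j] a_le[of j] b_ev[of j] show False
    by simp
qed

text \<open>
  The mirror image of the preceding lemma: if \<open>n\<close> ever falls below \<open>a\<close>, it stays below, while \<open>b\<close>
  exceeds \<open>n\<close> by at most one infinitely often; again \<open>b\<close> would not exceed \<open>p\<close> in the limit.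
\<close>

lemma no_drop_from_below:
  fixes a b n :: "nat \<Rightarrow> int"
  assumes drop_a: "corank_one_drop d (\<lambda>k. a k - n k)"
    and drop_b: "corank_one_drop d (\<lambda>k. b k - n k)"
    and a_le: "\<And>k. a k \<le> p" and b_ev: "\<And>k. k \<ge> L \<Longrightarrow> b k = p + 1"
  shows "a k = n k"
proof (rule ccontr)
  assume "a k \<noteq> n k"
  then have "1 \<le> a k - n k"
    using drop_a by (fastforce simp: corank_one_drop_def dest: spec[of _ k])
  then have pos: "1 \<le> a j - n j" if "j \<ge> k" for j
    using drop_a that unfolding corank_one_drop_def by blast
  obtain j where "j \<ge> max k L" "b j - n j \<le> 1"
    using corank_one_drop_often_le_one[OF drop_b] by blast
  with pos[of j] a_le[of j] b_ev[of j] show False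
    by simp
qed

text \<open>
  For \<open>x = a k - b k\<close> and \<open>j \<le> k\<close>, the inequalities \<open>a k \<le> p\<close> and \<open>b j \<le> b k\<close> give
  \<open>p - a j \<ge> x + (m j - a j) - (m j - b j)\<close>. Summed over \<open>j\<close> this is about \<open>x (k + 1) - (k + 2)\<close>,
  and \<open>x\<close> cannot exceed \<open>k + 2\<close>, so \<open>S\<close> is at least about \<open>x\<close> squared. For the opposite sign each of
  the \<open>k + 1\<close> terms \<open>p - a j\<close> is at least \<open>m k - 1 - a k\<close>.
\<close>

lemma count_change_bounds_common_supermodule:
  fixes a b m :: "nat \<Rightarrow> int"
  assumes mono: "mono m" "mono a" "mono b"
    and a_le: "\<And>k. a k \<le> p" and a_ev: "\<And>k. k \<ge> L \<Longrightarrow> a k = p"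
    and b_le: "\<And>k. b k \<le> p'" and b_ev: "\<And>k. k \<ge> L \<Longrightarrow> b k = p'"
    and b_nonneg: "\<And>k. 0 \<le> b k"
    and S: "\<And>k. (\<Sum>j\<le>k. p - a j) \<le> S"
    and drop_a: "corank_one_drop 1 (\<lambda>k. m k - a k)"
    and drop_b: "corank_one_drop 1 (\<lambda>k. m k - b k)"
    and near: "\<bar>p' - p\<bar> \<le> 1"
  shows "count_change_bounds p p' S a b"
proof -
  have nonneg: "0 \<le> m k - a k" "0 \<le> m k - b k" for k
    using drop_a drop_b by (auto simp: corank_one_drop_def)
  have up: "a k \<le> b k" if "p' = p + 1" for k
    using no_drop_from_above[OF drop_a drop_b a_le, of L k] b_ev that nonneg(1)[of k] by simp
  have down: "b k \<le> a k \<and> a k = m k" if "p' = p - 1" for k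
    using no_drop_from_above[OF drop_b drop_a b_le, of L k] a_ev that nonneg(2)[of k] by simp
  \<comment> \<open>By monotonicity \<open>m\<close> is bounded through a later index at which it exceeds \<open>a\<close> by at most one.\<close>
  have m_le: "m k \<le> p + 1" for k
  proof -
    obtain j where j: "j \<ge> k" "m j - a j \<le> 1"
      using corank_one_drop_often_le_one[OF drop_a] by blast
    with a_le[of j] monoD[OF mono(1) j(1)] show ?thesis by simp
  qed
  have low: "(b k - a k - 1)\<^sup>2 \<le> S" if y: "1 \<le> b k - a k" for k
  proof -
    define q where "q = m k - a k - 1"
    have q: "b k - a k - 1 \<le> q" "0 \<le> q"
      using nonneg(2)[of k] y by (auto simp: q_def)
    have "m k - a k \<le> int k + 2"
      using corank_one_drop_term_le_sum[OF drop_a, of k] drop_a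
      unfolding corank_one_drop_def by (smt (verit))
    then have qk: "q \<le> int k + 1" by (simp add: q_def)
    have "(b k - a k - 1)\<^sup>2 \<le> q * (int k + 1)"
      unfolding power2_eq_square using q qk y by (intro mult_mono) auto
    also have "\<dots> = (\<Sum>j\<le>k. q)" by simp
    also have "\<dots> \<le> (\<Sum>j\<le>k. p - a j)"
    proof (rule sum_mono)
      fix j assume "j \<in> {..k}"
      then have "a j \<le> a k" using monoD[OF mono(2)] by simp
      then show "q \<le> p - a j" using m_le[of k] by (simp add: q_def)
    qed
    also have "\<dots> \<le> S" by (rule S)
    finally show ?thesis .
  qed
  have high: "(a k - b k - 1)\<^sup>2 \<le> S + 1 \<or>
        p' = p \<and> (a k - b k) * (a k - b k - 1) \<le> S \<and> a k - b k \<le> p"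
    if x: "1 \<le> a k - b k" for k
  proof -
    define x where "x = a k - b k"
    have term_b: "m k - b k \<le> int k + 2"
      using corank_one_drop_term_le_sum[OF drop_b, of k] drop_b
      unfolding corank_one_drop_def by (smt (verit))
    have "x * (int k + 1) + (\<Sum>j\<le>k. m j - a j) - (\<Sum>j\<le>k. m j - b j)
        = (\<Sum>j\<le>k. x + (m j - a j) - (m j - b j))"
      by (simp add: sum.distrib sum_subtractf)
    also have "\<dots> \<le> (\<Sum>j\<le>k. p - a j)"
    proof (rule sum_mono)
      fix j assume "j \<in> {..k}"
      then have "b j \<le> b k" using monoD[OF mono(3)] by simp
      then show "x + (m j - a j) - (m j - b j) \<le> p - a j"
        using a_le[of k] by (simp add: x_def)
    qed
    also have "\<dots> \<le> S" by (rule S)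
    finally have main: "x * (int k + 1) + (\<Sum>j\<le>k. m j - a j) - (int k + 2) \<le> S"
      using drop_b unfolding corank_one_drop_def by (smt (verit))
    show ?thesis
    proof (cases "m k = a k")
      case True
      have "0 \<le> (\<Sum>j\<le>k. m j - a j)" by (intro sum_nonneg) (use nonneg in auto)
      then have "(x - 1) * (int k + 1) \<le> S + 1"
        using main by (simp add: algebra_simps)
      moreover have "(x - 1)\<^sup>2 \<le> (x - 1) * (int k + 1)"
        unfolding power2_eq_square using x True term_b by (intro mult_left_mono) (auto simp: x_def)
      ultimately show ?thesis by (simp add: x_def)
    next
      case False
      then have pos: "1 \<le> m k - a k" using nonneg(1)[of k] by simp
      then have "1 \<le> (\<Sum>j\<le>k. m j - a j)"
        using corank_one_drop_term_le_sum[OF drop_a, of k] by simp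
      then have 1: "(x - 1) * (int k + 1) \<le> S"
        using main by (simp add: algebra_simps)
      have "x * (x - 1) \<le> (x - 1) * (int k + 1)"
        unfolding mult.commute[of x] using x pos term_b by (intro mult_left_mono) (auto simp: x_def)
      moreover have "p' = p"
      proof -
        have "p' \<noteq> p + 1" using up[of k] x by auto
        moreover have "p' \<noteq> p - 1" using down[of k] False by auto
        ultimately show ?thesis using near by linarith
      qed
      moreover have "a k - b k \<le> p"
        using a_le[of k] b_nonneg[of k] by simp
      ultimately show ?thesis using 1 by (simp add: x_def)
    qed
  qed
  show ?thesis
    unfolding count_change_bounds_def using up down low high by blast
qed

text \<open>
  The sum of the \<open>p - a j\<close> for \<open>j \<le> k\<close> differs by at most \<open>k + 1\<close> from the sum of the \<open>p - n j\<close>, and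
  the latter are at least \<open>p - n k\<close>. So a large \<open>b k - n k\<close> makes \<open>S\<close> large. A large \<open>a k - n k\<close>
  does so too, because \<open>p - a j \<ge> (a k - n k) - (a j - n j)\<close>.
\<close>

lemma count_change_bounds_common_submodule:
  fixes a b n :: "nat \<Rightarrow> int"
  assumes mono: "mono n" "mono a"
    and a_le: "\<And>k. a k \<le> p" and a_ev: "\<And>k. k \<ge> L \<Longrightarrow> a k = p"
    and b_le: "\<And>k. b k \<le> p'" and b_ev: "\<And>k. k \<ge> L \<Longrightarrow> b k = p'"
    and S: "\<And>k. (\<Sum>j\<le>k. p - a j) \<le> S"
    and drop_a: "corank_one_drop 0 (\<lambda>k. a k - n k)"
    and drop_b: "corank_one_drop 0 (\<lambda>k. b k - n k)"
    and near: "\<bar>p' - p\<bar> \<le> 1"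
  shows "count_change_bounds p p' S a b"
proof -
  have nonneg: "0 \<le> a k - n k" "0 \<le> b k - n k" for k
    using drop_a drop_b by (auto simp: corank_one_drop_def)
  have term_le: "a k - n k \<le> int k + 1" "b k - n k \<le> int k + 1" for k
    using corank_one_drop_term_le_sum[OF drop_a, of k] corank_one_drop_term_le_sum[OF drop_b, of k]
      drop_a drop_b unfolding corank_one_drop_def by (smt (verit))+
  have sum_a: "(\<Sum>j\<le>k. a j - n j) \<le> int k + 1" for k
    using drop_a unfolding corank_one_drop_def by simp
  have up: "a k \<le> b k \<and> a k = n k" if "p' = p + 1" for k
    using no_drop_from_below[OF drop_a drop_b a_le, of L k] b_ev that nonneg(2)[of k] by simp
  have down: "b k \<le> a k" if "p' = p - 1" for k
    using no_drop_from_below[OF drop_b drop_a b_le, of L k] a_ev that nonneg(1)[of k] by simp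
  have low: "(b k - a k - 1)\<^sup>2 \<le> S" if y: "1 \<le> b k - a k" for k
  proof -
    define q where "q = b k - n k - 1"
    have q: "b k - a k - 1 \<le> q" "0 \<le> q" "q \<le> int k + 1"
      using nonneg(1)[of k] y term_le(2)[of k] by (auto simp: q_def)
    have "(b k - a k - 1)\<^sup>2 \<le> q * (int k + 1)"
      unfolding power2_eq_square using q y by (intro mult_mono) auto
    also have "\<dots> \<le> (\<Sum>j\<le>k. p - a j)"
    proof (cases "p' = p + 1")
      case True
      have "q * (int k + 1) = (\<Sum>j\<le>k. q)" by simp
      also have "\<dots> \<le> (\<Sum>j\<le>k. p - a j)"
      proof (rule sum_mono)
        fix j assume "j \<in> {..k}"
        then have "a j \<le> a k" using monoD[OF mono(2)] by simp
        then show "q \<le> p - a j" using b_le[of k] True up[OF True, of k] by (simp add: q_def)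
      qed
      finally show ?thesis .
    next
      case False
      then have "p' \<le> p" using near by linarith
      have "q * (int k + 1) = (\<Sum>j\<le>k. q + 1) - (int k + 1)" by (simp add: algebra_simps)
      also have "\<dots> \<le> (\<Sum>j\<le>k. q + 1) - (\<Sum>j\<le>k. a j - n j)" using sum_a[of k] by simp
      also have "\<dots> = (\<Sum>j\<le>k. q + 1 - (a j - n j))" by (simp only: sum_subtractf)
      also have "\<dots> \<le> (\<Sum>j\<le>k. p - a j)"
      proof (rule sum_mono)
        fix j assume "j \<in> {..k}"
        then have "n j \<le> n k" using monoD[OF mono(1)] by simp
        then show "q + 1 - (a j - n j) \<le> p - a j"
          using b_le[of k] \<open>p' \<le> p\<close> by (simp add: q_def)
      qed
      finally show ?thesis .
    qed
    also have "\<dots> \<le> S" by (rule S)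
    finally show ?thesis .
  qed
  have high: "(a k - b k - 1)\<^sup>2 \<le> S + 1" if x: "1 \<le> a k - b k" for k
  proof -
    define q where "q = a k - n k - 1"
    have q: "a k - b k - 1 \<le> q" "0 \<le> q" "q \<le> int k + 1"
      using nonneg(2)[of k] x term_le(1)[of k] by (auto simp: q_def)
    have "(a k - b k - 1)\<^sup>2 \<le> q * (int k + 1)"
      unfolding power2_eq_square using q x by (intro mult_mono) auto
    also have "\<dots> = (\<Sum>j\<le>k. q + 1) - (int k + 1)" by (simp add: algebra_simps)
    also have "\<dots> \<le> (\<Sum>j\<le>k. q + 1) - (\<Sum>j\<le>k. a j - n j)" using sum_a[of k] by simp
    also have "\<dots> = (\<Sum>j\<le>k. q + 1 - (a j - n j))" by (simp only: sum_subtractf)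
    also have "\<dots> \<le> (\<Sum>j\<le>k. p - a j)"
    proof (rule sum_mono)
      fix j assume "j \<in> {..k}"
      then have "n j \<le> n k" using monoD[OF mono(1)] by simp
      then show "q + 1 - (a j - n j) \<le> p - a j"
        using a_le[of k] by (simp add: q_def)
    qed
    also have "\<dots> \<le> S" by (rule S)
    finally show ?thesis by simp
  qed
  show ?thesis
    unfolding count_change_bounds_def using up down low high by blast
qed

section \<open>Square-root bounds for Brunovsky partitions\<close>

lemma le_isqrt:
  assumes "0 \<le> z" "0 \<le> y \<Longrightarrow> y\<^sup>2 \<le> z"
  shows "y \<le> isqrt (real_of_int z)"
proof (cases "0 \<le> y")
  case True
  then have "(real_of_int y)\<^sup>2 \<le> real_of_int z"
    using assms(2) by (metis of_int_le_iff of_int_power)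
  then show ?thesis
    by (simp add: isqrt_def le_floor_iff real_le_rsqrt)
next
  case False
  have "0 \<le> isqrt (real_of_int z)" using assms(1) by (simp add: isqrt_def)
  with False show ?thesis by simp
qed

lemma isqrt_nonneg: "0 \<le> z \<Longrightarrow> 0 \<le> isqrt z"
  by (simp add: isqrt_def)

text \<open>
  At index \<open>0\<close> the difference is the change of the total number of minimal indices; every other entry
  is \<open>r (k + 1) = r 0 - a k\<close>.
\<close>

lemma count_change_bounds_imp_sqrt_bounds:
  fixes r r' :: "nat \<Rightarrow> nat"
  assumes bounds: "count_change_bounds (int (r 0)) (int (r' 0)) (int (partition_size r))
      (\<lambda>k. int (r 0) - int (r (Suc k))) (\<lambda>k. int (r' 0) - int (r' (Suc k)))"
    and size0: "partition_size r = 0 \<longleftrightarrow> (\<forall>i\<ge>1. r i = 0)"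
  shows "r' 0 = r 0 \<Longrightarrow> \<forall>i\<ge>1. r i = 0 \<Longrightarrow>
            0 \<le> int (r' i) - int (r i) \<and> int (r' i) - int (r i) \<le> 2"
    and "r' 0 = r 0 \<Longrightarrow> \<not> (\<forall>i\<ge>1. r i = 0) \<Longrightarrow>
            min (- isqrt (real (partition_size r)) - 1) (- isqrt (real (starred_size r)))
              \<le> int (r' i) - int (r i) \<and>
            int (r' i) - int (r i)
              \<le> max (isqrt (real (partition_size r) - 1) + 2) (isqrt (real (starred_size r)))"
    and "r' 0 = r 0 + 1 \<Longrightarrow>
            min (1 - isqrt (real (starred_size r) + 1)) (- isqrt (real (partition_size r)))
              \<le> int (r' i) - int (r i) \<and> int (r' i) - int (r i) \<le> 1"
    and "r 0 = r' 0 + 1 \<Longrightarrow>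
            - 1 \<le> int (r' i) - int (r i) \<and>
            int (r' i) - int (r i)
              \<le> max (- 1 + isqrt (real (starred_size r))) (isqrt (real (partition_size r) + 1))"
proof -
  define S where "S = int (partition_size r)"
  have S: "real (partition_size r) = real_of_int S" "0 \<le> S"
      "real (starred_size r) = real_of_int (int (r 0) + S)"
    by (simp_all add: S_def starred_size_def)
  define a b where "a k = int (r 0) - int (r (Suc k))" and "b k = int (r' 0) - int (r' (Suc k))" for k
  have C: "count_change_bounds (int (r 0)) (int (r' 0)) S a b"
    using bounds unfolding S_def a_def b_def .
  have low: "b k - a k - 1 \<le> isqrt (real_of_int S)" for k
    by (rule le_isqrt) (use C S(2) in \<open>auto simp: count_change_bounds_def\<close>)
  have high: "(a k - b k - 1)\<^sup>2 \<le> S + 1 \<or>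
        r' 0 = r 0 \<and> (a k - b k) * (a k - b k - 1) \<le> S \<and> a k - b k \<le> int (r 0)"
    if "1 \<le> a k - b k" for k
    using C that by (auto simp: count_change_bounds_def)
  have isq: "0 \<le> isqrt (real_of_int S)" "0 \<le> isqrt (real_of_int S + 1)"
      "0 \<le> isqrt (real_of_int (int (r 0) + S))"
    using S(2) by (auto intro!: isqrt_nonneg)
  show "0 \<le> int (r' i) - int (r i) \<and> int (r' i) - int (r i) \<le> 2"
    if eq: "r' 0 = r 0" and z: "\<forall>i\<ge>1. r i = 0"
  proof (cases i)
    case 0
    with eq show ?thesis by simp
  next
    case (Suc k)
    have S0: "S = 0" using size0 z by (simp add: S_def)
    have "a k - b k \<le> 2"
    proof (rule ccontr)
      assume "\<not> ?thesis"
      then have x: "3 \<le> a k - b k" by simp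
      then have "2 * 2 \<le> (a k - b k - 1)\<^sup>2"
        unfolding power2_eq_square by (intro mult_mono) auto
      moreover have "3 * 2 \<le> (a k - b k) * (a k - b k - 1)"
        using x by (intro mult_mono) auto
      ultimately show False using high[of k] x S0 by auto
    qed
    then show ?thesis using Suc eq z by (simp add: a_def b_def)
  qed
  show "min (- isqrt (real (partition_size r)) - 1) (- isqrt (real (starred_size r)))
              \<le> int (r' i) - int (r i) \<and>
            int (r' i) - int (r i)
              \<le> max (isqrt (real (partition_size r) - 1) + 2) (isqrt (real (starred_size r)))"
    if eq: "r' 0 = r 0" and nz: "\<not> (\<forall>i\<ge>1. r i = 0)"
  proof -
    have "partition_size r \<noteq> 0" using size0 nz by blast
    then have S1: "1 \<le> S" by (simp add: S_def)
    then have isq1: "0 \<le> isqrt (real_of_int (S - 1))" by (intro isqrt_nonneg) simp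
    show ?thesis
    proof (cases i)
      case 0
      with eq isq isq1 show ?thesis by (auto simp: S min_le_iff_disj le_max_iff_disj)
    next
      case (Suc k)
      have 1: "int (r' i) - int (r i) = a k - b k"
        using Suc eq by (simp add: a_def b_def)
      have "a k - b k \<le> max (isqrt (real_of_int (S - 1)) + 2) (isqrt (real_of_int (int (r 0) + S)))"
      proof (cases "2 \<le> a k - b k")
        case False
        with isq1 show ?thesis by simp
      next
        case True
        define x where "x = a k - b k"
        from high[of k] True consider "(x - 1)\<^sup>2 \<le> S + 1" | "x * (x - 1) \<le> S" "x \<le> int (r 0)"
          by (auto simp: x_def)
        then show ?thesis
        proof cases
          case 1
          \<comment> \<open>\<open>(x - 1)\<^sup>2 \<le> S + 1\<close> implies \<open>(x - 2)\<^sup>2 \<le> S - 1\<close> from \<open>x = 3\<close> on; for \<open>x = 2\<close> the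
            latter only says that \<open>S\<close> is positive.\<close>
          have "x - 2 \<le> isqrt (real_of_int (S - 1))"
          proof (rule le_isqrt)
            show "0 \<le> S - 1" using S1 by simp
            show "(x - 2)\<^sup>2 \<le> S - 1"
            proof (cases "x = 2")
              case True
              then show ?thesis using S1 by simp
            next
              case False
              with True have "3 \<le> x" by (simp add: x_def)
              with 1 show ?thesis by (simp add: power2_eq_square algebra_simps)
            qed
          qed
          then show ?thesis by (simp add: x_def)
        next
          case 2
          have "x \<le> isqrt (real_of_int (int (r 0) + S))"
            by (rule le_isqrt) (use 2 S(2) in \<open>auto simp: power2_eq_square algebra_simps\<close>)
          then show ?thesis by (simp add: x_def)
        qed
      qed
      moreover have "- isqrt (real_of_int S) - 1 \<le> a k - b k" using low[of k] by simp
      ultimately show ?thesis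
        unfolding 1 S(1,3) by auto
    qed
  qed
  show "min (1 - isqrt (real (starred_size r) + 1)) (- isqrt (real (partition_size r)))
              \<le> int (r' i) - int (r i) \<and> int (r' i) - int (r i) \<le> 1"
    if eq: "r' 0 = r 0 + 1"
  proof (cases i)
    case 0
    with eq isq show ?thesis by (auto simp: S min_le_iff_disj le_max_iff_disj)
  next
    case (Suc k)
    have 1: "int (r' i) - int (r i) = 1 + a k - b k"
      using Suc eq by (simp add: a_def b_def)
    have "a k \<le> b k" using C eq by (simp add: count_change_bounds_def)
    then show ?thesis unfolding 1 S(1,3) using low[of k] by auto
  qed
  show "- 1 \<le> int (r' i) - int (r i) \<and>
            int (r' i) - int (r i)
              \<le> max (- 1 + isqrt (real (starred_size r))) (isqrt (real (partition_size r) + 1))"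
    if eq: "r 0 = r' 0 + 1"
  proof (cases i)
    case 0
    with eq isq show ?thesis by (auto simp: S min_le_iff_disj le_max_iff_disj)
  next
    case (Suc k)
    have 1: "int (r' i) - int (r i) = - 1 + a k - b k"
      using Suc eq by (simp add: a_def b_def)
    have "b k \<le> a k" using C eq by (simp add: count_change_bounds_def)
    moreover have "a k - b k - 1 \<le> isqrt (real_of_int (S + 1))"
      by (rule le_isqrt) (use high[of k] eq S(2) in auto)
    ultimately show ?thesis unfolding 1 S(1,3) by auto
  qed
qed

section \<open>Dimensions of truncated polynomial modules\<close>

text \<open>
  The polynomial spaces below are infinite-dimensional, and only the subspaces of bounded degree have
  finite spanning sets; therefore the finiteness is an assumption on \<open>W\<close> rather than on the whole space.
\<close>

lemma (in vector_space) dim_subset_finite_span: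
  assumes "V \<subseteq> W" "W \<subseteq> span E" "finite E"
  shows "dim V \<le> dim W"
proof -
  obtain B where B: "B \<subseteq> V" "independent B" "V \<subseteq> span B" "card B = dim V"
    using basis_exists by blast
  obtain C where C: "C \<subseteq> W" "independent C" "W \<subseteq> span C" "card C = dim W"
    using basis_exists by blast
  have "finite C" using independent_span_bound[OF assms(3) C(2)] C(1) assms(2) by blast
  then show ?thesis
    using independent_span_bound[of C B] B C assms(1) by (metis subset_trans)
qed

lemma (in vector_space) dim_psubset_finite_span:
  assumes "subspace V" "V \<subset> W" "W \<subseteq> span E" "finite E"
  shows "dim V < dim W"
proof -
  obtain B where B: "B \<subseteq> V" "independent B" "V \<subseteq> span B" "card B = dim V"
    using basis_exists by blast
  obtain y where y: "y \<in> W" "y \<notin> V" using assms(2) by blast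
  have "span B = V" using B assms(1) span_minimal by blast
  with y have yB: "y \<notin> span B" by simp
  have "independent (insert y B)" by (rule independent_insertI[OF yB B(2)])
  moreover have sub: "insert y B \<subseteq> W" using y B(1) assms(2) by blast
  ultimately have "dim (insert y B) = card (insert y B)"
    by (intro dim_eq_card_independent)
  moreover have fin: "finite B"
    using independent_span_bound[OF assms(4) B(2)] B(1) assms(2,3) by blast
  moreover have "y \<notin> B" using yB span_superset by blast
  moreover have "dim (insert y B) \<le> dim W"
    by (rule dim_subset_finite_span[OF sub assms(3,4)])
  ultimately show ?thesis using B(4) by simp
qed

text \<open>
  A basis of the kernel is extended to a basis of \<open>V\<close>; the images of the added vectors form a basis
  of the image.
\<close>

lemma (in vector_space_pair) rank_nullity_finite_span:
  assumes lin: "Vector_Spaces.linear s1 s2 f" and V: "vs1.subspace V" and E: "V \<subseteq> vs1.span E" "finite E"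
  shows "vs1.dim V = vs1.dim {x \<in> V. f x = 0} + vs2.dim (f ` V)"
proof -
  define K where "K = {x \<in> V. f x = 0}"
  obtain B where B: "B \<subseteq> K" "vs1.independent B" "K \<subseteq> vs1.span B" "card B = vs1.dim K"
    using vs1.basis_exists by blast
  have "B \<subseteq> V" using B(1) by (auto simp: K_def)
  then obtain D where D: "B \<subseteq> D" "D \<subseteq> V" "vs1.independent D" "V \<subseteq> vs1.span D"
    using vs1.maximal_independent_subset_extend[OF _ B(2)] by blast
  have finD: "finite D"
    using vs1.independent_span_bound[OF E(2) D(3)] D(2) E(1) by blast
  define C where "C = D - B"
  have fin: "finite B" "finite C" using finD D(1) finite_subset by (auto simp: C_def)
  have spanD: "vs1.span D = V" using D V vs1.span_minimal by blast
  have inj: "inj_on f (vs1.span C)"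
    unfolding linear_inj_on_iff_eq_0[OF lin vs1.subspace_span]
  proof (intro ballI impI)
    fix x assume x: "x \<in> vs1.span C" "f x = 0"
    have "vs1.span C \<subseteq> V" using vs1.span_mono[of C D] spanD by (auto simp: C_def)
    with x have "x \<in> vs1.span B" using B(3) by (auto simp: K_def)
    then obtain w where w: "x = (\<Sum>v\<in>B. s1 (w v) v)"
      unfolding vs1.span_finite[OF fin(1)] by blast
    obtain u where u: "x = (\<Sum>v\<in>C. s1 (u v) v)"
      using x(1) unfolding vs1.span_finite[OF fin(2)] by blast
    have "(\<Sum>v\<in>D. s1 (if v \<in> B then - w v else u v) v)
        = (\<Sum>v\<in>C. s1 (if v \<in> B then - w v else u v) v)
        + (\<Sum>v\<in>B. s1 (if v \<in> B then - w v else u v) v)"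
      unfolding C_def by (rule sum.subset_diff[OF D(1) finD])
    also have "\<dots> = (\<Sum>v\<in>C. s1 (u v) v) + (\<Sum>v\<in>B. s1 (- w v) v)"
      by (intro arg_cong2[where f = "(+)"] sum.cong) (auto simp: C_def)
    also have "\<dots> = 0"
      using w u by (simp add: vs1.scale_minus_left sum_negf)
    finally have z: "(if v \<in> B then - w v else u v) = 0" if "v \<in> D" for v
      using vs1.independentD[OF D(3) finD subset_refl _ that, of "\<lambda>v. if v \<in> B then - w v else u v"] by blast
    have "u v = 0" if "v \<in> C" for v
      using z[of v] that by (simp add: C_def)
    then show "x = 0" using u by simp
  qed
  have "f ` V = vs2.span (f ` D)"
    using linear_span_image[OF lin, of D] spanD by simp
  also have "\<dots> = vs2.span (f ` C)"
  proof -
    have "f ` B \<subseteq> {0}" using B(1) by (auto simp: K_def)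
    moreover have "f ` D = f ` B \<union> f ` C" using D(1) by (auto simp: C_def)
    ultimately have "f ` D = f ` C \<or> f ` D = insert 0 (f ` C)" by auto
    then show ?thesis by (metis vs2.span_insert_0)
  qed
  finally have "vs2.dim (f ` V) = card (f ` C)"
    using vs2.dim_span_eq_card_independent
      linear_independent_injective_image[OF lin vs1.independent_mono[OF D(3)] inj]
    by (simp add: C_def)
  also have "\<dots> = card C"
    by (rule card_image, rule inj_on_subset[OF inj vs1.span_superset])
  also have "\<dots> + card B = card D"
    using D(1) finD fin(1) by (simp add: C_def card_Diff_subset card_mono)
  also have "card D = vs1.dim V"
    using vs1.basis_card_eq_dim[OF D(2,4,3)] .
  finally show ?thesis using B(4) by (simp add: K_def)
qed

text \<open>
  Polynomial vectors of length \<open>n\<close> are functions that vanish from index \<open>n\<close> on. They all live in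
  one vector space over the ground field, and \<open>cscale\<close> is the scalar multiplication for the vectors
  of coefficients of a fixed power of the indeterminate.
\<close>

definition vscale :: "'a::field \<Rightarrow> (nat \<Rightarrow> 'a poly) \<Rightarrow> nat \<Rightarrow> 'a poly" where
  "vscale c x = (\<lambda>i. smult c (x i))"

definition cscale :: "'a::field \<Rightarrow> (nat \<Rightarrow> 'a) \<Rightarrow> nat \<Rightarrow> 'a" where
  "cscale c x = (\<lambda>i. c * x i)"

global_interpretation pv: vector_space "vscale :: 'a::field \<Rightarrow> _"
  by unfold_locales (auto simp: vscale_def fun_eq_iff smult_add_right smult_add_left)

global_interpretation cv: vector_space "cscale :: 'a::field \<Rightarrow> _"
  by unfold_locales (auto simp: cscale_def fun_eq_iff algebra_simps)

global_interpretation sv: vector_space "smult :: 'a::field \<Rightarrow> 'a poly \<Rightarrow> _"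
  by unfold_locales (auto simp: smult_add_right smult_add_left)

global_interpretation pv_cv: vector_space_pair "vscale :: 'a::field \<Rightarrow> _" "cscale :: 'a::field \<Rightarrow> _" ..

global_interpretation pv_sv: vector_space_pair "vscale :: 'a::field \<Rightarrow> _" "smult :: 'a::field \<Rightarrow> _" ..

lemma sum_fun_apply: "(\<Sum>a\<in>A. f a) i = (\<Sum>a\<in>A. f a i)" for f :: "'b \<Rightarrow> 'c \<Rightarrow> 'd::comm_monoid_add"
  by (induction A rule: infinite_finite_induct) auto

definition supp_below :: "nat \<Rightarrow> (nat \<Rightarrow> 'b::zero) \<Rightarrow> bool" where
  "supp_below n x \<longleftrightarrow> (\<forall>i\<ge>n. x i = 0)"

definition deg_below :: "nat \<Rightarrow> 'a::zero poly \<Rightarrow> bool" where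
  "deg_below k p \<longleftrightarrow> (\<forall>l\<ge>k. coeff p l = 0)"

lemma poly_eq_sum_monom_deg_below:
  fixes p :: "'a::comm_semiring_1 poly"
  assumes "deg_below k p"
  shows "(\<Sum>l<k. smult (coeff p l) (monom 1 l)) = p"
proof (rule poly_eqI)
  fix l
  have "coeff (\<Sum>l<k. smult (coeff p l) (monom 1 l)) l = (\<Sum>j<k. if j = l then coeff p l else 0)"
    unfolding coeff_sum by (rule sum.cong) auto
  also have "\<dots> = coeff p l"
    using assms by (auto simp: deg_below_def)
  finally show "coeff (\<Sum>l<k. smult (coeff p l) (monom 1 l)) l = coeff p l" .
qed

lemma deg_below_finite_span:
  "Collect (deg_below k :: 'a::field poly \<Rightarrow> bool) \<subseteq> sv.span (monom 1 ` {..<k})"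
proof
  fix p :: "'a poly"
  assume "p \<in> Collect (deg_below k)"
  then have p: "p = (\<Sum>l<k. smult (coeff p l) (monom 1 l))"
    by (simp add: poly_eq_sum_monom_deg_below)
  show "p \<in> sv.span (monom 1 ` {..<k})"
    by (subst p) (intro sv.span_sum sv.span_scale sv.span_base, auto)
qed

lemma supp_below_finite_span:
  "Collect (supp_below n :: (nat \<Rightarrow> 'a::field) \<Rightarrow> bool)
    \<subseteq> cv.span ((\<lambda>j i. if i = j then 1 else 0) ` {..<n})"
proof
  fix x :: "nat \<Rightarrow> 'a"
  assume x: "x \<in> Collect (supp_below n)"
  have "x = (\<Sum>j<n. cscale (x j) (\<lambda>i. if i = j then 1 else 0))"
  proof
    fix i
    have "(\<Sum>j<n. cscale (x j) (\<lambda>i. if i = j then 1 else 0)) i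
        = (\<Sum>j<n. if j = i then x i else 0)"
      unfolding sum_fun_apply by (rule sum.cong) (auto simp: cscale_def)
    also have "\<dots> = x i" using x by (auto simp: supp_below_def)
    finally show "x i = (\<Sum>j<n. cscale (x j) (\<lambda>i. if i = j then 1 else 0)) i" by simp
  qed
  moreover have "(\<Sum>j<n. cscale (x j) (\<lambda>i. if i = j then 1 else 0)) \<in>
      cv.span ((\<lambda>j i. if i = j then 1 else 0) ` {..<n})"
    by (intro cv.span_sum cv.span_scale cv.span_base) auto
  ultimately show "x \<in> cv.span ((\<lambda>j i. if i = j then 1 else 0) ` {..<n})" by simp
qed

lemma deg_supp_below_finite_span:
  "{x :: nat \<Rightarrow> 'a::field poly. supp_below n x \<and> (\<forall>i. deg_below k (x i))}
    \<subseteq> pv.span ((\<lambda>(j, l) i. if i = j then monom 1 l else 0) ` ({..<n} \<times> {..<k}))"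
proof
  let ?e = "\<lambda>j l i. if i = j then monom 1 l else (0 :: 'a poly)"
  let ?E = "(\<lambda>(j, l). ?e j l) ` ({..<n} \<times> {..<k})"
  fix x :: "nat \<Rightarrow> 'a poly"
  assume x: "x \<in> {x. supp_below n x \<and> (\<forall>i. deg_below k (x i))}"
  have "x = (\<Sum>j<n. \<Sum>l<k. vscale (coeff (x j) l) (?e j l))"
  proof
    fix i
    have "(\<Sum>j<n. \<Sum>l<k. vscale (coeff (x j) l) (?e j l)) i
        = (\<Sum>j<n. if j = i then \<Sum>l<k. smult (coeff (x i) l) (monom 1 l) else 0)"
      unfolding sum_fun_apply by (rule sum.cong) (auto simp: vscale_def)
    also have "\<dots> = x i"
      using x by (auto simp: supp_below_def poly_eq_sum_monom_deg_below)
    finally show "x i = (\<Sum>j<n. \<Sum>l<k. vscale (coeff (x j) l) (?e j l)) i" by simp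
  qed
  moreover have "(\<Sum>j<n. \<Sum>l<k. vscale (coeff (x j) l) (?e j l)) \<in> pv.span ?E"
    by (intro pv.span_sum pv.span_scale pv.span_base) force
  ultimately show "x \<in> pv.span ?E" by simp
qed

text \<open>
  Multiplication by the indeterminate, which raises degrees by one.
\<close>

definition shift :: "(nat \<Rightarrow> 'a::comm_semiring_1 poly) \<Rightarrow> nat \<Rightarrow> 'a poly" where
  "shift x = (\<lambda>i. [:0, 1:] * x i)"

definition poly_submodule :: "nat \<Rightarrow> (nat \<Rightarrow> 'a::field poly) set \<Rightarrow> bool" where
  "poly_submodule n M \<longleftrightarrow> M \<subseteq> Collect (supp_below n) \<and> pv.subspace M \<and> shift ` M \<subseteq> M"

text \<open>
  Since \<open>deg_below\<close> is strict, \<open>trunc k M\<close> consists of the elements of degree less than \<open>k\<close>; in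
  particular \<open>trunc 0 M\<close> is the zero space.
\<close>

definition trunc :: "nat \<Rightarrow> (nat \<Rightarrow> 'a::zero poly) set \<Rightarrow> (nat \<Rightarrow> 'a poly) set" where
  "trunc k M = {x \<in> M. \<forall>i. deg_below k (x i)}"

definition top_coeffs :: "nat \<Rightarrow> (nat \<Rightarrow> 'a::zero poly) \<Rightarrow> nat \<Rightarrow> 'a" where
  "top_coeffs k x = (\<lambda>i. coeff (x i) k)"

text \<open>
  This is the growth of the dimension from the elements of degree less than \<open>k\<close> to those of degree
  at most \<open>k\<close>, because the former are the kernel of \<open>top_coeffs k\<close> on the latter.
\<close>

definition top_dim :: "(nat \<Rightarrow> 'a::field poly) set \<Rightarrow> nat \<Rightarrow> nat" where
  "top_dim M k = cv.dim (top_coeffs k ` trunc (Suc k) M)"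

lemma coeff_shift: "coeff (shift x i) l = (case l of 0 \<Rightarrow> 0 | Suc l' \<Rightarrow> coeff (x i) l')"
  by (cases l) (auto simp: shift_def)

lemma subspace_trunc: "pv.subspace M \<Longrightarrow> pv.subspace (trunc k M)"
  unfolding pv.subspace_def trunc_def by (auto simp: deg_below_def vscale_def)

lemma trunc_finite_span:
  "poly_submodule n M \<Longrightarrow>
    trunc k M \<subseteq> pv.span ((\<lambda>(j, l) i. if i = j then monom 1 l else 0) ` ({..<n} \<times> {..<k}))"
  by (rule order_trans[OF _ deg_supp_below_finite_span]) (auto simp: poly_submodule_def trunc_def)

lemma linear_top_coeffs: "Vector_Spaces.linear vscale cscale (top_coeffs k :: _ \<Rightarrow> nat \<Rightarrow> 'a::field)"
  by unfold_locales (auto simp: top_coeffs_def vscale_def cscale_def fun_eq_iff)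

lemma trunc_0: "poly_submodule n M \<Longrightarrow> trunc 0 M = {0}"
  by (auto simp: poly_submodule_def pv.subspace_def trunc_def deg_below_def fun_eq_iff poly_eq_iff)

lemma trunc_Suc_kernel: "{x \<in> trunc (Suc k) M. top_coeffs k x = 0} = trunc k M"
  by (auto simp: trunc_def top_coeffs_def deg_below_def fun_eq_iff) (metis le_antisym not_less_eq_eq)

lemma dim_trunc:
  assumes M: "poly_submodule n M"
  shows "pv.dim (trunc k M) = (\<Sum>j<k. top_dim M j)"
proof (induction k)
  case 0
  have "pv.dim {0 :: nat \<Rightarrow> 'a poly} = card ({} :: (nat \<Rightarrow> 'a poly) set)"
    by (rule pv.dim_eq_card[OF _ pv.independent_empty]) simp
  then show ?case using trunc_0[OF M] by simp
next
  case (Suc k)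
  have "pv.subspace M" using M by (simp add: poly_submodule_def)
  then have "pv.dim (trunc (Suc k) M)
      = pv.dim {x \<in> trunc (Suc k) M. top_coeffs k x = 0} + cv.dim (top_coeffs k ` trunc (Suc k) M)"
    by (intro pv_cv.rank_nullity_finite_span[OF linear_top_coeffs subspace_trunc trunc_finite_span[OF M]]) simp_all
  with Suc show ?case by (simp add: trunc_Suc_kernel top_dim_def)
qed

text \<open>
  Multiplication by the indeterminate moves the coefficients at \<open>k\<close> to \<open>k + 1\<close>.
\<close>

lemma mono_top_dim:
  assumes M: "poly_submodule n M"
  shows "mono (top_dim M)"
  unfolding mono_iff_le_Suc
proof
  fix k
  have "top_coeffs k ` trunc (Suc k) M \<subseteq> top_coeffs (Suc k) ` trunc (Suc (Suc k)) M"
  proof safe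
    fix x assume x: "x \<in> trunc (Suc k) M"
    have "shift x \<in> trunc (Suc (Suc k)) M"
      using x M by (auto simp: trunc_def poly_submodule_def deg_below_def coeff_shift split: nat.splits)
    moreover have "top_coeffs (Suc k) (shift x) = top_coeffs k x"
      by (simp add: top_coeffs_def coeff_shift)
    ultimately show "top_coeffs k x \<in> top_coeffs (Suc k) ` trunc (Suc (Suc k)) M" by force
  qed
  moreover have "top_coeffs (Suc k) ` trunc (Suc (Suc k)) M \<subseteq> Collect (supp_below n)"
    using M by (auto simp: poly_submodule_def trunc_def supp_below_def top_coeffs_def)
  ultimately show "top_dim M k \<le> top_dim M (Suc k)"
    unfolding top_dim_def
    by (intro cv.dim_subset_finite_span[OF _ order_trans[OF _ supp_below_finite_span]]) auto
qed

lemma poly_submodule_kernel: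
  assumes M: "poly_submodule n M" and lin: "Vector_Spaces.linear vscale smult \<phi>"
    and shift: "\<And>x. x \<in> M \<Longrightarrow> \<phi> (shift x) = [:0, 1:] * \<phi> x"
  shows "poly_submodule n {x \<in> M. \<phi> x = 0}"
  using M shift unfolding poly_submodule_def pv.subspace_def
  by (auto simp: pv_sv.linear_0[OF lin] pv_sv.linear_add[OF lin] pv_sv.linear_scale[OF lin])

text \<open>
  By rank-nullity the partial sums of the drop are the dimensions of the images of the truncations under
  \<open>\<phi>\<close>. If such an image is nonzero, the product of the indeterminate with an element of largest degree
  lies in the next image but not in this one.
\<close>

lemma corank_one_drop_top_dim:
  assumes M: "poly_submodule n M" and lin: "Vector_Spaces.linear vscale smult \<phi>"
    and shift: "\<And>x. x \<in> M \<Longrightarrow> \<phi> (shift x) = [:0, 1:] * \<phi> x"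
    and deg: "\<And>k x. x \<in> M \<Longrightarrow> \<forall>i. deg_below k (x i) \<Longrightarrow> deg_below (k + d) (\<phi> x)"
    and K: "K = {x \<in> M. \<phi> x = 0}"
  shows "corank_one_drop (int d) (\<lambda>k. int (top_dim M k) - int (top_dim K k))"
proof -
  define F where "F k = sv.dim (\<phi> ` trunc k M)" for k
  have K_sub: "poly_submodule n K" unfolding K using M lin shift by (rule poly_submodule_kernel)
  have subsp: "pv.subspace (trunc k M)" for k
    using M by (intro subspace_trunc) (simp add: poly_submodule_def)
  have in_deg: "\<phi> ` trunc k M \<subseteq> sv.span (monom 1 ` {..<k + d})" for k
    by (rule order_trans[OF _ deg_below_finite_span]) (auto simp: trunc_def deg)
  have "{x \<in> trunc k M. \<phi> x = 0} = trunc k K" for k by (auto simp: trunc_def K)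
  then have F: "pv.dim (trunc k M) = pv.dim (trunc k K) + F k" for k
    using pv_sv.rank_nullity_finite_span[OF lin subsp trunc_finite_span[OF M], of k] by (simp add: F_def)
  have sum_eq: "(\<Sum>j<k. int (top_dim M j) - int (top_dim K j)) = int (F k)" for k
    using F[of k] by (simp add: dim_trunc[OF M] dim_trunc[OF K_sub] sum_subtractf flip: of_nat_sum)
  have F_le: "F k \<le> k + d" for k
  proof -
    have "F k \<le> card (monom 1 ` {..<k + d} :: 'a poly set)"
      unfolding F_def by (rule sv.dim_le_card[OF in_deg]) simp
    also have "\<dots> \<le> k + d" using card_image_le[of "{..<k + d}"] by simp
    finally show ?thesis .
  qed
  have sub_Suc: "\<phi> ` trunc k M \<subseteq> \<phi> ` trunc (Suc k) M" for k
    by (auto simp: trunc_def deg_below_def)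
  have F_mono: "F k \<le> F (Suc k)" for k
    unfolding F_def by (rule sv.dim_subset_finite_span[OF sub_Suc in_deg]) simp
  have F_Suc: "F k < F (Suc k)" if "0 < F k" for k
  proof -
    have "\<phi> ` trunc k M \<noteq> \<phi> ` trunc (Suc k) M"
    proof
      assume eq: "\<phi> ` trunc k M = \<phi> ` trunc (Suc k) M"
      have "\<exists>x\<in>trunc k M. \<phi> x \<noteq> 0"
      proof (rule ccontr)
        assume "\<not> ?thesis"
        then have "\<phi> ` trunc k M \<subseteq> sv.span {}" by auto
        from sv.dim_le_card[OF this] that show False by (simp add: F_def)
      qed
      then obtain x0 where x0: "x0 \<in> trunc k M \<and> \<phi> x0 \<noteq> 0" by blast
      have bounded: "degree (\<phi> x) \<le> k + d" if "x \<in> trunc k M \<and> \<phi> x \<noteq> 0" for x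
        using deg[of x k] that by (intro degree_le) (auto simp: trunc_def deg_below_def)
      obtain x where x: "x \<in> trunc k M" "\<phi> x \<noteq> 0"
        and max: "\<And>y. y \<in> trunc k M \<Longrightarrow> \<phi> y \<noteq> 0 \<Longrightarrow> degree (\<phi> y) \<le> degree (\<phi> x)"
        using ex_has_greatest_nat[of "\<lambda>x. x \<in> trunc k M \<and> \<phi> x \<noteq> 0" x0 "\<lambda>x. degree (\<phi> x)" "k + d + 1"]
          x0 bounded by force
      have "shift x \<in> trunc (Suc k) M"
        using x(1) M by (auto simp: trunc_def poly_submodule_def deg_below_def coeff_shift split: nat.splits)
      then have "[:0, 1:] * \<phi> x \<in> \<phi> ` trunc k M"
        using eq shift[of x] x(1) by (metis (no_types, lifting) image_eqI mem_Collect_eq trunc_def)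
      then obtain y where y: "y \<in> trunc k M" "\<phi> y = [:0, 1:] * \<phi> x" by force
      have "degree (\<phi> y) = Suc (degree (\<phi> x))" "\<phi> y \<noteq> 0"
        using y(2) x(2) by (simp_all add: degree_mult_eq)
      with max[OF y(1)] show False by simp
    qed
    then have "\<phi> ` trunc k M \<subset> \<phi> ` trunc (Suc k) M" using sub_Suc[of k] by blast
    then show ?thesis unfolding F_def
      by (intro sv.dim_psubset_finite_span[OF pv_sv.linear_subspace_image[OF lin subsp] _ in_deg]) simp_all
  qed
  have diff: "int (top_dim M k) - int (top_dim K k) = int (F (Suc k)) - int (F k)" for k
    using sum_eq[of "Suc k"] sum_eq[of k] by simp
  have F_pos: "0 < F k" if "0 < F j" "j \<le> k" for j k
    using that(2,1) by (induction rule: dec_induct) (use F_mono in \<open>auto intro: less_le_trans\<close>)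
  have "1 \<le> int (F (Suc k)) - int (F k)" if "j \<le> k" "1 \<le> int (F (Suc j)) - int (F j)" for j k
  proof (cases "j = k")
    case False
    then have "0 < F k" using F_pos[of "Suc j" k] that by simp
    then show ?thesis using F_Suc[of k] by simp
  qed (use that in simp)
  moreover have "(\<Sum>j\<le>k. int (F (Suc j)) - int (F j)) \<le> int k + 1 + int d" for k
    using sum_eq[of "Suc k"] F_le[of "Suc k"] by (simp add: diff lessThan_Suc_atMost)
  ultimately show ?thesis
    unfolding corank_one_drop_def diff using F_mono by simp
qed

section \<open>Minimal bases and their degrees\<close>

lemma (in vector_space) independent_family:
  assumes fin: "finite J" and indep: "\<And>\<alpha>. (\<Sum>j\<in>J. scale (\<alpha> j) (f j)) = 0 \<Longrightarrow> \<forall>j\<in>J. \<alpha> j = 0"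
  shows "inj_on f J" "independent (f ` J)"
proof -
  show inj: "inj_on f J"
  proof (rule inj_onI, rule ccontr)
    fix i j assume ij: "i \<in> J" "j \<in> J" "f i = f j" "i \<noteq> j"
    define \<alpha> where "\<alpha> l = (if l = i then 1 else if l = j then - 1 else 0 :: 'a)" for l
    have "(\<Sum>l\<in>J. scale (\<alpha> l) (f l)) = (\<Sum>l\<in>{i, j}. scale (\<alpha> l) (f l))"
      by (rule sum.mono_neutral_right) (use fin ij in \<open>auto simp: \<alpha>_def\<close>)
    also have "\<dots> = 0" using ij by (simp add: \<alpha>_def)
    finally have "\<alpha> i = 0" using indep ij(1) by blast
    then show False by (simp add: \<alpha>_def)
  qed
  show "independent (f ` J)"
  proof (rule independent_if_scalars_zero)
    show "finite (f ` J)" using fin by simp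
    fix g x assume g: "(\<Sum>x\<in>f ` J. scale (g x) x) = 0" and x: "x \<in> f ` J"
    have "(\<Sum>j\<in>J. scale (g (f j)) (f j)) = 0"
      using g by (simp add: sum.reindex[OF inj])
    from indep[OF this] x show "g x = 0" by auto
  qed
qed

text \<open>
  A basis, over the field of fractions, of the space spanned by \<open>M\<close>. The definition avoids fractions:
  coefficients are taken in the ring, and membership in the span holds after multiplication by a
  common denominator \<open>d\<close>.
\<close>

definition rational_basis :: "(nat \<Rightarrow> 'a::idom) set \<Rightarrow> nat \<Rightarrow> (nat \<Rightarrow> nat \<Rightarrow> 'a) \<Rightarrow> bool" where
  "rational_basis M p b \<longleftrightarrow> (\<forall>j<p. b j \<in> M) \<and>
     (\<forall>q. (\<forall>i. (\<Sum>j<p. q j * b j i) = 0) \<longrightarrow> (\<forall>j<p. q j = 0)) \<and>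
     (\<forall>x\<in>M. \<exists>d q. d \<noteq> 0 \<and> (\<forall>i. d * x i = (\<Sum>j<p. q j * b j i)))"

lemma sum_fun_upd:
  fixes b :: "nat \<Rightarrow> nat \<Rightarrow> 'a::comm_ring_1"
  assumes "l < p"
  shows "(\<Sum>j<p. w j * (b(l := x)) j i) = (\<Sum>j<p. w j * b j i) - w l * b l i + w l * x i"
  using assms by (simp add: sum.remove[of "{..<p}" l])

text \<open>
  Steinitz exchange, based on \<open>q l * b l = d * x\<close> minus the remaining terms of \<open>dx\<close>.
\<close>

lemma rational_basis_exchange:
  assumes b: "rational_basis M p b" and x: "x \<in> M" and d: "d \<noteq> 0"
    and dx: "\<And>i. d * x i = (\<Sum>j<p. q j * b j i)" and l: "l < p" "q l \<noteq> 0"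
  shows "rational_basis M p (b(l := x))"
  unfolding rational_basis_def
proof (intro conjI allI impI ballI)
  fix j assume "j < p"
  then show "(b(l := x)) j \<in> M" using b x by (auto simp: rational_basis_def)
next
  fix w j assume w: "\<forall>i. (\<Sum>j<p. w j * (b(l := x)) j i) = 0" and j: "j < p"
  define v where "v j = (if j = l then w l * q l else d * w j + w l * q j)" for j
  have "(\<Sum>j<p. v j * b j i) = 0" for i
  proof -
    have "(\<Sum>j<p. v j * b j i) = (\<Sum>j<p. d * (w j * b j i) + w l * (q j * b j i)) - d * w l * b l i"
      using l(1) by (simp add: sum.remove[of "{..<p}" l] v_def algebra_simps)
    also have "\<dots> = d * ((\<Sum>j<p. w j * b j i) - w l * b l i) + w l * (\<Sum>j<p. q j * b j i)"
      by (simp add: sum.distrib sum_distrib_left algebra_simps)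
    also have "\<dots> = d * (\<Sum>j<p. w j * (b(l := x)) j i)"
      unfolding sum_fun_upd[OF l(1)] dx[symmetric] by (simp add: algebra_simps)
    finally show ?thesis using w by simp
  qed
  then have v0: "\<forall>j<p. v j = 0" using b unfolding rational_basis_def by blast
  then have wl: "w l = 0" using l by (auto simp: v_def)
  then show "w j = 0"
    using v0 j d by (cases "j = l") (auto simp: v_def)
next
  fix y assume "y \<in> M"
  then obtain e s where e: "e \<noteq> 0" and s: "\<forall>i. e * y i = (\<Sum>j<p. s j * b j i)"
    using b unfolding rational_basis_def by blast
  define v where "v j = (if j = l then s l * d else q l * s j - s l * q j)" for j
  have "q l * e * y i = (\<Sum>j<p. v j * (b(l := x)) j i)" for i
  proof -
    have "(\<Sum>j<p. v j * (b(l := x)) j i)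
        = (\<Sum>j<p. (q l * s j - s l * q j) * b j i) + s l * d * x i"
      using l(1) by (simp add: sum.remove[of "{..<p}" l] v_def algebra_simps)
    also have "(\<Sum>j<p. (q l * s j - s l * q j) * b j i)
        = q l * (\<Sum>j<p. s j * b j i) - s l * (\<Sum>j<p. q j * b j i)"
      by (simp add: sum_subtractf sum_distrib_left algebra_simps)
    also have "\<dots> = q l * (e * y i) - s l * (d * x i)"
      using s dx by simp
    finally show ?thesis by (simp add: algebra_simps)
  qed
  then show "\<exists>d q. d \<noteq> 0 \<and> (\<forall>i. d * y i = (\<Sum>j<p. q j * (b(l := x)) j i))"
    using e l by (intro exI[of _ "q l * e"] exI[of _ v]) simp
qed

definition vdeg :: "nat \<Rightarrow> (nat \<Rightarrow> 'a::zero poly) \<Rightarrow> nat" where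
  "vdeg n x = Max ((\<lambda>i. degree (x i)) ` {..<n})"

lemma degree_le_vdeg: "supp_below n x \<Longrightarrow> degree (x i) \<le> vdeg n x"
  unfolding vdeg_def supp_below_def by (cases "i < n") (auto intro: Max_ge)

lemma vdeg_le: "0 < n \<Longrightarrow> (\<And>i. degree (x i) \<le> k) \<Longrightarrow> vdeg n x \<le> k"
  unfolding vdeg_def by (subst Max_le_iff) auto

lemma deg_below_Suc_iff: "deg_below (Suc k) p \<longleftrightarrow> degree p \<le> k"
  unfolding deg_below_def by (meson Suc_le_eq coeff_eq_0 degree_le le_less_trans)

definition minimal_rational_basis :: "nat \<Rightarrow> (nat \<Rightarrow> 'a::idom poly) set \<Rightarrow> nat \<Rightarrow> (nat \<Rightarrow> nat \<Rightarrow> 'a poly) \<Rightarrow> bool" where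
  "minimal_rational_basis n M p b \<longleftrightarrow> rational_basis M p b \<and>
     (\<forall>b'. rational_basis M p b' \<longrightarrow> (\<Sum>j<p. vdeg n (b j)) \<le> (\<Sum>j<p. vdeg n (b' j)))"

text \<open>
  Exchanging \<open>b l\<close> for \<open>x\<close> cannot lower the sum of the degrees.
\<close>

lemma minimal_rational_basis_degree_le:
  assumes b: "minimal_rational_basis n M p b" and x: "x \<in> M" and d: "d \<noteq> 0"
    and dx: "\<And>i. d * x i = (\<Sum>j<p. q j * b j i)" and l: "l < p" "q l \<noteq> 0"
  shows "vdeg n (b l) \<le> vdeg n x"
proof -
  have "rational_basis M p (b(l := x))"
    using rational_basis_exchange[OF _ x d dx l] b by (simp add: minimal_rational_basis_def)
  then have "(\<Sum>j<p. vdeg n (b j)) \<le> (\<Sum>j<p. vdeg n ((b(l := x)) j))"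
    using b unfolding minimal_rational_basis_def by blast
  moreover have "(\<Sum>j<p. vdeg n (b j)) = vdeg n (b l) + (\<Sum>j\<in>{..<p} - {l}. vdeg n (b j))"
    using l(1) by (simp add: sum.remove[of "{..<p}" l])
  moreover have "(\<Sum>j<p. vdeg n ((b(l := x)) j)) = vdeg n x + (\<Sum>j\<in>{..<p} - {l}. vdeg n (b j))"
    using l(1) by (simp add: sum.remove[of "{..<p}" l])
  ultimately show ?thesis by linarith
qed

lemma poly_submodule_mult:
  assumes M: "poly_submodule n M" and x: "x \<in> M"
  shows "(\<lambda>i. q * x i) \<in> M"
proof (induction q)
  case 0
  have "0 \<in> M" using M by (simp add: poly_submodule_def pv.subspace_0)
  then show ?case by (simp add: zero_fun_def)
next
  case (pCons a q)
  have "vscale a x + shift (\<lambda>i. q * x i) \<in> M"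
    using M x pCons.IH unfolding poly_submodule_def
    by (intro pv.subspace_add pv.subspace_scale) auto
  moreover have "vscale a x + shift (\<lambda>i. q * x i) = (\<lambda>i. pCons a q * x i)"
    by (auto simp: fun_eq_iff vscale_def shift_def mult_pCons_left)
  ultimately show ?case by simp
qed

lemma poly_submodule_sum:
  assumes M: "poly_submodule n M" and b: "\<And>j. j < p \<Longrightarrow> b j \<in> M"
  shows "(\<lambda>i. \<Sum>j<p. q j * b j i) \<in> M"
proof -
  have "(\<Sum>j<p. (\<lambda>i. q j * b j i)) \<in> M"
    by (rule pv.subspace_sum) (use M b poly_submodule_mult[OF M] in \<open>auto simp: poly_submodule_def\<close>)
  moreover have "(\<Sum>j<p. (\<lambda>i. q j * b j i)) = (\<lambda>i. \<Sum>j<p. q j * b j i)"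
    by (simp add: fun_eq_iff sum_fun_apply)
  ultimately show ?thesis by simp
qed

lemma coeff_mult_top:
  fixes p q :: "'a::comm_semiring_1 poly"
  assumes "degree p \<le> a" "degree q \<le> b"
  shows "coeff (p * q) (a + b) = coeff p a * coeff q b"
proof -
  have "coeff (p * q) (a + b) = (\<Sum>i\<le>a + b. coeff p i * coeff q (a + b - i))"
    by (rule coeff_mult)
  also have "\<dots> = (\<Sum>i\<le>a + b. if i = a then coeff p a * coeff q b else 0)"
  proof (rule sum.cong)
    fix i assume "i \<in> {..a + b}"
    consider "i < a" | "i = a" | "a < i" by linarith
    then show "coeff p i * coeff q (a + b - i) = (if i = a then coeff p a * coeff q b else 0)"
    proof cases
      case 1
      then have "degree q < a + b - i" using assms(2) by linarith
      then show ?thesis using 1 by (simp add: coeff_eq_0)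
    next
      case 3
      then have "degree p < i" using assms(1) by linarith
      then show ?thesis using 3 by (simp add: coeff_eq_0)
    qed simp
  qed simp
  also have "\<dots> = coeff p a * coeff q b" by simp
  finally show ?thesis .
qed

text \<open>
  Let \<open>c\<close> be the largest degree that occurs in a nontrivial relation of the leading coefficients.
  After multiplication by suitable powers of the indeterminate, the relation yields an element \<open>x\<close> of
  \<open>M\<close> of degree less than \<open>c\<close>, and a basis element of degree \<open>c\<close> can be exchanged for it. If \<open>c = 0\<close>,
  then \<open>x = 0\<close> is a relation of the basis itself.
\<close>

lemma minimal_rational_basis_leading_independent:
  fixes b :: "nat \<Rightarrow> nat \<Rightarrow> 'a::field poly"
  assumes M: "poly_submodule n M" and b: "minimal_rational_basis n M p b"
    and zero: "\<And>i. (\<Sum>j<p. \<alpha> j * coeff (b j i) (vdeg n (b j))) = 0" and l: "l < p"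
  shows "\<alpha> l = 0"
proof (rule ccontr)
  assume "\<alpha> l \<noteq> 0"
  define J where "J = {j. j < p \<and> \<alpha> j \<noteq> 0}"
  have "finite J" "J \<noteq> {}" using l \<open>\<alpha> l \<noteq> 0\<close> by (auto simp: J_def)
  then obtain k where k: "k \<in> J" and max: "\<And>j. j \<in> J \<Longrightarrow> vdeg n (b j) \<le> vdeg n (b k)"
    using obtains_MAX[of J "\<lambda>j. vdeg n (b j)"] by (metis (no_types, lifting) Max_ge finite_imageI imageI)
  define c where "c = vdeg n (b k)"
  define q where "q j = monom (\<alpha> j) (c - vdeg n (b j))" for j
  define x where "x i = (\<Sum>j<p. q j * b j i)" for i
  have bM: "b j \<in> M" if "j < p" for j
    using b that by (simp add: minimal_rational_basis_def rational_basis_def)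
  then have supp: "supp_below n (b j)" if "j < p" for j
    using M that by (auto simp: poly_submodule_def)
  have xM: "x \<in> M" unfolding x_def by (rule poly_submodule_sum[OF M bM])
  have k': "k < p" "q k \<noteq> 0" using k by (auto simp: J_def q_def)
  have "x \<noteq> 0"
  proof
    assume "x = 0"
    then have "\<forall>i. (\<Sum>j<p. q j * b j i) = 0" by (simp add: x_def fun_eq_iff)
    then have "q k = 0" using b k'(1) unfolding minimal_rational_basis_def rational_basis_def by blast
    with k' show False by simp
  qed
  moreover have "supp_below n x" using M xM by (auto simp: poly_submodule_def)
  ultimately have n0: "0 < n" by (cases n) (auto simp: supp_below_def fun_eq_iff)
  have deg: "degree (q j) \<le> c - vdeg n (b j)" for j
    by (simp add: q_def degree_monom_le)
  have deg_term: "degree (q j * b j i) \<le> c" if "j < p" for i j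
  proof (cases "j \<in> J")
    case True
    have "degree (q j * b j i) \<le> (c - vdeg n (b j)) + vdeg n (b j)"
      using degree_mult_le[of "q j" "b j i"] deg[of j] degree_le_vdeg[OF supp[OF that], of i] by linarith
    then show ?thesis using max[OF True] by (simp add: c_def)
  qed (use that in \<open>simp add: J_def q_def\<close>)
  have top: "coeff (x i) c = 0" for i
  proof -
    have "coeff (q j * b j i) c = \<alpha> j * coeff (b j i) (vdeg n (b j))" if "j < p" for j
    proof (cases "j \<in> J")
      case True
      then have "c = (c - vdeg n (b j)) + vdeg n (b j)" using max by (simp add: c_def)
      then have "coeff (q j * b j i) c = coeff (q j) (c - vdeg n (b j)) * coeff (b j i) (vdeg n (b j))"
        using coeff_mult_top[OF deg[of j] degree_le_vdeg[OF supp[OF that], of i]] by simp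
      then show ?thesis by (simp add: q_def)
    qed (use that in \<open>simp add: J_def q_def\<close>)
    then have "coeff (x i) c = (\<Sum>j<p. \<alpha> j * coeff (b j i) (vdeg n (b j)))"
      by (simp add: x_def coeff_sum)
    with zero show ?thesis by simp
  qed
  have x_le: "degree (x i) \<le> c" for i
    unfolding x_def by (rule degree_sum_le) (use deg_term in auto)
  have "1 * x i = (\<Sum>j<p. q j * b j i)" for i by (simp add: x_def)
  from minimal_rational_basis_degree_le[where q = q, OF b xM one_neq_zero this k']
  have c_le: "c \<le> vdeg n x" by (simp add: c_def)
  show False
  proof (cases c)
    case 0
    then have "x i = 0" for i using top[of i] x_le[of i] by (metis le_zero_eq leading_coeff_0_iff)
    then show False using \<open>x \<noteq> 0\<close> by (simp add: fun_eq_iff)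
  next
    case (Suc c')
    have "degree (x i) \<le> c'" for i
      using eq_zero_or_degree_less[OF x_le[of i] top[of i]] Suc by auto
    then have "vdeg n x \<le> c'" by (rule vdeg_le[OF n0])
    with c_le Suc show False by simp
  qed
qed

text \<open>
  An element \<open>x\<close> of degree at most \<open>k\<close> depends only on basis elements of degree at most \<open>k\<close>, by
  exchange. As the leading coefficients of the basis are independent, no cancellation occurs in the
  top degree of a combination; hence the top coefficients of \<open>x\<close> are a combination of those of these
  basis elements.
\<close>

lemma minimal_rational_basis_top_dim:
  fixes b :: "nat \<Rightarrow> nat \<Rightarrow> 'a::field poly"
  assumes M: "poly_submodule n M" and b: "minimal_rational_basis n M p b"
  shows "top_dim M k = card {j. j < p \<and> vdeg n (b j) \<le> k}"
proof -
  define c where "c j = vdeg n (b j)" for j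
  define lc where "lc j = top_coeffs (c j) (b j)" for j
  define J where "J = {j. j < p \<and> c j \<le> k}"
  have bM: "b j \<in> M" if "j < p" for j
    using b that by (simp add: minimal_rational_basis_def rational_basis_def)
  then have supp: "supp_below n (b j)" if "j < p" for j
    using M that by (auto simp: poly_submodule_def)
  have indep: "\<alpha> l = 0" if "\<And>i. (\<Sum>j<p. \<alpha> j * lc j i) = 0" "l < p" for \<alpha> l
    using minimal_rational_basis_leading_independent[OF M b _ that(2)] that(1)
    by (simp add: lc_def c_def top_coeffs_def)
  have finJ: "finite J" by (simp add: J_def)
  have indepJ: "\<forall>j\<in>J. \<alpha> j = 0" if "(\<Sum>j\<in>J. cscale (\<alpha> j) (lc j)) = 0" for \<alpha>
  proof
    fix j assume j: "j \<in> J"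
    define \<beta> where "\<beta> j = (if j \<in> J then \<alpha> j else 0)" for j
    have "(\<Sum>j<p. \<beta> j * lc j i) = 0" for i
    proof -
      have "(\<Sum>j<p. \<beta> j * lc j i) = (\<Sum>j\<in>J. \<beta> j * lc j i)"
        by (rule sum.mono_neutral_right) (auto simp: J_def \<beta>_def)
      also have "\<dots> = (\<Sum>j\<in>J. cscale (\<alpha> j) (lc j)) i"
        unfolding sum_fun_apply by (rule sum.cong) (auto simp: \<beta>_def cscale_def)
      finally show ?thesis using that by simp
    qed
    then have "\<beta> j = 0" using indep[of \<beta> j] j by (simp add: J_def)
    then show "\<alpha> j = 0" using j by (simp add: \<beta>_def)
  qed
  have "top_coeffs k ` trunc (Suc k) M = cv.span (lc ` J)"
  proof
    have "lc ` J \<subseteq> top_coeffs k ` trunc (Suc k) M"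
    proof safe
      fix j assume j: "j \<in> J"
      define y where "y i = monom 1 (k - c j) * b j i" for i
      have kc: "(k - c j) + c j = k" using j by (simp add: J_def)
      have deg_b: "degree (b j i) \<le> c j" for i
        unfolding c_def by (rule degree_le_vdeg) (use supp j in \<open>simp add: J_def\<close>)
      have "degree (y i) \<le> k" for i
        using degree_mult_le[of "monom 1 (k - c j)" "b j i"] deg_b[of i] kc
          degree_monom_le[of "1::'a" "k - c j"] unfolding y_def by linarith
      moreover have "y \<in> M"
        using poly_submodule_mult[OF M bM, of j] j by (simp add: J_def y_def[abs_def])
      ultimately have "y \<in> trunc (Suc k) M" by (simp add: trunc_def deg_below_Suc_iff)
      moreover have "top_coeffs k y = lc j"
        using coeff_mult_top[OF degree_monom_le deg_b, of "1::'a" "k - c j"] kc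
        by (simp add: top_coeffs_def lc_def y_def fun_eq_iff)
      ultimately show "lc j \<in> top_coeffs k ` trunc (Suc k) M" by force
    qed
    then show "cv.span (lc ` J) \<subseteq> top_coeffs k ` trunc (Suc k) M"
      using M by (intro cv.span_minimal pv_cv.linear_subspace_image[OF linear_top_coeffs] subspace_trunc)
        (simp_all add: poly_submodule_def)
    show "top_coeffs k ` trunc (Suc k) M \<subseteq> cv.span (lc ` J)"
    proof safe
      fix x assume "x \<in> trunc (Suc k) M"
      then have xM: "x \<in> M" and x_deg: "degree (x i) \<le> k" for i
        by (auto simp: trunc_def deg_below_Suc_iff)
      obtain d q where d: "d \<noteq> 0" and dx: "\<And>i. d * x i = (\<Sum>j<p. q j * b j i)"
        using b xM unfolding minimal_rational_basis_def rational_basis_def by blast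
      define Q where "Q = {j. j < p \<and> q j \<noteq> 0}"
      have Q_sub: "Q \<subseteq> J"
      proof
        fix l assume l: "l \<in> Q"
        have "0 < n"
        proof (rule ccontr)
          assume "\<not> 0 < n"
          then have "\<forall>i. (\<Sum>j<p. (1::'a poly) * b j i) = 0"
            using supp by (auto simp: supp_below_def intro!: sum.neutral)
          moreover have "(\<forall>i. (\<Sum>j<p. q j * b j i) = 0) \<longrightarrow> (\<forall>j<p. q j = 0)" for q
            using b unfolding minimal_rational_basis_def rational_basis_def by blast
          ultimately have "\<forall>j<p. (1::'a poly) = 0" by fast
          then show False using l by (simp add: Q_def)
        qed
        then have "vdeg n x \<le> k" using x_deg by (rule vdeg_le)
        moreover have "c l \<le> vdeg n x"
          unfolding c_def using minimal_rational_basis_degree_le[OF b xM d dx] l by (simp add: Q_def)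
        ultimately show "l \<in> J" using l by (simp add: Q_def J_def)
      qed
      have finQ: "finite Q" by (simp add: Q_def)
      have coeff_rhs: "coeff (\<Sum>j<p. q j * b j i) D = (\<Sum>j<p. coeff (q j) (D - c j) * lc j i)"
        if D: "\<And>j. j \<in> Q \<Longrightarrow> degree (q j) + c j \<le> D" for D i
        unfolding coeff_sum
      proof (rule sum.cong)
        fix j assume "j \<in> {..<p}"
        then have j: "j < p" by simp
        show "coeff (q j * b j i) D = coeff (q j) (D - c j) * lc j i"
        proof (cases "q j = 0")
          case False
          then have "degree (q j) \<le> D - c j" "D = (D - c j) + c j" using D[of j] j by (auto simp: Q_def)
          then show ?thesis
            using coeff_mult_top[of "q j" "D - c j" "b j i" "c j"] degree_le_vdeg[OF supp[OF j], of i]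
            by (simp add: c_def lc_def top_coeffs_def)
        qed simp
      qed simp
      have deg_dx: "degree (d * x i) \<le> degree d + k" for i
        using degree_mult_le[of d "x i"] x_deg[of i] by linarith
      define T where "T = degree d + k"
      \<comment> \<open>At the largest degree \<open>D\<close> that occurs on the right-hand side, the coefficients are a nontrivial
        combination of leading coefficients, hence nonzero; so \<open>D\<close> is the degree of \<open>d * x\<close>.\<close>
      have T: "degree (q j) + c j \<le> T" if "j \<in> Q" for j
      proof (rule ccontr)
        assume not: "\<not> degree (q j) + c j \<le> T"
        define D where "D = Max ((\<lambda>j. degree (q j) + c j) ` Q)"
        have D_ge: "degree (q l) + c l \<le> D" if "l \<in> Q" for l
          unfolding D_def by (rule Max_ge) (use finQ that in auto)
        have "D \<in> (\<lambda>j. degree (q j) + c j) ` Q"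
          unfolding D_def by (rule Max_in) (use finQ that in auto)
        then obtain l where l: "l \<in> Q" "D = degree (q l) + c l" by blast
        have "T < D" using not D_ge[OF that] by simp
        then have "coeff (d * x i) D = 0" for i
          using deg_dx[of i] by (intro coeff_eq_0) (simp add: T_def)
        then have "(\<Sum>j<p. coeff (q j) (D - c j) * lc j i) = 0" for i
          using coeff_rhs[of D i, OF D_ge] by (simp add: dx)
        then have "coeff (q l) (D - c l) = 0"
          by (rule indep) (use l in \<open>simp add: Q_def\<close>)
        then show False using l by (simp add: Q_def)
      qed
      have "top_coeffs k x = (\<Sum>j\<in>Q. cscale (coeff (q j) (T - c j) / lead_coeff d) (lc j))"
      proof
        fix i
        have "lead_coeff d * coeff (x i) k = coeff (d * x i) T"
          unfolding T_def by (rule coeff_mult_top[symmetric]) (use x_deg in auto)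
        also have "\<dots> = (\<Sum>j<p. coeff (q j) (T - c j) * lc j i)"
          unfolding dx by (rule coeff_rhs[OF T])
        also have "\<dots> = (\<Sum>j\<in>Q. coeff (q j) (T - c j) * lc j i)"
          by (rule sum.mono_neutral_right) (auto simp: Q_def)
        finally have "coeff (x i) k = (\<Sum>j\<in>Q. coeff (q j) (T - c j) * lc j i) / lead_coeff d"
          using d by (simp add: field_simps)
        then show "top_coeffs k x i = (\<Sum>j\<in>Q. cscale (coeff (q j) (T - c j) / lead_coeff d) (lc j)) i"
          unfolding sum_fun_apply by (simp add: top_coeffs_def cscale_def sum_divide_distrib)
      qed
      also have "\<dots> \<in> cv.span (lc ` J)"
        by (intro cv.span_sum cv.span_scale cv.span_base) (use Q_sub in auto)
      finally show "top_coeffs k x \<in> cv.span (lc ` J)" .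
    qed
  qed
  then have "top_dim M k = card (lc ` J)"
    unfolding top_dim_def
    using cv.dim_span_eq_card_independent[OF cv.independent_family(2)[OF finJ indepJ]] by simp
  also have "\<dots> = card J"
    by (rule card_image[OF cv.independent_family(1)[OF finJ indepJ]])
  finally show ?thesis by (simp add: J_def c_def)
qed

section \<open>Divisibility of minors\<close>

text \<open>
  The rows of \<open>submatrix\<close> are listed in increasing order by \<open>pick\<close>; any other injective list of the
  same rows is a permutation of it.
\<close>

lemma injection_is_permuted_pick:
  assumes "inj_on f {..<q}"
  shows "\<exists>\<pi>. \<pi> permutes {0..<q} \<and> (\<forall>i<q. f i = pick (f ` {..<q}) (\<pi> i))"
proof -
  define I where "I = f ` {..<q}"
  define \<pi> where "\<pi> i = (if i < q then card {a \<in> I. a < f i} else i)" for i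
  have cardI: "card I = q" using card_image[OF assms] by (simp add: I_def)
  have pick: "f i = pick I (\<pi> i)" if "i < q" for i
    using that pick_card_in_set[of "f i" I] by (simp add: \<pi>_def I_def)
  have "\<pi> i < q" if "i < q" for i
  proof -
    have "{a \<in> I. a < f i} \<subset> I" using that by (auto simp: I_def)
    then have "card {a \<in> I. a < f i} < card I" by (rule psubset_card_mono[rotated]) (simp add: I_def)
    then show ?thesis using that cardI by (simp add: \<pi>_def)
  qed
  moreover have "inj_on \<pi> {0..<q}"
    using pick assms by (intro inj_onI) (metis atLeastLessThan_iff inj_onD lessThan_iff)
  moreover from calculation have "\<pi> ` {0..<q} = {0..<q}" by (intro endo_inj_surj) auto
  ultimately have "bij_betw \<pi> {0..<q} {0..<q}" by (simp add: bij_betw_def)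
  then have "\<pi> permutes {0..<q}" by (rule bij_imp_permutes) (simp add: \<pi>_def)
  with pick show ?thesis by (auto simp: I_def)
qed

lemma det_rows_not_inj:
  fixes F :: "nat \<Rightarrow> nat \<Rightarrow> 'r::comm_ring_1"
  assumes "\<not> inj_on f {..<q}"
  shows "det (mat q q (\<lambda>(i, j). F (f i) j)) = 0"
proof -
  obtain i i' where "i < q" "i' < q" "i \<noteq> i'" "f i = f i'" using assms by (auto simp: inj_on_def)
  then show ?thesis
    by (intro det_identical_rows[of _ q i i']) (auto intro!: eq_vecI)
qed

lemma det_rows_pick:
  fixes F :: "nat \<Rightarrow> nat \<Rightarrow> 'r::comm_ring_1"
  assumes "inj_on f {..<q}"
  shows "\<exists>c. det (mat q q (\<lambda>(i, j). F (f i) j)) = c * det (mat q q (\<lambda>(i, j). F (pick (f ` {..<q}) i) j))"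
proof -
  obtain \<pi> where \<pi>: "\<pi> permutes {0..<q}" "\<forall>i<q. f i = pick (f ` {..<q}) (\<pi> i)"
    using injection_is_permuted_pick[OF assms] by blast
  let ?B = "mat q q (\<lambda>(i, j). F (pick (f ` {..<q}) i) j)"
  have "mat q q (\<lambda>(i, j). F (f i) j) = mat q q (\<lambda>(i, j). ?B $$ (\<pi> i, j))"
    using \<pi> permutes_in_image[OF \<pi>(1)] by (intro eq_matI) auto
  then show ?thesis using det_permute_rows[of ?B q, OF _ \<pi>(1)] by auto
qed

lemma det_mat_transpose:
  "det (mat q q (\<lambda>(i, j). F j i)) = det (mat q q (\<lambda>(i, j). F i j :: 'r::comm_ring_1))"
  by (subst det_transpose[symmetric, of _ q]) (auto intro!: arg_cong[of _ _ det] eq_matI)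

text \<open>
  Minors whose rows and columns are listed by arbitrary functions, unordered or with repetitions, are
  zero or agree up to sign with a minor of the set \<open>minors q A\<close>. Being divisible by \<open>e = 0\<close> means to
  vanish, so statements of this form cover the rank as well as divisibility by powers of a prime.
\<close>

lemma dvd_minors_iff:
  fixes A :: "'r::comm_ring_1 mat"
  shows "(\<forall>x\<in>minors q A. e dvd x) \<longleftrightarrow>
    (\<forall>f g. (\<forall>i<q. f i < dim_row A) \<longrightarrow> (\<forall>j<q. g j < dim_col A) \<longrightarrow>
       e dvd det (mat q q (\<lambda>(i, j). A $$ (f i, g j))))" (is "_ = ?R")
proof
  assume L: "\<forall>x\<in>minors q A. e dvd x"
  show ?R
  proof (intro allI impI)
    fix f g :: "nat \<Rightarrow> nat"
    assume f: "\<forall>i<q. f i < dim_row A" and g: "\<forall>j<q. g j < dim_col A"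
    show "e dvd det (mat q q (\<lambda>(i, j). A $$ (f i, g j)))"
    proof (cases "inj_on f {..<q} \<and> inj_on g {..<q}")
      case False
      then have "det (mat q q (\<lambda>(i, j). A $$ (f i, g j))) = 0"
        using det_rows_not_inj[of f q "\<lambda>i j. A $$ (i, g j)"]
          det_rows_not_inj[of g q "\<lambda>j i. A $$ (f i, j)"] det_mat_transpose[of q "\<lambda>i j. A $$ (f i, g j)"]
        by auto
      then show ?thesis by simp
    next
      case True
      define I J where "I = f ` {..<q}" and "J = g ` {..<q}"
      have sub: "I \<subseteq> {..<dim_row A}" "J \<subseteq> {..<dim_col A}" using f g by (auto simp: I_def J_def)
      have cards: "card I = q" "card J = q" using True by (simp_all add: I_def J_def card_image)
      obtain c where c: "det (mat q q (\<lambda>(i, j). A $$ (f i, g j))) = c * det (mat q q (\<lambda>(i, j). A $$ (pick I i, g j)))"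
        using det_rows_pick[of f q "\<lambda>i j. A $$ (i, g j)"] True by (auto simp: I_def)
      obtain d where d: "det (mat q q (\<lambda>(j, i). A $$ (pick I i, g j))) = d * det (mat q q (\<lambda>(j, i). A $$ (pick I i, pick J j)))"
        using det_rows_pick[of g q "\<lambda>j i. A $$ (pick I i, j)"] True by (auto simp: J_def)
      have "{i. i < dim_row A \<and> i \<in> I} = I" "{i. i < dim_col A \<and> i \<in> J} = J" using sub by auto
      then have "submatrix A I J = mat q q (\<lambda>(i, j). A $$ (pick I i, pick J j))"
        by (simp add: submatrix_def cards)
      then have "det (mat q q (\<lambda>(i, j). A $$ (pick I i, pick J j))) \<in> minors q A"
        using sub cards unfolding minors_def mem_Collect_eq
        by (intro exI[of _ I] exI[of _ J]) simp
      then have "e dvd det (mat q q (\<lambda>(i, j). A $$ (pick I i, pick J j)))" using L by blast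
      then show ?thesis
        using c d det_mat_transpose[of q "\<lambda>i j. A $$ (pick I i, g j)"]
          det_mat_transpose[of q "\<lambda>i j. A $$ (pick I i, pick J j)"] by simp
    qed
  qed
next
  assume R: ?R
  show "\<forall>x\<in>minors q A. e dvd x"
  proof
    fix x assume "x \<in> minors q A"
    then obtain I J where IJ: "x = det (submatrix A I J)" "I \<subseteq> {..<dim_row A}" "J \<subseteq> {..<dim_col A}"
        "card I = q" "card J = q"
      by (auto simp: minors_def)
    have "{i. i < dim_row A \<and> i \<in> I} = I" "{i. i < dim_col A \<and> i \<in> J} = J" using IJ by auto
    then have "submatrix A I J = mat q q (\<lambda>(i, j). A $$ (pick I i, pick J j))"
      by (simp add: submatrix_def IJ)
    moreover have "pick I i < dim_row A" "pick J i < dim_col A" if "i < q" for i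
      using pick_in_set_le[of i I] pick_in_set_le[of i J] that IJ by auto
    ultimately show "e dvd x" using R IJ(1) by simp
  qed
qed

text \<open>
  By multilinearity in the rows, a minor of \<open>U * A\<close> is a combination of minors of \<open>A\<close>.
\<close>

lemma dvd_minors_mult_left:
  fixes A :: "'r::comm_ring_1 mat"
  assumes U: "U \<in> carrier_mat k m" and A: "A \<in> carrier_mat m n"
    and dvd: "\<forall>x\<in>minors q A. e dvd x"
  shows "\<forall>x\<in>minors q (U * A). e dvd x"
  unfolding dvd_minors_iff
proof (intro allI impI)
  fix f g :: "nat \<Rightarrow> nat"
  assume f: "\<forall>i<q. f i < dim_row (U * A)" and g: "\<forall>j<q. g j < dim_col (U * A)"
  define X where "X = mat q m (\<lambda>(i, l). U $$ (f i, l))"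
  define Y where "Y = mat m q (\<lambda>(l, j). A $$ (l, g j))"
  have X: "X \<in> carrier_mat q m" and Y: "Y \<in> carrier_mat m q" by (auto simp: X_def Y_def)
  have "mat q q (\<lambda>(i, j). (U * A) $$ (f i, g j)) = X * Y"
    using f g U A by (intro eq_matI) (auto simp: X_def Y_def scalar_prod_def)
  also have "det \<dots> = det (mat\<^sub>r q q (\<lambda>i. finsum_vec TYPE('r) q (\<lambda>l. X $$ (i, l) \<cdot>\<^sub>v row Y l) {0..<m}))"
    by (subst mat_mul_finsum_alt[OF X Y]) simp
  also have "\<dots> = (\<Sum>h | (\<forall>i\<in>{0..<q}. h i \<in> {0..<m}) \<and> (\<forall>i. i \<notin> {0..<q} \<longrightarrow> h i = i).
      det (mat\<^sub>r q q (\<lambda>i. X $$ (i, h i) \<cdot>\<^sub>v row Y (h i))))"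
    by (rule det_linear_rows_sum) (use Y in auto)
  also have "e dvd \<dots>"
  proof (rule dvd_sum)
    fix h assume h: "h \<in> {h. (\<forall>i\<in>{0..<q}. h i \<in> {0..<m}) \<and> (\<forall>i. i \<notin> {0..<q} \<longrightarrow> h i = i)}"
    have "det (mat\<^sub>r q q (\<lambda>i. X $$ (i, h i) \<cdot>\<^sub>v row Y (h i)))
        = (\<Prod>i\<in>{0..<q}. X $$ (i, h i)) * det (mat\<^sub>r q q (\<lambda>i. row Y (h i)))"
      by (rule det_rows_mul) (use Y h in auto)
    also have "mat\<^sub>r q q (\<lambda>i. row Y (h i)) = mat q q (\<lambda>(i, j). A $$ (h i, g j))"
      using h by (intro eq_matI) (auto simp: Y_def)
    also have "e dvd (\<Prod>i\<in>{0..<q}. X $$ (i, h i)) * det (mat q q (\<lambda>(i, j). A $$ (h i, g j)))"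
      using dvd[unfolded dvd_minors_iff] h g A by (intro dvd_mult) auto
    finally show "e dvd det (mat\<^sub>r q q (\<lambda>i. X $$ (i, h i) \<cdot>\<^sub>v row Y (h i)))" .
  qed
  finally show "e dvd det (mat q q (\<lambda>(i, j). (U * A) $$ (f i, g j)))" .
qed

lemma dvd_minors_transpose:
  fixes A :: "'r::comm_ring_1 mat"
  shows "(\<forall>x\<in>minors q (transpose_mat A). e dvd x) \<longleftrightarrow> (\<forall>x\<in>minors q A. e dvd x)"
proof -
  have "det (mat q q (\<lambda>(i, j). transpose_mat A $$ (f i, g j))) = det (mat q q (\<lambda>(i, j). A $$ (g i, f j)))"
    if "\<forall>i<q. f i < dim_col A" "\<forall>j<q. g j < dim_row A" for f g
  proof -
    have "mat q q (\<lambda>(i, j). transpose_mat A $$ (f i, g j)) = mat q q (\<lambda>(i, j). A $$ (g j, f i))"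
      using that by (intro eq_matI) auto
    then show ?thesis using det_mat_transpose[of q "\<lambda>i j. A $$ (g i, f j)"] by simp
  qed
  then show ?thesis unfolding dvd_minors_iff by auto
qed

lemma dvd_minors_mult_right:
  fixes A :: "'r::comm_ring_1 mat"
  assumes V: "V \<in> carrier_mat n k" and A: "A \<in> carrier_mat m n"
    and dvd: "\<forall>x\<in>minors q A. e dvd x"
  shows "\<forall>x\<in>minors q (A * V). e dvd x"
proof -
  have "\<forall>x\<in>minors q (transpose_mat V * transpose_mat A). e dvd x"
    by (rule dvd_minors_mult_left[of _ k n _ m]) (use V A dvd in \<open>auto simp: dvd_minors_transpose\<close>)
  then have "\<forall>x\<in>minors q (transpose_mat (A * V)). e dvd x"
    by (simp add: transpose_mult[OF A V])
  then show ?thesis by (simp only: dvd_minors_transpose)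
qed

lemma dvd_minors_smult:
  fixes A :: "'r::comm_ring_1 mat"
  assumes cancel: "\<And>x. e dvd c ^ q * x \<Longrightarrow> e dvd x"
    and dvd: "\<forall>x\<in>minors q (c \<cdot>\<^sub>m A). e dvd x"
  shows "\<forall>x\<in>minors q A. e dvd x"
  unfolding dvd_minors_iff
proof (intro allI impI)
  fix f g :: "nat \<Rightarrow> nat"
  assume fg: "\<forall>i<q. f i < dim_row A" "\<forall>j<q. g j < dim_col A"
  have "mat q q (\<lambda>(i, j). (c \<cdot>\<^sub>m A) $$ (f i, g j)) = c \<cdot>\<^sub>m mat q q (\<lambda>(i, j). A $$ (f i, g j))"
    using fg by (intro eq_matI) auto
  then have "det (mat q q (\<lambda>(i, j). (c \<cdot>\<^sub>m A) $$ (f i, g j))) = c ^ q * det (mat q q (\<lambda>(i, j). A $$ (f i, g j)))"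
    by simp
  moreover have "e dvd det (mat q q (\<lambda>(i, j). (c \<cdot>\<^sub>m A) $$ (f i, g j)))"
    proof -
    have "\<forall>i<q. f i < dim_row (c \<cdot>\<^sub>m A)" "\<forall>j<q. g j < dim_col (c \<cdot>\<^sub>m A)" using fg by auto
    then show ?thesis using dvd[unfolded dvd_minors_iff, THEN spec[of _ f], THEN spec[of _ g]] by blast
  qed
  ultimately have "e dvd c ^ q * det (mat q q (\<lambda>(i, j). A $$ (f i, g j)))" by (simp only:)
  then show "e dvd det (mat q q (\<lambda>(i, j). A $$ (f i, g j)))" by (rule cancel)
qed

lemma prime_elem_not_dvd_prod:
  fixes p :: "'r::comm_semiring_1"
  assumes "prime_elem p" "\<And>i. i \<in> I \<Longrightarrow> \<not> p dvd f i"
  shows "\<not> p dvd (\<Prod>i\<in>I. f i)"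
  using assms(2)
  by (induction I rule: infinite_finite_induct)
    (use assms(1) in \<open>auto simp: prime_elem_dvd_mult_iff prime_elem_not_unit\<close>)

text \<open>
  This replaces the invertibility of \<open>c\<close> in the localization at \<open>p\<close>.
\<close>

lemma prime_elem_power_cancel:
  fixes p :: "'r::idom"
  assumes p: "prime_elem p" and c: "\<not> p dvd c" and dvd: "p ^ j dvd c * x"
  shows "p ^ j dvd x"
  using dvd
proof (induction j arbitrary: x)
  case (Suc j)
  have "p dvd c * x" using Suc.prems by (metis dvd_trans dvd_triv_left power_Suc)
  then obtain y where y: "x = p * y" using p c by (auto simp: prime_elem_dvd_mult_iff)
  have "p * p ^ j dvd p * (c * y)" using Suc.prems y by (simp add: algebra_simps)
  then have "p ^ j dvd c * y" using p by (simp add: dvd_mult_cancel_left)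
  from Suc.IH[OF this] show ?case unfolding y by (simp add: mult_dvd_mono)
qed simp

text \<open>
  Equivalence of matrices over the localization at \<open>p\<close>: the transformations have entries in the ring
  itself, and they are invertible after localization because \<open>p\<close> does not divide their determinants.
\<close>

definition equivalent_off :: "'r::idom \<Rightarrow> 'r mat \<Rightarrow> 'r mat \<Rightarrow> bool" where
  "equivalent_off p A B \<longleftrightarrow> (\<exists>U V. U \<in> carrier_mat (dim_row A) (dim_row A) \<and>
     V \<in> carrier_mat (dim_col A) (dim_col A) \<and> \<not> p dvd det U \<and> \<not> p dvd det V \<and> B = U * A * V)"

lemma equivalent_offI:
  "A \<in> carrier_mat m n \<Longrightarrow> U \<in> carrier_mat m m \<Longrightarrow> V \<in> carrier_mat n n \<Longrightarrow>
    \<not> p dvd det U \<Longrightarrow> \<not> p dvd det V \<Longrightarrow> equivalent_off p A (U * A * V)"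
  unfolding equivalent_off_def by (intro exI[of _ U] exI[of _ V]) auto

lemma equivalent_off_carrier:
  "equivalent_off p A B \<Longrightarrow> A \<in> carrier_mat m n \<Longrightarrow> B \<in> carrier_mat m n"
  unfolding equivalent_off_def by auto

lemma mult_mat_two_sided:
  fixes A :: "'r::comm_ring_1 mat"
  assumes "A \<in> carrier_mat m n" "U \<in> carrier_mat m m" "V \<in> carrier_mat n n"
    and "U' \<in> carrier_mat m m" "V' \<in> carrier_mat n n"
  shows "U' * (U * A * V) * V' = (U' * U) * A * (V * V')"
proof -
  have "U' * (U * A * V) = U' * (U * A) * V"
    by (rule assoc_mult_mat[symmetric, of _ m m _ n _ n]) (use assms in auto)
  also have "U' * (U * A) = U' * U * A"
    by (rule assoc_mult_mat[symmetric, of _ m m _ m _ n]) (use assms in auto)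
  finally have "U' * (U * A * V) * V' = (U' * U * A) * V * V'" by simp
  also have "\<dots> = (U' * U) * A * (V * V')"
    by (rule assoc_mult_mat[of _ m n _ n _ n]) (use assms in auto)
  finally show ?thesis .
qed

lemma equivalent_off_trans:
  assumes p: "prime_elem p" and AB: "equivalent_off p A B" and BC: "equivalent_off p B C"
  shows "equivalent_off p A C"
proof -
  obtain m n where A: "A \<in> carrier_mat m n" by (rule that) auto
  have B: "B \<in> carrier_mat m n" using equivalent_off_carrier[OF AB A] .
  obtain U V where UV: "U \<in> carrier_mat m m" "V \<in> carrier_mat n n" "\<not> p dvd det U" "\<not> p dvd det V"
      "B = U * A * V"
    using AB A unfolding equivalent_off_def by auto
  obtain U' V' where UV': "U' \<in> carrier_mat m m" "V' \<in> carrier_mat n n" "\<not> p dvd det U'" "\<not> p dvd det V'"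
      "C = U' * B * V'"
    using BC B unfolding equivalent_off_def by auto
  have "C = (U' * U) * A * (V * V')"
    unfolding UV'(5) UV(5) by (rule mult_mat_two_sided[OF A UV(1,2) UV'(1,2)])
  moreover have "\<not> p dvd det (U' * U)" "\<not> p dvd det (V * V')"
    using UV UV' p by (simp_all add: det_mult[of _ m] det_mult[of _ n] prime_elem_dvd_mult_iff)
  ultimately show ?thesis
    using equivalent_offI[of A m n "U' * U" "V * V'" p] A UV UV' by simp
qed

text \<open>
  Inverts a transformation up to a scalar that is prime to \<open>p\<close> when both determinants are.
\<close>

lemma adj_mat_sandwich:
  fixes A :: "'r::comm_ring_1 mat"
  assumes A: "A \<in> carrier_mat m n" and U: "U \<in> carrier_mat m m" and V: "V \<in> carrier_mat n n"
  shows "adj_mat U * (U * A * V) * adj_mat V = (det U * det V) \<cdot>\<^sub>m A"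
proof -
  note aU = adj_mat[OF U] and aV = adj_mat[OF V]
  have "adj_mat U * (U * A * V) * adj_mat V = (adj_mat U * U) * A * (V * adj_mat V)"
    by (rule mult_mat_two_sided[OF A U V aU(1) aV(1)])
  also have "\<dots> = (det U * det V) \<cdot>\<^sub>m A"
  proof -
    have "(det U \<cdot>\<^sub>m 1\<^sub>m m) * A = det U \<cdot>\<^sub>m A"
      using A by (simp add: mult_smult_assoc_mat[of _ m m _ n])
    moreover have "(det U \<cdot>\<^sub>m A) * (det V \<cdot>\<^sub>m 1\<^sub>m n) = det V \<cdot>\<^sub>m (det U \<cdot>\<^sub>m A)"
      using A by (simp add: mult_smult_distrib[of _ m n _ n])
    ultimately show ?thesis
      unfolding aU(3) aV(2) using A by (intro eq_matI) (auto simp: ac_simps)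
  qed
  finally show ?thesis .
qed

text \<open>
  The assumption \<open>cancel\<close> holds for \<open>e = 0\<close> and for the powers of \<open>p\<close>.
\<close>

lemma equivalent_off_dvd_minors_iff:
  assumes eq: "equivalent_off p A B"
    and cancel: "\<And>c x. \<not> p dvd c \<Longrightarrow> e dvd c * x \<Longrightarrow> e dvd x"
    and p: "prime_elem p"
  shows "(\<forall>x\<in>minors q B. e dvd x) \<longleftrightarrow> (\<forall>x\<in>minors q A. e dvd x)"
proof -
  obtain m n where A: "A \<in> carrier_mat m n" by (rule that) auto
  obtain U V where UV: "U \<in> carrier_mat m m" "V \<in> carrier_mat n n" "\<not> p dvd det U" "\<not> p dvd det V"
      "B = U * A * V"
    using eq A unfolding equivalent_off_def by auto
  have B: "B \<in> carrier_mat m n" using UV A by simp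
  have pc: "\<not> p dvd (det U * det V) ^ q"
    using UV p by (meson prime_elem_dvd_mult_iff prime_elem_dvd_power)
  show ?thesis
  proof
    assume "\<forall>x\<in>minors q A. e dvd x"
    then show "\<forall>x\<in>minors q B. e dvd x"
      unfolding UV(5) using A UV
      by (intro dvd_minors_mult_right[of _ n n _ m] dvd_minors_mult_left[of _ m m _ n]) auto
  next
    assume "\<forall>x\<in>minors q B. e dvd x"
    then have "\<forall>x\<in>minors q (adj_mat U * B * adj_mat V). e dvd x"
      using B adj_mat(1)[OF UV(1)] adj_mat(1)[OF UV(2)]
      by (intro dvd_minors_mult_right[of _ n n _ m] dvd_minors_mult_left[of _ m m _ n]) auto
    then have "\<forall>x\<in>minors q ((det U * det V) \<cdot>\<^sub>m A). e dvd x"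
      unfolding UV(5) adj_mat_sandwich[OF A UV(1,2)] .
    then show "\<forall>x\<in>minors q A. e dvd x"
      by (rule dvd_minors_smult[rotated]) (rule cancel[OF pc])
  qed
qed

section \<open>Local Smith forms\<close>

lemma dvd_entries_mult_left:
  fixes A :: "'r::comm_ring_1 mat"
  assumes "U \<in> carrier_mat k m" "A \<in> carrier_mat m n" "\<forall>i<m. \<forall>j<n. e dvd A $$ (i, j)"
  shows "\<forall>i<k. \<forall>j<n. e dvd (U * A) $$ (i, j)"
  using assms by (auto simp: scalar_prod_def intro!: dvd_sum dvd_mult)

lemma dvd_entries_mult_right:
  fixes A :: "'r::comm_ring_1 mat"
  assumes "V \<in> carrier_mat n k" "A \<in> carrier_mat m n" "\<forall>i<m. \<forall>j<n. e dvd A $$ (i, j)"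
  shows "\<forall>i<m. \<forall>j<k. e dvd (A * V) $$ (i, j)"
  using assms by (auto simp: scalar_prod_def intro!: dvd_sum dvd_mult2)

lemma equivalent_off_dvd_entries:
  assumes "equivalent_off p A B" "A \<in> carrier_mat m n" "\<forall>i<m. \<forall>j<n. e dvd A $$ (i, j)"
  shows "\<forall>i<m. \<forall>j<n. e dvd B $$ (i, j)"
proof -
  obtain U V where UV: "U \<in> carrier_mat m m" "V \<in> carrier_mat n n" "B = U * A * V"
    using assms(1,2) unfolding equivalent_off_def by auto
  then show ?thesis
    using dvd_entries_mult_right[OF UV(2) mult_carrier_mat[OF UV(1) assms(2)]
        dvd_entries_mult_left[OF UV(1) assms(2,3)]] by simp
qed

lemma equivalent_off_refl: "prime_elem p \<Longrightarrow> equivalent_off p A A"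
  using equivalent_offI[of A "dim_row A" "dim_col A" "1\<^sub>m (dim_row A)" "1\<^sub>m (dim_col A)" p]
  by (simp add: prime_elem_not_unit)

lemma not_dvd_det_triangular:
  fixes U :: "'r::idom mat"
  assumes p: "prime_elem p" and U: "U \<in> carrier_mat m m"
    and tri: "\<And>i j. i < j \<Longrightarrow> j < m \<Longrightarrow> U $$ (i, j) = 0"
    and diag: "\<And>i. i < m \<Longrightarrow> \<not> p dvd U $$ (i, i)"
  shows "\<not> p dvd det U"
proof -
  have prod: "\<not> p dvd prod_list xs" if "\<And>x. x \<in> set xs \<Longrightarrow> \<not> p dvd x" for xs
    using that by (induction xs) (use p in \<open>auto simp: prime_elem_dvd_mult_iff prime_elem_not_unit\<close>)
  have "\<not> p dvd prod_list (diag_mat U)"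
    by (rule prod) (use diag U in \<open>auto simp: diag_mat_def\<close>)
  then show ?thesis by (subst det_lower_triangular[OF tri U])
qed

lemma not_dvd_det_swaprows_mat:
  fixes p :: "'r::idom"
  assumes "prime_elem p" "k < m" "l < m"
  shows "\<not> p dvd det (swaprows_mat m k l :: 'r mat)"
proof (cases "k = l")
  case True
  have "swaprows_mat m k l = (1\<^sub>m m :: 'r mat)"
    using True by (intro eq_matI) auto
  then show ?thesis using assms(1) by (simp add: prime_elem_not_unit)
next
  case False
  then show ?thesis using assms by (simp add: det_swaprows_mat prime_elem_not_unit)
qed

lemma equivalent_off_swap_to_corner:
  fixes A :: "'r::idom mat"
  assumes p: "prime_elem p" and A: "A \<in> carrier_mat m n" and ij: "i < m" "j < n"
  shows "\<exists>B. equivalent_off p A B \<and> B $$ (0, 0) = A $$ (i, j)"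
proof (intro exI conjI)
  let ?U = "swaprows_mat m 0 i" and ?V = "swaprows_mat n 0 j"
  have "swapcols 0 j (?U * A) = ?U * A * ?V"
    by (rule swapcols_mat[of _ m]) (use A ij in auto)
  moreover have "swaprows 0 i A = ?U * A"
    by (rule swaprows_mat) (use A ij in auto)
  ultimately have eq: "?U * A * ?V = swapcols 0 j (swaprows 0 i A)" by simp
  show "equivalent_off p A (?U * A * ?V)"
    using ij by (intro equivalent_offI[OF A] not_dvd_det_swaprows_mat[OF p]) auto
  show "(?U * A * ?V) $$ (0, 0) = A $$ (i, j)"
    unfolding eq using A ij by auto
qed

text \<open>
  With \<open>A\<close> equal to \<open>p\<close> to the power \<open>k\<close> times \<open>C\<close>, every row \<open>i\<close> but the first is replaced by
  \<open>u\<close> times itself minus \<open>C i 0\<close> times the first row, and likewise for columns. Multiplying by \<open>u\<close> instead of dividing by it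
  keeps the entries in the ring, and the determinant of the transformation is a power of \<open>u\<close>.
\<close>

lemma equivalent_off_pivot:
  fixes A :: "'r::idom mat"
  assumes p: "prime_elem p" and A: "A \<in> carrier_mat (Suc m) (Suc n)"
    and corner: "A $$ (0, 0) = p ^ k * u" and u: "\<not> p dvd u"
    and dvd: "\<forall>i<Suc m. \<forall>j<Suc n. p ^ k dvd A $$ (i, j)"
  shows "\<exists>A'. A' \<in> carrier_mat m n \<and>
    equivalent_off p A (four_block_mat (mat 1 1 (\<lambda>_. p ^ k * u)) (0\<^sub>m 1 n) (0\<^sub>m m 1) A')"
proof -
  define C where "C i j = (SOME c. A $$ (i, j) = p ^ k * c)" for i j
  have C: "A $$ (i, j) = p ^ k * C i j" if "i < Suc m" "j < Suc n" for i j
    using dvd that unfolding C_def dvd_def by (metis (mono_tags, lifting) someI_ex)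
  define U where "U = mat (Suc m) (Suc m) (\<lambda>(i, j). if i = 0 then (if j = 0 then 1 else 0)
      else if j = 0 then - C i 0 else if i = j then u else 0)"
  define V where "V = mat (Suc n) (Suc n) (\<lambda>(i, j). if j = 0 then (if i = 0 then 1 else 0)
      else if i = 0 then - C 0 j else if i = j then u else 0)"
  have UV: "U \<in> carrier_mat (Suc m) (Suc m)" "V \<in> carrier_mat (Suc n) (Suc n)"
    by (auto simp: U_def V_def)
  have detU: "\<not> p dvd det U"
    by (rule not_dvd_det_triangular[OF p UV(1)]) (use u p in \<open>auto simp: U_def prime_elem_not_unit\<close>)
  have "\<not> p dvd det (transpose_mat V)"
    by (rule not_dvd_det_triangular[OF p, of _ "Suc n"]) (use u p in \<open>auto simp: V_def prime_elem_not_unit\<close>)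
  then have detV: "\<not> p dvd det V" by (simp add: det_transpose[OF UV(2)])
  have UA: "(U * A) $$ (i, j) = (if i = 0 then A $$ (0, j) else u * A $$ (i, j) - C i 0 * A $$ (0, j))"
    if ij: "i < Suc m" "j < Suc n" for i j
  proof -
    have "(U * A) $$ (i, j) = (\<Sum>l\<in>{0..<Suc m}. U $$ (i, l) * A $$ (l, j))"
      using ij UV A by (auto simp: scalar_prod_def intro!: sum.cong)
    also have "\<dots> = U $$ (i, 0) * A $$ (0, j) + (\<Sum>l\<in>{0..<m}. U $$ (i, Suc l) * A $$ (Suc l, j))"
      by (subst sum.atLeast0_lessThan_Suc_shift) (simp add: comp_def)
    also have "(\<Sum>l\<in>{0..<m}. U $$ (i, Suc l) * A $$ (Suc l, j))
        = (\<Sum>l\<in>{0..<m}. if Suc l = i then u * A $$ (i, j) else 0)"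
      by (rule sum.cong) (use ij in \<open>auto simp: U_def\<close>)
    also have "\<dots> = (if i = 0 then 0 else u * A $$ (i, j))"
      using ij by (cases i) auto
    finally show ?thesis using ij by (auto simp: U_def)
  qed
  define B where "B = U * A"
  have B: "B \<in> carrier_mat (Suc m) (Suc n)" using UV A by (auto simp: B_def)
  have BV: "(B * V) $$ (i, j) = (if j = 0 then B $$ (i, 0) else u * B $$ (i, j) - C 0 j * B $$ (i, 0))"
    if ij: "i < Suc m" "j < Suc n" for i j
  proof -
    have "(B * V) $$ (i, j) = (\<Sum>l\<in>{0..<Suc n}. B $$ (i, l) * V $$ (l, j))"
      using ij UV B by (auto simp: scalar_prod_def intro!: sum.cong)
    also have "\<dots> = B $$ (i, 0) * V $$ (0, j) + (\<Sum>l\<in>{0..<n}. B $$ (i, Suc l) * V $$ (Suc l, j))"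
      by (subst sum.atLeast0_lessThan_Suc_shift) (simp add: comp_def)
    also have "(\<Sum>l\<in>{0..<n}. B $$ (i, Suc l) * V $$ (Suc l, j))
        = (\<Sum>l\<in>{0..<n}. if Suc l = j then u * B $$ (i, j) else 0)"
      by (rule sum.cong) (use ij in \<open>auto simp: V_def\<close>)
    also have "\<dots> = (if j = 0 then 0 else u * B $$ (i, j))"
      using ij by (cases j) auto
    finally show ?thesis using ij by (auto simp: V_def)
  qed
  define A' where "A' = mat m n (\<lambda>(i, j). (U * A * V) $$ (Suc i, Suc j))"
  have row0: "(U * A * V) $$ (0, j) = (if j = 0 then p ^ k * u else 0)" if "j < Suc n" for j
    using that BV[of 0 j] UA[of 0 0] UA[of 0 j] C[of 0 j] corner by (auto simp: B_def)
  have col0: "(U * A * V) $$ (i, 0) = (if i = 0 then p ^ k * u else 0)" if "i < Suc m" for i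
    using that BV[of i 0] UA[of i 0] C[of i 0] corner by (auto simp: B_def)
  have "four_block_mat (mat 1 1 (\<lambda>_. p ^ k * u)) (0\<^sub>m 1 n) (0\<^sub>m m 1) A' = U * A * V"
    (is "?F = _")
  proof (rule eq_matI)
    fix i j assume "i < dim_row (U * A * V)" "j < dim_col (U * A * V)"
    then have ij: "i < Suc m" "j < Suc n" using UV by auto
    show "?F $$ (i, j) = (U * A * V) $$ (i, j)"
      using row0[of j] col0[of i] ij
      by (cases i; cases j) (auto simp: A'_def)
  qed (use UV A in \<open>auto simp: A'_def\<close>)
  moreover have "A' \<in> carrier_mat m n" by (simp add: A'_def)
  ultimately show ?thesis using equivalent_offI[OF A UV detU detV] by auto
qed

lemma equivalent_off_block:
  fixes A :: "'r::idom mat"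
  assumes eq: "equivalent_off p A D" and A: "A \<in> carrier_mat m n" and b: "b \<in> carrier_mat 1 1"
  shows "equivalent_off p (four_block_mat b (0\<^sub>m 1 n) (0\<^sub>m m 1) A) (four_block_mat b (0\<^sub>m 1 n) (0\<^sub>m m 1) D)"
proof -
  obtain U V where UV: "U \<in> carrier_mat m m" "V \<in> carrier_mat n n" "\<not> p dvd det U" "\<not> p dvd det V"
      "D = U * A * V"
    using eq A unfolding equivalent_off_def by auto
  define U' where "U' = four_block_mat (1\<^sub>m 1) (0\<^sub>m 1 m) (0\<^sub>m m 1) U"
  define V' where "V' = four_block_mat (1\<^sub>m 1) (0\<^sub>m 1 n) (0\<^sub>m n 1) V"
  let ?F = "\<lambda>X. four_block_mat b (0\<^sub>m 1 n) (0\<^sub>m m 1) X"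
  have det: "det U' = det U" "det V' = det V"
    using UV unfolding U'_def V'_def by (subst det_four_block_mat_lower_left_zero; simp)+
  have 1: "U' * ?F A = ?F (U * A)"
    unfolding U'_def using UV A b by (subst mult_four_block_mat[of _ 1 1 _ m _ m _ _ 1 _ n]) auto
  have 2: "?F (U * A) * V' = ?F (U * A * V)"
    unfolding V'_def using UV A b by (subst mult_four_block_mat[of _ 1 1 _ n _ m _ _ 1 _ n]) auto
  have "equivalent_off p (?F A) (U' * ?F A * V')"
    by (rule equivalent_offI[of _ "Suc m" "Suc n"])
      (use UV A b det in \<open>auto simp: U'_def V'_def\<close>)
  then show ?thesis unfolding 1 2 UV(5) .
qed

definition local_smith_form :: "'r::idom \<Rightarrow> 'r mat \<Rightarrow> nat \<Rightarrow> (nat \<Rightarrow> nat) \<Rightarrow> (nat \<Rightarrow> 'r) \<Rightarrow> bool" where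
  "local_smith_form p A r e u \<longleftrightarrow> r \<le> dim_row A \<and> r \<le> dim_col A \<and>
     (\<forall>i j. i \<le> j \<longrightarrow> j < r \<longrightarrow> e i \<le> e j) \<and> (\<forall>i<r. \<not> p dvd u i) \<and>
     equivalent_off p A (mat (dim_row A) (dim_col A) (\<lambda>(i, j). if i = j \<and> i < r then p ^ e i * u i else 0))"

lemma prime_power_decomposition:
  fixes p a :: "'r::idom"
  assumes "\<exists>k. \<not> p ^ k dvd a"
  shows "\<exists>k u. a = p ^ k * u \<and> \<not> p dvd u"
proof -
  define k where "k = (LEAST k. \<not> p ^ k dvd a)"
  have k: "\<not> p ^ k dvd a" unfolding k_def using assms by (rule LeastI_ex)
  then obtain k' where k': "k = Suc k'" by (cases k) auto
  have "p ^ k' dvd a" using not_less_Least[of k' "\<lambda>k. \<not> p ^ k dvd a"] k' by (simp add: k_def)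
  then obtain u where u: "a = p ^ k' * u" by (elim dvdE)
  have "\<not> p dvd u" using k u k' by (auto simp: mult_dvd_mono)
  with u show ?thesis by blast
qed

lemma prime_power_dvd_cancel:
  fixes p u :: "'r::idom"
  assumes p: "prime_elem p" and u: "\<not> p dvd u" and dvd: "p ^ j dvd p ^ k * u"
  shows "j \<le> k"
proof (rule ccontr)
  assume "\<not> j \<le> k"
  then have "p ^ Suc k dvd p ^ k * u" using dvd by (meson dvd_trans le_imp_power_dvd not_less_eq_eq)
  then have "p dvd u" using p by (simp add: mult.commute)
  with u show False by simp
qed

text \<open>
  The pivot is an entry with the least power of \<open>p\<close>. This power divides all entries and keeps doing
  so under transformations, which is why the exponents do not decrease.
\<close>

theorem local_smith_form_exists:
  fixes p :: "'r::idom"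
  assumes p: "prime_elem p" and fin: "\<And>a. a \<noteq> 0 \<Longrightarrow> \<exists>k. \<not> p ^ k dvd a"
  shows "\<exists>r e u. local_smith_form p A r e u"
proof -
  have "\<exists>r e u. local_smith_form p A r e u" if "A \<in> carrier_mat m n" for A m n
    using that
  proof (induction m arbitrary: A n)
    case 0
    have "mat (dim_row A) (dim_col A) (\<lambda>(i, j). if i = j \<and> i < 0 then p ^ e i * u i else 0) = A" for e u
      using 0 by (intro eq_matI) auto
    then have "local_smith_form p A 0 (\<lambda>_. 0) (\<lambda>_. 1)"
      using equivalent_off_refl[OF p, of A] by (simp add: local_smith_form_def)
    then show ?case by blast
  next
    case (Suc m)
    note A = Suc.prems
    show ?case
    proof (cases "\<forall>i<Suc m. \<forall>j<n. A $$ (i, j) = 0")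
      case True
      have "mat (dim_row A) (dim_col A) (\<lambda>(i, j). if i = j \<and> i < 0 then p ^ e i * u i else 0) = A" for e u
        using A True by (intro eq_matI) auto
      then have "local_smith_form p A 0 (\<lambda>_. 0) (\<lambda>_. 1)"
        using equivalent_off_refl[OF p, of A] by (simp add: local_smith_form_def)
      then show ?thesis by blast
    next
      case False
      define Q where "Q k \<longleftrightarrow> (\<exists>i<Suc m. \<exists>j<n. \<exists>u. A $$ (i, j) = p ^ k * u \<and> \<not> p dvd u)" for k
      have decomp: "\<exists>k u. A $$ (i, j) = p ^ k * u \<and> \<not> p dvd u" if "A $$ (i, j) \<noteq> 0" for i j
        using prime_power_decomposition[OF fin[OF that]] .
      obtain k0 where "Q k0" using False decomp unfolding Q_def by blast
      define k where "k = (LEAST k. Q k)"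
      have "Q k" unfolding k_def using \<open>Q k0\<close> by (rule LeastI)
      then obtain i j u where ij: "i < Suc m" "j < n" "A $$ (i, j) = p ^ k * u" "\<not> p dvd u"
        unfolding Q_def by blast
      have dvdA: "\<forall>i<Suc m. \<forall>j<n. p ^ k dvd A $$ (i, j)"
      proof (intro allI impI)
        fix i j assume "i < Suc m" "j < n"
        show "p ^ k dvd A $$ (i, j)"
        proof (cases "A $$ (i, j) = 0")
          case False
          then obtain k' u' where k': "A $$ (i, j) = p ^ k' * u'" "\<not> p dvd u'" using decomp by blast
          then have "Q k'" using \<open>i < Suc m\<close> \<open>j < n\<close> unfolding Q_def by blast
          then have "k \<le> k'" unfolding k_def by (rule Least_le)
          then show ?thesis unfolding k'(1) by (intro dvd_mult2 le_imp_power_dvd)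
        qed simp
      qed
      obtain n' where n': "n = Suc n'" using ij(2) by (cases n) auto
      obtain B where B: "equivalent_off p A B" "B $$ (0, 0) = p ^ k * u"
        using equivalent_off_swap_to_corner[OF p A ij(1,2)] ij(3) by auto
      have Bc: "B \<in> carrier_mat (Suc m) (Suc n')" using equivalent_off_carrier[OF B(1) A] n' by simp
      obtain A' where A': "A' \<in> carrier_mat m n'"
        and BA': "equivalent_off p B (four_block_mat (mat 1 1 (\<lambda>_. p ^ k * u)) (0\<^sub>m 1 n') (0\<^sub>m m 1) A')"
          (is "equivalent_off p B ?F")
        using equivalent_off_pivot[OF p Bc B(2) ij(4)] equivalent_off_dvd_entries[OF B(1) A dvdA] n' by auto
      have dvdF: "\<forall>i<Suc m. \<forall>j<Suc n'. p ^ k dvd ?F $$ (i, j)"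
        using equivalent_off_dvd_entries[OF equivalent_off_trans[OF p B(1) BA'] A dvdA] n' by simp
      have dvdA': "\<forall>i<m. \<forall>j<n'. p ^ k dvd A' $$ (i, j)"
      proof (intro allI impI)
        fix i j assume "i < m" "j < n'"
        then have "?F $$ (Suc i, Suc j) = A' $$ (i, j)" using A' by simp
        with dvdF \<open>i < m\<close> \<open>j < n'\<close> show "p ^ k dvd A' $$ (i, j)" by (metis Suc_less_eq)
      qed
      obtain r' e' u' where sm: "local_smith_form p A' r' e' u'" using Suc.IH[OF A'] by blast
      define D' where "D' = mat m n' (\<lambda>(i, j). if i = j \<and> i < r' then p ^ e' i * u' i else 0)"
      have D': "equivalent_off p A' D'" "r' \<le> m" "r' \<le> n'" "\<forall>i j. i \<le> j \<longrightarrow> j < r' \<longrightarrow> e' i \<le> e' j"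
          "\<forall>i<r'. \<not> p dvd u' i"
        using sm A' by (auto simp: local_smith_form_def D'_def)
      have k_le: "k \<le> e' i" if "i < r'" for i
      proof -
        have "p ^ k dvd D' $$ (i, i)"
          using equivalent_off_dvd_entries[OF D'(1) A' dvdA'] that D'(2,3) by auto
        then have "p ^ k dvd p ^ e' i * u' i" using that D'(2,3) by (simp add: D'_def)
        then show ?thesis using prime_power_dvd_cancel[OF p] D'(5) that by blast
      qed
      define e where "e = case_nat k e'"
      define w where "w = case_nat u u'"
      let ?G = "four_block_mat (mat 1 1 (\<lambda>_. p ^ k * u)) (0\<^sub>m 1 n') (0\<^sub>m m 1) D'"
      have "equivalent_off p ?F ?G" by (rule equivalent_off_block[OF D'(1) A']) simp
      then have "equivalent_off p A ?G" using B(1) BA' equivalent_off_trans[OF p] by blast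
      moreover have "?G = mat (dim_row A) (dim_col A) (\<lambda>(i, j). if i = j \<and> i < Suc r' then p ^ e i * w i else 0)"
        using A n' by (intro eq_matI) (auto simp: D'_def e_def w_def split: nat.splits)
      moreover have "\<forall>i j. i \<le> j \<longrightarrow> j < Suc r' \<longrightarrow> e i \<le> e j"
        using k_le D'(4) by (auto simp: e_def split: nat.splits)
      moreover have "\<forall>i<Suc r'. \<not> p dvd w i"
        using D'(5) ij(4) by (auto simp: w_def split: nat.splits)
      ultimately have "local_smith_form p A (Suc r') e w"
        using A D'(2,3) n' by (simp add: local_smith_form_def)
      then show ?thesis by blast
    qed
  qed
  then show ?thesis by (metis carrier_matI)
qed

section \<open>Local Smith forms under a rank-one perturbation\<close>

lemma sum_initial_le_sum_injective:
  fixes e :: "nat \<Rightarrow> nat"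
  assumes mono: "\<forall>i j. i \<le> j \<longrightarrow> j < r \<longrightarrow> e i \<le> e j"
    and I: "finite I" "I \<subseteq> {..<r}" "card I = q"
  shows "(\<Sum>i<q. e i) \<le> (\<Sum>i\<in>I. e i)"
  using I
proof (induction q arbitrary: I)
  case (Suc q)
  then have ne: "I \<noteq> {}" by auto
  define x where "x = Max I"
  have x: "x \<in> I" using Suc.prems(1) ne by (simp add: x_def)
  have "I \<subseteq> {..x}" using Suc.prems(1) by (auto simp: x_def)
  then have "card I \<le> card {..x}" by (intro card_mono) auto
  then have "q \<le> x" using Suc.prems(3) by simp
  moreover have "x < r" using x Suc.prems(2) by auto
  ultimately have "e q \<le> e x" using mono by blast
  moreover have "(\<Sum>i<q. e i) \<le> (\<Sum>i\<in>I - {x}. e i)"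
    by (rule Suc.IH) (use Suc.prems x in auto)
  moreover have "(\<Sum>i\<in>I. e i) = e x + (\<Sum>i\<in>I - {x}. e i)"
    by (rule sum.remove) (use Suc.prems x in auto)
  ultimately show ?case by simp
qed simp

lemma det_scale_rows:
  fixes c :: "nat \<Rightarrow> 'r::comm_ring_1"
  shows "det (mat q q (\<lambda>(i, j). c i * F i j)) = (\<Prod>i<q. c i) * det (mat q q (\<lambda>(i, j). F i j))"
proof -
  let ?a = "\<lambda>i. vec q (\<lambda>j. F i j)"
  have "mat q q (\<lambda>(i, j). c i * F i j) = mat\<^sub>r q q (\<lambda>i. c i \<cdot>\<^sub>v ?a i)"
    by (intro eq_matI) auto
  moreover have "mat q q (\<lambda>(i, j). F i j) = mat\<^sub>r q q ?a"
    by (intro eq_matI) auto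
  ultimately show ?thesis
    using det_rows_mul[of ?a q c] by (simp add: atLeast0LessThan)
qed

lemma det_diagonal:
  fixes c :: "nat \<Rightarrow> 'r::comm_ring_1"
  shows "det (mat q q (\<lambda>(i, j). if i = j then c i else 0)) = (\<Prod>i<q. c i)"
proof -
  have "mat q q (\<lambda>(i, j). if i = j then c i else 0) = mat q q (\<lambda>(i, j). c i * (if i = j then 1 else 0))"
    by (intro eq_matI) auto
  moreover have "mat q q (\<lambda>(i, j). if i = j then 1 else 0) = (1\<^sub>m q :: 'r mat)"
    by (intro eq_matI) auto
  ultimately show ?thesis using det_scale_rows[of q c "\<lambda>i j. if i = j then 1 else 0"] by simp
qed

text \<open>
  A minor of a diagonal matrix is the product of the diagonal entries of the selected rows, times the
  minor of the identity matrix. The smallest power of \<open>p\<close> occurs in the leading minor.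
\<close>

lemma dvd_minors_diagonal_iff:
  fixes p :: "'r::idom"
  assumes p: "prime_elem p" and r: "r \<le> m" "r \<le> n"
    and mono: "\<forall>i j. i \<le> j \<longrightarrow> j < r \<longrightarrow> e i \<le> e j" and u: "\<forall>i<r. \<not> p dvd u i"
  defines "D \<equiv> mat m n (\<lambda>(i, j). if i = j \<and> i < r then p ^ e i * u i else 0)"
  shows "r < q \<Longrightarrow> \<forall>x\<in>minors q D. 0 dvd x"
    and "q \<le> r \<Longrightarrow> (\<forall>x\<in>minors q D. p ^ k dvd x) \<longleftrightarrow> k \<le> (\<Sum>i<q. e i)"
proof -
  define d where "d i = (if i < r then p ^ e i * u i else 0)" for i
  have minor: "det (mat q q (\<lambda>(i, j). D $$ (f i, g j)))
      = (\<Prod>i<q. d (f i)) * det (mat q q (\<lambda>(i, j). if f i = g j then 1 else 0))"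
    if fg: "\<forall>i<q. f i < dim_row D" "\<forall>j<q. g j < dim_col D" for f g q
  proof -
    have "mat q q (\<lambda>(i, j). D $$ (f i, g j)) = mat q q (\<lambda>(i, j). d (f i) * (if f i = g j then 1 else 0))"
      using fg by (intro eq_matI) (auto simp: D_def d_def)
    then show ?thesis by (simp only: det_scale_rows)
  qed
  have not_inj: "det (mat q q (\<lambda>(i, j). D $$ (f i, g j))) = 0" if "\<not> inj_on f {..<q}" for f g q
    by (rule det_rows_not_inj[OF that])
  show "\<forall>x\<in>minors q D. 0 dvd x" if q: "r < q"
    unfolding dvd_minors_iff
  proof (intro allI impI)
    fix f g assume fg: "\<forall>i<q. f i < dim_row D" "\<forall>j<q. g j < dim_col D"
    show "0 dvd det (mat q q (\<lambda>(i, j). D $$ (f i, g j)))"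
    proof (cases "inj_on f {..<q}")
      case True
      have "\<not> f ` {..<q} \<subseteq> {..<r}"
      proof
        assume "f ` {..<q} \<subseteq> {..<r}"
        then have "card (f ` {..<q}) \<le> card {..<r}" by (intro card_mono) auto
        then show False using q by (simp add: card_image[OF True])
      qed
      then obtain i where "i < q" "\<not> f i < r" by auto
      then have "(\<Prod>i<q. d (f i)) = 0" by (intro prod_zero) (auto simp: d_def)
      then show ?thesis unfolding minor[OF fg] by simp
    qed (simp add: not_inj)
  qed
  show "(\<forall>x\<in>minors q D. p ^ k dvd x) \<longleftrightarrow> k \<le> (\<Sum>i<q. e i)" if q: "q \<le> r"
  proof
    assume dvd: "\<forall>x\<in>minors q D. p ^ k dvd x"
    have fg: "\<forall>i<q. i < dim_row D" "\<forall>j<q. j < dim_col D" using q r by (auto simp: D_def)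
    have "mat q q (\<lambda>(i, j). D $$ (i, j)) = mat q q (\<lambda>(i, j). if i = j then d i else 0)"
      using q r by (intro eq_matI) (auto simp: D_def d_def)
    then have "det (mat q q (\<lambda>(i, j). D $$ (i, j))) = (\<Prod>i<q. d i)"
      by (simp only: det_diagonal)
    also have "\<dots> = (\<Prod>i<q. p ^ e i * u i)"
      by (rule prod.cong) (use q in \<open>auto simp: d_def\<close>)
    also have "\<dots> = p ^ (\<Sum>i<q. e i) * (\<Prod>i<q. u i)"
      by (simp add: prod.distrib power_sum)
    finally have "p ^ k dvd p ^ (\<Sum>i<q. e i) * (\<Prod>i<q. u i)"
      using dvd[unfolded dvd_minors_iff, THEN spec[of _ "\<lambda>i. i"], THEN spec[of _ "\<lambda>i. i"]] fg by simp
    moreover have "\<not> p dvd (\<Prod>i<q. u i)"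
      by (rule prime_elem_not_dvd_prod[OF p]) (use u q in auto)
    ultimately show "k \<le> (\<Sum>i<q. e i)" using prime_power_dvd_cancel[OF p] by blast
  next
    assume k: "k \<le> (\<Sum>i<q. e i)"
    show "\<forall>x\<in>minors q D. p ^ k dvd x"
      unfolding dvd_minors_iff
    proof (intro allI impI)
      fix f g assume fg: "\<forall>i<q. f i < dim_row D" "\<forall>j<q. g j < dim_col D"
      show "p ^ k dvd det (mat q q (\<lambda>(i, j). D $$ (f i, g j)))"
      proof (cases "inj_on f {..<q} \<and> f ` {..<q} \<subseteq> {..<r}")
        case True
        have "k \<le> (\<Sum>i\<in>f ` {..<q}. e i)"
          using k sum_initial_le_sum_injective[OF mono, of "f ` {..<q}" q] True
          by (simp add: card_image)
        also have "\<dots> = (\<Sum>i<q. e (f i))" using True by (simp add: sum.reindex)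
        finally have "p ^ k dvd p ^ (\<Sum>i<q. e (f i))" by (rule le_imp_power_dvd)
        also have "\<dots> dvd p ^ (\<Sum>i<q. e (f i)) * (\<Prod>i<q. u (f i))" by simp
        also have "\<dots> = (\<Prod>i<q. p ^ e (f i) * u (f i))" by (simp add: prod.distrib power_sum)
        also have "\<dots> = (\<Prod>i<q. d (f i))" by (rule prod.cong) (use True in \<open>auto simp: d_def\<close>)
        finally show ?thesis unfolding minor[OF fg] by simp
      next
        case False
        then consider "\<not> inj_on f {..<q}" | i where "i < q" "\<not> f i < r" by auto
        then show ?thesis
        proof cases
          case 2
          then have "(\<Prod>i<q. d (f i)) = 0" by (intro prod_zero) (auto simp: d_def)
          then show ?thesis unfolding minor[OF fg] by (simp only: mult_zero_left dvd_0_right)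
        qed (simp add: not_inj)
      qed
    qed
  qed
qed

lemma local_smith_form_minors:
  fixes p :: "'r::idom"
  assumes p: "prime_elem p" and A: "local_smith_form p A r e u"
  shows "r < q \<Longrightarrow> x \<in> minors q A \<Longrightarrow> x = 0"
    and "q \<le> r \<Longrightarrow> (\<forall>x\<in>minors q A. p ^ k dvd x) \<longleftrightarrow> k \<le> (\<Sum>i<q. e i)"
    and "q \<le> r \<Longrightarrow> \<exists>x\<in>minors q A. x \<noteq> 0"
proof -
  define D where "D = mat (dim_row A) (dim_col A) (\<lambda>(i, j). if i = j \<and> i < r then p ^ e i * u i else 0)"
  have eq: "equivalent_off p A D" and r: "r \<le> dim_row A" "r \<le> dim_col A"
    and mono: "\<forall>i j. i \<le> j \<longrightarrow> j < r \<longrightarrow> e i \<le> e j" and u: "\<forall>i<r. \<not> p dvd u i"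
    using A by (auto simp: local_smith_form_def D_def)
  note minors_D = dvd_minors_diagonal_iff[OF p r mono u, folded D_def]
  have "(\<forall>x\<in>minors q D. 0 dvd x) \<longleftrightarrow> (\<forall>x\<in>minors q A. 0 dvd x)" for q
    by (rule equivalent_off_dvd_minors_iff[OF eq _ p]) auto
  then show "r < q \<Longrightarrow> x \<in> minors q A \<Longrightarrow> x = 0"
    using minors_D(1) by (metis dvd_0_left_iff)
  have power: "(\<forall>x\<in>minors q D. p ^ k dvd x) \<longleftrightarrow> (\<forall>x\<in>minors q A. p ^ k dvd x)" for k
    by (rule equivalent_off_dvd_minors_iff[OF eq _ p]) (rule prime_elem_power_cancel[OF p])
  show iff: "(\<forall>x\<in>minors q A. p ^ k dvd x) \<longleftrightarrow> k \<le> (\<Sum>i<q. e i)" if "q \<le> r" for k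
    using minors_D(2)[OF that] power by simp
  show "\<exists>x\<in>minors q A. x \<noteq> 0" if "q \<le> r"
    using iff[OF that, of "Suc (\<Sum>i<q. e i)"] by (metis dvd_0_right not_less_eq_eq order_refl)
qed

text \<open>
  Every permutation other than the identity meets an entry off the diagonal.
\<close>

lemma dvd_det_minus_diagonal:
  fixes F :: "'r::comm_ring_1 mat"
  assumes F: "F \<in> carrier_mat N N" and off: "\<And>i j. i < N \<Longrightarrow> j < N \<Longrightarrow> i \<noteq> j \<Longrightarrow> p dvd F $$ (i, j)"
  shows "p dvd det F - (\<Prod>i<N. F $$ (i, i))"
proof -
  let ?P = "{\<pi>. \<pi> permutes {0..<N}}"
  let ?t = "\<lambda>\<pi>. signof \<pi> * (\<Prod>i = 0..<N. F $$ (i, \<pi> i))"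
  have fin: "finite ?P" by (rule finite_permutations) simp
  have "det F = (\<Sum>\<pi>\<in>?P. ?t \<pi>)" by (rule det_def'[OF F])
  also have "\<dots> = ?t id + (\<Sum>\<pi>\<in>?P - {id}. ?t \<pi>)"
    by (rule sum.remove[OF fin]) (simp add: permutes_id)
  also have "?t id = (\<Prod>i<N. F $$ (i, i))" by (simp add: atLeast0LessThan)
  finally have "det F - (\<Prod>i<N. F $$ (i, i)) = (\<Sum>\<pi>\<in>?P - {id}. ?t \<pi>)"
    by (simp only: add_diff_cancel_left')
  moreover have "p dvd (\<Sum>\<pi>\<in>?P - {id}. ?t \<pi>)"
  proof (rule dvd_sum)
    fix \<pi> assume \<pi>: "\<pi> \<in> ?P - {id}"
    then obtain i where i: "\<pi> i \<noteq> i" by (auto simp: fun_eq_iff)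
    then have iN: "i \<in> {0..<N}" using \<pi> by (auto dest: permutes_not_in)
    then have "\<pi> i < N" using \<pi> permutes_in_image[of \<pi> "{0..<N}" i] by auto
    then have "p dvd F $$ (i, \<pi> i)" using off[of i "\<pi> i"] i iN by auto
    also have "\<dots> dvd (\<Prod>i = 0..<N. F $$ (i, \<pi> i))"
      by (rule dvd_prodI) (use iN in auto)
    finally show "p dvd ?t \<pi>" by simp
  qed
  ultimately show ?thesis by simp
qed

text \<open>
  More than \<open>k\<close> rows selected among \<open>k\<close> contain a repetition.
\<close>

lemma minors_mult_inner_dim:
  fixes X :: "'r::comm_ring_1 mat"
  assumes X: "X \<in> carrier_mat m k" and Y: "Y \<in> carrier_mat k n" and q: "k < q" and x: "x \<in> minors q (X * Y)"
  shows "x = 0"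
proof -
  have "\<forall>x\<in>minors q Y. 0 dvd x"
    unfolding dvd_minors_iff
  proof (intro allI impI)
    fix f g :: "nat \<Rightarrow> nat" assume f: "\<forall>i<q. f i < dim_row Y"
    have "\<not> inj_on f {..<q}"
    proof
      assume inj: "inj_on f {..<q}"
      have "card (f ` {..<q}) \<le> card {..<k}" using f Y by (intro card_mono) auto
      then show False using q by (simp add: card_image[OF inj])
    qed
    then show "0 dvd det (mat q q (\<lambda>(i, j). Y $$ (f i, g j)))" using det_rows_not_inj[of f q "\<lambda>i j. Y $$ (i, g j)"] by simp
  qed
  then show ?thesis using dvd_minors_mult_left[OF X Y, of q 0] x by auto
qed

lemma index_mult_mat_sum:
  assumes "A \<in> carrier_mat m k" "B \<in> carrier_mat k n" "i < m" "j < n"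
  shows "(A * B) $$ (i, j) = (\<Sum>l\<in>{0..<k}. A $$ (i, l) * B $$ (l, j))"
  using assms by (auto simp: scalar_prod_def intro!: sum.cong)

text \<open>
  Let \<open>\<nu>\<close> be the number of exponents of \<open>A\<close> below \<open>k\<close>. Modulo \<open>p\<close> to the power \<open>k\<close> and up to a
  factor \<open>c\<close> prime to \<open>p\<close>, the diagonal form of \<open>A\<close> has only \<open>\<nu>\<close> nonzero entries, so \<open>A\<close> is a product
  with inner dimension \<open>\<nu>\<close>, and \<open>B\<close> is a product with inner dimension \<open>\<nu> + 1\<close>. If \<open>B\<close> had
  \<open>\<nu> + 2\<close> exponents below \<open>k\<close>, the corresponding leading minor of its diagonal form would, after the
  powers of \<open>p\<close> are taken out of the rows, be prime to \<open>p\<close> and zero at the same time.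
\<close>

theorem rank_one_perturbation_local_smith_form:
  fixes p :: "'r::idom"
  assumes p: "prime_elem p" and A: "A \<in> carrier_mat m n" and B: "B \<in> carrier_mat m n"
    and AB: "\<And>i j. i < m \<Longrightarrow> j < n \<Longrightarrow> B $$ (i, j) = A $$ (i, j) + a i * b j"
    and sA: "local_smith_form p A r e u" and sB: "local_smith_form p B r' e' u'"
  shows "card {i. i < r' \<and> e' i < k} \<le> card {i. i < r \<and> e i < k} + 1"
proof (rule ccontr)
  assume contra: "\<not> ?thesis"
  define \<nu> where "\<nu> = card {i. i < r \<and> e i < k}"
  define N where "N = \<nu> + 2"
  have big: "N \<le> card {i. i < r' \<and> e' i < k}" using contra by (simp add: N_def \<nu>_def)
  define D where "D = mat m n (\<lambda>(i, j). if i = j \<and> i < r then p ^ e i * u i else 0)"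
  define D' where "D' = mat m n (\<lambda>(i, j). if i = j \<and> i < r' then p ^ e' i * u' i else 0)"
  have r: "r \<le> m" "r \<le> n" and mono: "\<And>i j. i \<le> j \<Longrightarrow> j < r \<Longrightarrow> e i \<le> e j"
    using sA A by (auto simp: local_smith_form_def)
  have r': "r' \<le> m" "r' \<le> n" and mono': "\<And>i j. i \<le> j \<Longrightarrow> j < r' \<Longrightarrow> e' i \<le> e' j"
    and u': "\<And>i. i < r' \<Longrightarrow> \<not> p dvd u' i"
    using sB B by (auto simp: local_smith_form_def)
  obtain U V where UV: "U \<in> carrier_mat m m" "V \<in> carrier_mat n n" "\<not> p dvd det U" "\<not> p dvd det V"
      "D = U * A * V"
    using sA A unfolding local_smith_form_def equivalent_off_def D_def by auto
  obtain U' V' where UV': "U' \<in> carrier_mat m m" "V' \<in> carrier_mat n n" "D' = U' * B * V'"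
    using sB B unfolding local_smith_form_def equivalent_off_def D'_def by auto
  define c where "c = det U * det V"
  have c: "\<not> p dvd c" using UV p by (simp add: c_def prime_elem_dvd_mult_iff)
  have small': "i < r' \<and> e' i < k" if "i < N" for i
  proof (rule ccontr)
    assume not: "\<not> ?thesis"
    have "{i. i < r' \<and> e' i < k} \<subseteq> {..<i}"
      using not mono' by (auto simp: not_less) (meson le_less_trans not_le order_trans)
    then have "card {i. i < r' \<and> e' i < k} \<le> card {..<i}" by (intro card_mono) auto
    then show False using big that by simp
  qed
  have large: "k \<le> e l" if "\<nu> \<le> l" "l < r" for l
  proof (rule ccontr)
    assume "\<not> k \<le> e l"
    then have "{..l} \<subseteq> {i. i < r \<and> e i < k}"
      using mono[OF _ that(2)] that by (auto simp: not_le intro: le_less_trans)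
    then have "card {..l} \<le> \<nu>" unfolding \<nu>_def by (intro card_mono) auto
    then show False using that by simp
  qed
  define X where "X = adj_mat U"
  define Y where "Y = adj_mat V"
  have XY: "X \<in> carrier_mat m m" "Y \<in> carrier_mat n n"
    using adj_mat(1) UV by (auto simp: X_def Y_def)
  define d where "d l = (if l < r then p ^ e l * u l else 0)" for l
  have cA: "c * A $$ (i, j) = (\<Sum>l<r. X $$ (i, l) * d l * Y $$ (l, j))" if ij: "i < m" "j < n" for i j
  proof -
    have XD: "(X * D) $$ (i, l) = (if l < r then X $$ (i, l) * d l else 0)" if l: "l < n" for l
    proof -
      have "(X * D) $$ (i, l) = (\<Sum>l'\<in>{0..<m}. X $$ (i, l') * D $$ (l', l))"
        using ij l XY by (auto simp: D_def scalar_prod_def intro!: sum.cong)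
      also have "\<dots> = (\<Sum>l'\<in>{0..<m}. if l' = l then if l < r then X $$ (i, l) * d l else 0 else 0)"
        by (rule sum.cong) (use l in \<open>auto simp: D_def d_def\<close>)
      also have "\<dots> = (if l < r then X $$ (i, l) * d l else 0)" using r by auto
      finally show ?thesis .
    qed
    have XDc: "X * D \<in> carrier_mat m n" using XY by (auto simp: D_def)
    have "c * A $$ (i, j) = (X * D * Y) $$ (i, j)"
      using adj_mat_sandwich[OF A UV(1,2)] ij A by (simp add: X_def Y_def UV(5) c_def)
    also have "\<dots> = (\<Sum>l\<in>{0..<n}. (X * D) $$ (i, l) * Y $$ (l, j))"
      by (rule index_mult_mat_sum[OF XDc XY(2) ij])
    also have "\<dots> = (\<Sum>l\<in>{0..<n}. if l < r then X $$ (i, l) * d l * Y $$ (l, j) else 0)"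
      by (rule sum.cong) (use XD in auto)
    also have "\<dots> = (\<Sum>l<r. X $$ (i, l) * d l * Y $$ (l, j))"
      using r by (intro sum.mono_neutral_cong_right) auto
    finally show ?thesis .
  qed
  \<comment> \<open>The last column of \<open>P\<close> and the last row of \<open>Q\<close> carry the perturbation.\<close>
  define P where "P = mat m (Suc \<nu>) (\<lambda>(i, l). if l < \<nu> then X $$ (i, l) * d l else c * a i)"
  define Q where "Q = mat (Suc \<nu>) n (\<lambda>(l, j). if l < \<nu> then Y $$ (l, j) else b j)"
  have PQ: "P \<in> carrier_mat m (Suc \<nu>)" "Q \<in> carrier_mat (Suc \<nu>) n" by (auto simp: P_def Q_def)
  define E where "E = mat m n (\<lambda>(i, j). c * B $$ (i, j) - (P * Q) $$ (i, j))"
  have dvdE: "\<forall>i<m. \<forall>j<n. p ^ k dvd E $$ (i, j)"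
  proof (intro allI impI)
    fix i j assume ij: "i < m" "j < n"
    have "(P * Q) $$ (i, j) = (\<Sum>l\<in>{0..<Suc \<nu>}. P $$ (i, l) * Q $$ (l, j))"
      using ij PQ by (auto simp: scalar_prod_def intro!: sum.cong)
    also have "\<dots> = (\<Sum>l\<in>{0..<\<nu>}. P $$ (i, l) * Q $$ (l, j)) + c * a i * b j"
      using ij by (simp add: P_def Q_def)
    also have "(\<Sum>l\<in>{0..<\<nu>}. P $$ (i, l) * Q $$ (l, j))
        = (\<Sum>l\<in>{..<r} \<inter> {..<\<nu>}. X $$ (i, l) * d l * Y $$ (l, j))"
      by (rule sum.mono_neutral_cong_right) (use ij in \<open>auto simp: P_def Q_def d_def\<close>)
    finally have PQ_ij: "(P * Q) $$ (i, j)
        = (\<Sum>l\<in>{..<r} \<inter> {..<\<nu>}. X $$ (i, l) * d l * Y $$ (l, j)) + c * a i * b j" .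
    have "c * B $$ (i, j) = (\<Sum>l<r. X $$ (i, l) * d l * Y $$ (l, j)) + c * a i * b j"
      unfolding cA[OF ij, symmetric] using ij by (simp add: AB algebra_simps)
    also have "(\<Sum>l<r. X $$ (i, l) * d l * Y $$ (l, j))
        = (\<Sum>l\<in>{..<r} \<inter> {..<\<nu>}. X $$ (i, l) * d l * Y $$ (l, j))
        + (\<Sum>l\<in>{..<r} - {..<\<nu>}. X $$ (i, l) * d l * Y $$ (l, j))"
      by (subst sum.Int_Diff[of _ _ "{..<\<nu>}"]) auto
    finally have "E $$ (i, j) = (\<Sum>l\<in>{..<r} - {..<\<nu>}. X $$ (i, l) * d l * Y $$ (l, j))"
      using ij PQ_ij by (simp add: E_def)
    also have "p ^ k dvd \<dots>"
    proof (rule dvd_sum)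
      fix l assume "l \<in> {..<r} - {..<\<nu>}"
      then have "p ^ k dvd d l" using large[of l] by (auto simp: d_def intro!: dvd_mult2 le_imp_power_dvd)
      then show "p ^ k dvd X $$ (i, l) * d l * Y $$ (l, j)" by simp
    qed
    finally show "p ^ k dvd E $$ (i, j)" .
  qed
  have Ec: "E \<in> carrier_mat m n" by (simp add: E_def)
  have split: "c \<cdot>\<^sub>m B = P * Q + E" using B PQ by (intro eq_matI) (auto simp: E_def)
  define E' where "E' = U' * E * V'"
  have E'c: "E' \<in> carrier_mat m n" using UV' Ec by (auto simp: E'_def)
  have dvdE': "\<forall>i<m. \<forall>j<n. p ^ k dvd E' $$ (i, j)"
    unfolding E'_def
    by (rule dvd_entries_mult_right[OF UV'(2) mult_carrier_mat[OF UV'(1) Ec]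
          dvd_entries_mult_left[OF UV'(1) Ec dvdE]])
  have cD': "c \<cdot>\<^sub>m D' = (U' * P) * (Q * V') + E'"
  proof -
    have "c \<cdot>\<^sub>m D' = U' * (c \<cdot>\<^sub>m B) * V'"
      unfolding UV'(3) using UV' B
      by (simp add: mult_smult_distrib[of _ m m _ n] mult_smult_assoc_mat[of _ m n _ n])
    also have "\<dots> = U' * (P * Q) * V' + E'"
      unfolding split E'_def using UV' PQ Ec
      by (simp add: mult_add_distrib_mat[of _ m m _ n] add_mult_distrib_mat[of _ m n _ _ n])
    also have "U' * (P * Q) * V' = (U' * P) * (Q * V')"
    proof -
      have "U' * (P * Q) = U' * P * Q"
        by (rule assoc_mult_mat[symmetric]) (use UV' PQ in auto)
      moreover have "U' * P * Q * V' = (U' * P) * (Q * V')"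
        by (rule assoc_mult_mat) (use UV' PQ in auto)
      ultimately show ?thesis by simp
    qed
    finally show ?thesis .
  qed
  define y where "y i j = (SOME y. E' $$ (i, j) = p ^ k * y)" for i j
  \<comment> \<open>What remains of the \<open>i\<close>-th row after the power \<open>e' i < k\<close> of \<open>p\<close> is taken out: modulo \<open>p\<close> it is
    diagonal with entries prime to \<open>p\<close>.\<close>
  define G where "G i j = (if i = j then c * u' i else 0) - y i j * p ^ (k - e' i)" for i j
  have N_le: "N \<le> r'" using small'[of "N - 1"] by (auto simp: N_def)
  have entry: "((U' * P) * (Q * V')) $$ (i, j) = p ^ e' i * G i j" if ij: "i < N" "j < N" for i j
  proof -
    have bounds: "i < m" "j < n" "i < r'" "e' i < k" using ij N_le r' small'[of i] by auto
    have E'y: "E' $$ (i, j) = p ^ k * y i j"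
    proof -
      have "p ^ k dvd E' $$ (i, j)" using dvdE' bounds by blast
      then have "\<exists>y. E' $$ (i, j) = p ^ k * y" unfolding dvd_def .
      then show ?thesis unfolding y_def by (rule someI_ex)
    qed
    have pk: "p ^ k = p ^ e' i * p ^ (k - e' i)" using bounds by (simp flip: power_add)
    have "((U' * P) * (Q * V')) $$ (i, j) = c * D' $$ (i, j) - E' $$ (i, j)"
      using arg_cong[OF cD', of "\<lambda>M. M $$ (i, j)"] bounds E'c by (simp add: D'_def)
    also have "\<dots> = p ^ e' i * G i j"
      unfolding E'y pk using bounds by (auto simp: D'_def G_def algebra_simps)
    finally show ?thesis .
  qed
  have "x = 0" if "x \<in> minors N ((U' * P) * (Q * V'))" for x
    by (rule minors_mult_inner_dim[OF _ _ _ that]) (use UV' PQ in \<open>auto simp: N_def\<close>)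
  then have "\<forall>x\<in>minors N ((U' * P) * (Q * V')). 0 dvd x" by auto
  note this[unfolded dvd_minors_iff, THEN spec[of _ "\<lambda>i. i"], THEN spec[of _ "\<lambda>i. i"]]
  moreover have "\<forall>i<N. i < dim_row ((U' * P) * (Q * V'))" "\<forall>i<N. i < dim_col ((U' * P) * (Q * V'))"
    using UV' N_le r' by auto
  ultimately have "0 dvd det (mat N N (\<lambda>(i, j). ((U' * P) * (Q * V')) $$ (i, j)))" by blast
  moreover have "mat N N (\<lambda>(i, j). ((U' * P) * (Q * V')) $$ (i, j)) = mat N N (\<lambda>(i, j). p ^ e' i * G i j)"
    using entry by (intro eq_matI) auto
  ultimately have "(\<Prod>i<N. p ^ e' i) * det (mat N N (\<lambda>(i, j). G i j)) = 0"
    by (simp only: det_scale_rows dvd_0_left_iff)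
  moreover have "(\<Prod>i<N. p ^ e' i) \<noteq> 0" using p by auto
  ultimately have "det (mat N N (\<lambda>(i, j). G i j)) = 0" by simp
  moreover have dvd_pow: "p dvd p ^ (k - e' i)" if "i < N" for i
    using small'[OF that] by (intro dvd_power) auto
  then have "p dvd det (mat N N (\<lambda>(i, j). G i j)) - (\<Prod>i<N. mat N N (\<lambda>(i, j). G i j) $$ (i, i))"
    by (intro dvd_det_minus_diagonal) (auto simp: G_def)
  ultimately have "p dvd (\<Prod>i<N. G i i)" by simp
  moreover have "\<not> p dvd (\<Prod>i<N. G i i)"
  proof (rule prime_elem_not_dvd_prod[OF p])
    fix i assume "i \<in> {..<N}"
    then have "\<not> p dvd c * u' i" "p dvd y i i * p ^ (k - e' i)"
      using c u'[of i] p N_le dvd_pow by (auto simp: prime_elem_dvd_mult_iff)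
    then show "\<not> p dvd G i i" by (simp add: G_def dvd_diff_left_iff dvd_diff_right_iff)
  qed
  ultimately show False by simp
qed

lemma prime_elem_linear_factor: "prime_elem [:- c, 1 :: 'r::idom:]"
  unfolding prime_elem_def by (auto simp: poly_eq_0_iff_dvd[symmetric] is_unit_poly_iff)

text \<open>
  By comparison of degrees.
\<close>

lemma linear_factor_power_not_dvd:
  fixes a :: "'r::idom poly"
  assumes "a \<noteq> 0"
  shows "\<exists>k. \<not> [:- c, 1:] ^ k dvd a"
proof (rule exI[of _ "Suc (degree a)"], rule notI)
  assume "[:- c, 1:] ^ Suc (degree a) dvd a"
  then have "degree ([:- c, 1:] ^ Suc (degree a)) \<le> degree a" using assms by (rule dvd_imp_degree_le)
  then show False by (simp only: degree_linear_power)
qed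

section \<open>Polynomial bases of the null space\<close>

lemma rational_basis_independent:
  assumes "rational_basis M p b" "\<And>i. (\<Sum>j<p. q j * b j i) = 0" "j < p"
  shows "q j = 0"
proof -
  have "\<forall>q. (\<forall>i. (\<Sum>j<p. q j * b j i) = 0) \<longrightarrow> (\<forall>j<p. q j = 0)"
    using assms(1) unfolding rational_basis_def by (elim conjE)
  from this[THEN spec[of _ q], THEN mp] assms(2,3) show ?thesis by simp
qed

lemma rational_basis_cong:
  assumes "\<And>j. j < p \<Longrightarrow> b j = b' j"
  shows "rational_basis M p b \<longleftrightarrow> rational_basis M p b'"
proof -
  have 1: "(\<Sum>j<p. q j * b j i) = (\<Sum>j<p. q j * b' j i)" for q i
    by (rule sum.cong) (simp_all add: assms)
  have 2: "(\<forall>j<p. b j \<in> M) = (\<forall>j<p. b' j \<in> M)" using assms by auto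
  show ?thesis unfolding rational_basis_def 1 2 ..
qed

text \<open>
  The notion of basis for kernels speaks of sets of vectors and linear combinations with coefficients
  indexed by vectors; for an injective family they can be indexed by the position.
\<close>

lemma (in kernel) basis_family_iff:
  fixes p :: nat
  assumes inj: "inj_on w {..<p}" and ker: "\<And>j. j < p \<Longrightarrow> w j \<in> mat_kernel A"
  shows "basis (w ` {..<p}) \<longleftrightarrow>
    (\<forall>f. (\<forall>i<nc. (\<Sum>j<p. f j * w j $ i) = 0) \<longrightarrow> (\<forall>j<p. f j = 0)) \<and>
    (\<forall>x\<in>mat_kernel A. \<exists>f. \<forall>i<nc. x $ i = (\<Sum>j<p. f j * w j $ i))"
    (is "_ \<longleftrightarrow> ?indep \<and> ?span")
proof -
  let ?S = "w ` {..<p}"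
  have fin: "finite ?S" by (rule finite_imageI) simp
  have sub: "?S \<subseteq> mat_kernel A" using ker by auto
  have dimv: "dim_vec v = nc" if "v \<in> mat_kernel A" for v
    using that mat_kernel_carrier[OF A] by auto
  have lincomb_S: "lincomb f ?S \<in> mat_kernel A" for f
    using Ker.lincomb_closed[of ?S f] sub by auto
  have lincomb_eq: "lincomb f ?S $ i = (\<Sum>j<p. f (w j) * w j $ i)" if "i < nc" for f i
    by (subst lincomb_index[OF that sub]) (simp add: sum.reindex[OF inj])
  have coeffs: "\<exists>g. \<forall>j<p. g (w j) = f j" for f
    by (rule exI[of _ "\<lambda>v. f (the_inv_into {..<p} w v)"]) (use inj in \<open>auto simp: the_inv_into_f_f\<close>)
  have indep_iff: "lin_indpt ?S \<longleftrightarrow> ?indep"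
  proof
    assume li: "lin_indpt ?S"
    show ?indep
    proof (intro allI impI)
      fix f j assume f: "\<forall>i<nc. (\<Sum>j<p. f j * w j $ i) = 0" and j: "j < p"
      obtain g where g: "\<forall>j<p. g (w j) = f j" using coeffs by blast
      have "lincomb g ?S = 0\<^sub>v nc"
        using lincomb_eq g f dimv[OF lincomb_S] by (intro eq_vecI) auto
      then have "g \<in> ?S \<rightarrow> {0}"
        using Ker.not_lindepD[OF li fin subset_refl, of g] by auto
      then show "f j = 0" using g j by (metis PiE imageI lessThan_iff singletonD)
    qed
  next
    assume R: ?indep
    show "lin_indpt ?S"
    proof (rule Ker.finite_lin_indpt2[OF fin])
      show "?S \<subseteq> mat_kernel A" by (rule sub)
      fix a assume a: "lincomb a ?S = 0\<^sub>v nc"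
      have "(\<Sum>j<p. a (w j) * w j $ i) = 0" if "i < nc" for i
        using lincomb_eq[OF that, of a] that unfolding a by simp
      then have "\<forall>j<p. a (w j) = 0" using R[THEN spec[of _ "\<lambda>j. a (w j)"], THEN mp] by blast
      then show "\<forall>v\<in>?S. a v = 0" by auto
    qed
  qed
  have span_iff: "gen_set ?S \<longleftrightarrow> ?span"
  proof -
    have "span ?S = {lincomb a ?S | a. a \<in> ?S \<rightarrow> UNIV}"
      using Ker.finite_span[OF fin] sub by simp
    then have span_eq: "span ?S = range (\<lambda>a. lincomb a ?S)" by auto
    show ?thesis
    proof
      assume gen: "gen_set ?S"
      show ?span
      proof
        fix x assume "x \<in> mat_kernel A"
        then obtain a where "x = lincomb a ?S" using gen span_eq by auto
        then show "\<exists>f. \<forall>i<nc. x $ i = (\<Sum>j<p. f j * w j $ i)"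
          using lincomb_eq[of _ a] by (intro exI[of _ "\<lambda>j. a (w j)"]) simp
      qed
    next
      assume R: ?span
      have "x \<in> span ?S" if x: "x \<in> mat_kernel A" for x
      proof -
        obtain f where f: "\<forall>i<nc. x $ i = (\<Sum>j<p. f j * w j $ i)" using R x by blast
        obtain g where g: "\<forall>j<p. g (w j) = f j" using coeffs by blast
        have "x = lincomb g ?S"
          using lincomb_eq g f dimv[OF lincomb_S] dimv[OF x] by (intro eq_vecI) auto
        then show ?thesis using span_eq by auto
      qed
      moreover have "span ?S \<subseteq> mat_kernel A" using lincomb_S span_eq by auto
      ultimately show "gen_set ?S" by auto
    qed
  qed
  show ?thesis
    unfolding Ker.basis_def using indep_iff span_iff sub by auto
qed

lemma common_denominator:
  fixes f :: "nat \<Rightarrow> 'r::idom fract"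
  shows "\<exists>d q. d \<noteq> 0 \<and> (\<forall>j<k. to_fract d * f j = to_fract (q j))"
proof (induction k)
  case 0
  show ?case by (rule exI[of _ 1]) simp
next
  case (Suc k)
  then obtain d q where d: "d \<noteq> 0" "\<forall>j<k. to_fract d * f j = to_fract (q j)" by blast
  obtain a b where ab: "f k = Fract a b" "b \<noteq> 0" by (cases "f k")
  have "to_fract (d * b) * f j = to_fract (if j < k then b * q j else d * a)" if "j < Suc k" for j
  proof (cases "j < k")
    case True
    have "to_fract (d * b) * f j = to_fract b * (to_fract d * f j)" by (simp add: ac_simps)
    then show ?thesis using d(2) True by simp
  next
    case False
    then have "j = k" using that by simp
    then show ?thesis using ab by (simp add: Fract_conv_to_fract)
  qed
  then show ?case using d(1) ab(2)
    by (intro exI[of _ "d * b"] exI[of _ "\<lambda>j. if j < k then b * q j else d * a"]) simp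
qed

definition poly_kernel :: "'r::comm_ring_1 mat \<Rightarrow> (nat \<Rightarrow> 'r) set" where
  "poly_kernel H = {x. supp_below (dim_col H) x \<and> (\<forall>i<dim_row H. (\<Sum>j<dim_col H. H $$ (i, j) * x j) = 0)}"

text \<open>
  Outside the range the value is \<open>0\<close>, so that vectors of length \<open>n\<close> correspond exactly to the
  functions supported below \<open>n\<close>.
\<close>

definition fun_of_vec :: "'r::zero vec \<Rightarrow> nat \<Rightarrow> 'r" where
  "fun_of_vec v = (\<lambda>i. if i < dim_vec v then v $ i else 0)"

lemma fun_of_vec_vec: "supp_below n x \<Longrightarrow> fun_of_vec (vec n x) = x"
  by (auto simp: fun_of_vec_def supp_below_def fun_eq_iff)

lemma to_fract_vec_in_kernel_iff:
  assumes "v \<in> carrier_vec (dim_col H)"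
  shows "map_vec to_fract v \<in> mat_kernel (map_mat to_fract H) \<longleftrightarrow> fun_of_vec v \<in> poly_kernel H"
proof -
  have "(map_mat to_fract H *\<^sub>v map_vec to_fract v) $ i = to_fract (\<Sum>j<dim_col H. H $$ (i, j) * fun_of_vec v j)"
    if "i < dim_row H" for i
    using that assms by (auto simp: scalar_prod_def fun_of_vec_def atLeast0LessThan intro!: sum.cong)
  then have "map_mat to_fract H *\<^sub>v map_vec to_fract v = 0\<^sub>v (dim_row H) \<longleftrightarrow>
      (\<forall>i<dim_row H. (\<Sum>j<dim_col H. H $$ (i, j) * fun_of_vec v j) = 0)"
    by (simp add: vec_eq_iff del: index_mult_mat_vec to_fract_sum to_fract_mult)
  then show ?thesis
    using assms by (auto simp: mat_kernel_def poly_kernel_def supp_below_def fun_of_vec_def)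
qed

text \<open>
  The two notions differ only by denominators: relations and kernel vectors over the field of fractions
  become polynomial after multiplication by a common denominator.
\<close>

lemma polynomial_null_basis_iff_rational_basis:
  fixes H :: "'a::field poly mat"
  assumes carrier: "set bs \<subseteq> carrier_vec (dim_col H)" and dist: "distinct bs"
  shows "polynomial_null_basis H bs \<longleftrightarrow> rational_basis (poly_kernel H) (length bs) (\<lambda>j. fun_of_vec (bs ! j))"
proof -
  let ?n = "dim_col H" and ?p = "length bs" and ?K = "map_mat to_fract H"
  define w where "w j = map_vec to_fract (bs ! j)" for j
  define b where "b j = fun_of_vec (bs ! j)" for j
  have bs_c: "bs ! j \<in> carrier_vec ?n" if "j < ?p" for j using carrier that by auto
  interpret k: kernel "dim_row H" ?n ?K by unfold_locales auto
  have image: "map_vec to_fract ` set bs = w ` {..<?p}"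
  proof -
    have "set bs = (!) bs ` {..<?p}" by (auto simp: set_conv_nth)
    then show ?thesis by (simp add: w_def[abs_def] image_image)
  qed
  have inj_map: "v = v'" if "map_vec to_fract v = map_vec to_fract v'" for v v' :: "'a poly vec"
    using that by (auto simp: vec_eq_iff)
  have inj: "inj_on w {..<?p}"
  proof (rule inj_onI)
    fix x y assume xy: "x \<in> {..<?p}" "y \<in> {..<?p}" "w x = w y"
    then have "bs ! x = bs ! y" by (intro inj_map) (simp add: w_def)
    then show "x = y" using dist xy by (simp add: nth_eq_iff_index_eq)
  qed
  have w_b: "w j $ i = to_fract (b j i)" if "j < ?p" "i < ?n" for i j
    using bs_c[OF that(1)] that by (auto simp: w_def b_def fun_of_vec_def)
  have b_supp: "b j i = 0" if "j < ?p" "\<not> i < ?n" for i j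
    using bs_c[OF that(1)] that by (auto simp: b_def fun_of_vec_def)
  have mem: "w j \<in> mat_kernel ?K \<longleftrightarrow> b j \<in> poly_kernel H" if "j < ?p" for j
    using to_fract_vec_in_kernel_iff[OF bs_c[OF that]] by (simp add: w_def b_def)
  show ?thesis
  proof (cases "\<forall>j<?p. b j \<in> poly_kernel H")
    case False
    then have "\<not> w ` {..<?p} \<subseteq> mat_kernel ?K" using mem by blast
    then have "\<not> k.basis (w ` {..<?p})" unfolding k.Ker.basis_def by auto
    then show ?thesis using False carrier dist
      by (auto simp: polynomial_null_basis_def rational_basis_def image b_def)
  next
    case True
    have indep: "(\<forall>f. (\<forall>i<?n. (\<Sum>j<?p. f j * w j $ i) = 0) \<longrightarrow> (\<forall>j<?p. f j = 0)) \<longleftrightarrow>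
        (\<forall>q. (\<forall>i. (\<Sum>j<?p. q j * b j i) = 0) \<longrightarrow> (\<forall>j<?p. q j = 0))" (is "?L \<longleftrightarrow> ?R")
    proof
      assume L: ?L
      show ?R
      proof (intro allI impI)
        fix q j assume q: "\<forall>i. (\<Sum>j<?p. q j * b j i) = 0" and j: "j < ?p"
        have "(\<Sum>j<?p. to_fract (q j) * w j $ i) = to_fract (\<Sum>j<?p. q j * b j i)" if "i < ?n" for i
          using that by (simp add: w_b)
        then have "\<forall>i<?n. (\<Sum>j<?p. to_fract (q j) * w j $ i) = 0" using q by simp
        from L[THEN spec[of _ "\<lambda>j. to_fract (q j)"], THEN mp, OF this]
        have "\<forall>j<?p. to_fract (q j) = 0" .
        then show "q j = 0" using j by simp
      qed
    next
      assume R: ?R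
      show ?L
      proof (intro allI impI)
        fix f j assume f: "\<forall>i<?n. (\<Sum>j<?p. f j * w j $ i) = 0" and j: "j < ?p"
        obtain d q where d: "d \<noteq> 0" "\<forall>j<?p. to_fract d * f j = to_fract (q j)"
          using common_denominator by blast
        have "(\<Sum>j<?p. q j * b j i) = 0" for i
        proof (cases "i < ?n")
          case True
          have "to_fract (\<Sum>j<?p. q j * b j i) = (\<Sum>j<?p. to_fract d * (f j * w j $ i))"
            unfolding to_fract_sum
            by (rule sum.cong) (use d(2) True in \<open>auto simp: w_b simp flip: mult.assoc\<close>)
          also have "\<dots> = to_fract d * (\<Sum>j<?p. f j * w j $ i)" by (simp add: sum_distrib_left)
          also have "\<dots> = 0" using f True by simp
          finally show ?thesis by (simp only: to_fract_eq_0_iff)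
        qed (simp add: b_supp)
        then have "q j = 0" using R[THEN spec[of _ q], THEN mp] j by blast
        then have "to_fract d * f j = 0" using d(2) j by simp
        then show "f j = 0" using d(1) by simp
      qed
    qed
    have span: "(\<forall>x\<in>mat_kernel ?K. \<exists>f. \<forall>i<?n. x $ i = (\<Sum>j<?p. f j * w j $ i)) \<longleftrightarrow>
        (\<forall>x\<in>poly_kernel H. \<exists>d q. d \<noteq> 0 \<and> (\<forall>i. d * x i = (\<Sum>j<?p. q j * b j i)))" (is "?L \<longleftrightarrow> ?R")
    proof
      assume L: ?L
      show ?R
      proof
        fix x assume x: "x \<in> poly_kernel H"
        then have supp: "supp_below ?n x" by (simp add: poly_kernel_def)
        then have "map_vec to_fract (vec ?n x) \<in> mat_kernel ?K"
          using x to_fract_vec_in_kernel_iff[of "vec ?n x" H] by (simp add: fun_of_vec_vec)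
        then obtain f where f: "\<forall>i<?n. map_vec to_fract (vec ?n x) $ i = (\<Sum>j<?p. f j * w j $ i)"
          using L by blast
        obtain d q where d: "d \<noteq> 0" "\<forall>j<?p. to_fract d * f j = to_fract (q j)"
          using common_denominator by blast
        have "d * x i = (\<Sum>j<?p. q j * b j i)" for i
        proof (cases "i < ?n")
          case True
          have "to_fract (d * x i) = to_fract d * (\<Sum>j<?p. f j * w j $ i)"
            using f True by simp
          also have "\<dots> = (\<Sum>j<?p. to_fract (q j * b j i))"
            unfolding sum_distrib_left
            by (rule sum.cong) (use d(2) True in \<open>auto simp: w_b simp flip: mult.assoc\<close>)
          also have "\<dots> = to_fract (\<Sum>j<?p. q j * b j i)" by simp
          finally show ?thesis by (simp only: to_fract_eq_iff)
        next
          case False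
          then show ?thesis using supp by (simp add: b_supp supp_below_def)
        qed
        with d(1) show "\<exists>d q. d \<noteq> 0 \<and> (\<forall>i. d * x i = (\<Sum>j<?p. q j * b j i))" by blast
      qed
    next
      assume R: ?R
      show ?L
      proof
        fix x assume x: "x \<in> mat_kernel ?K"
        obtain c y where c: "c \<noteq> 0" "\<forall>i<?n. to_fract c * x $ i = to_fract (y i)"
          using common_denominator by blast
        have xc: "x \<in> carrier_vec ?n" using x by (auto simp: mat_kernel_def)
        define z where "z = vec ?n y"
        have "map_vec to_fract z = to_fract c \<cdot>\<^sub>v x"
          using c(2) xc by (intro eq_vecI) (auto simp: z_def)
        then have "map_vec to_fract z \<in> mat_kernel ?K"
          using mat_kernel_smult[OF k.A x] by simp
        then have "fun_of_vec z \<in> poly_kernel H"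
          using to_fract_vec_in_kernel_iff[of z H] by (simp add: z_def)
        then obtain d q where d: "d \<noteq> 0" "\<forall>i. d * fun_of_vec z i = (\<Sum>j<?p. q j * b j i)"
          using R by blast
        have "x $ i = (\<Sum>j<?p. to_fract (q j) / to_fract (d * c) * w j $ i)" if i: "i < ?n" for i
        proof -
          have "to_fract (d * c) * x $ i = to_fract (d * fun_of_vec z i)"
            using c(2) i by (simp add: z_def fun_of_vec_def mult.assoc)
          also have "\<dots> = (\<Sum>j<?p. to_fract (q j) * w j $ i)"
            using d(2) i by (simp add: w_b)
          finally show ?thesis
            using c(1) d(1) by (simp add: sum_divide_distrib[symmetric] field_simps)
        qed
        then show "\<exists>f. \<forall>i<?n. x $ i = (\<Sum>j<?p. f j * w j $ i)"
          by (intro exI[of _ "\<lambda>j. to_fract (q j) / to_fract (d * c)"]) blast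
      qed
    qed
    have "polynomial_null_basis H bs \<longleftrightarrow> k.basis (w ` {..<?p})"
      using carrier dist by (simp add: polynomial_null_basis_def image)
    also have "\<dots> \<longleftrightarrow> (\<forall>f. (\<forall>i<?n. (\<Sum>j<?p. f j * w j $ i) = 0) \<longrightarrow> (\<forall>j<?p. f j = 0)) \<and>
        (\<forall>x\<in>mat_kernel ?K. \<exists>f. \<forall>i<?n. x $ i = (\<Sum>j<?p. f j * w j $ i))"
      by (rule k.basis_family_iff[OF inj]) (use mem True in blast)
    also have "\<dots> \<longleftrightarrow> rational_basis (poly_kernel H) ?p b"
      unfolding indep span rational_basis_def eqTrueI[OF True] by (simp only: simp_thms)
    finally show ?thesis by (simp add: b_def[abs_def])
  qed
qed

text \<open>
  Minimality transfers because any competing family of functions can be read as a list of vectors; the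
  list is distinct since its members are independent.
\<close>

lemma minimal_null_basis_imp_minimal_rational_basis:
  fixes H :: "'a::field poly mat"
  assumes bs: "minimal_null_basis H bs"
  shows "minimal_rational_basis (dim_col H) (poly_kernel H) (length bs) (\<lambda>j. fun_of_vec (bs ! j))"
    and "j < length bs \<Longrightarrow> vdeg (dim_col H) (fun_of_vec (bs ! j)) = vec_degree (bs ! j)"
proof -
  let ?n = "dim_col H" and ?p = "length bs"
  have pb: "polynomial_null_basis H bs" using bs by (simp add: minimal_null_basis_def)
  then have carrier: "set bs \<subseteq> carrier_vec ?n" and dist: "distinct bs"
    by (simp_all add: polynomial_null_basis_def)
  have vdeg_eq: "vdeg ?n (fun_of_vec v) = vec_degree v" if "v \<in> carrier_vec ?n" for v :: "'a poly vec"
    using that by (auto simp: vdeg_def vec_degree_def fun_of_vec_def intro!: arg_cong[of _ _ Max])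
  show deg: "vdeg ?n (fun_of_vec (bs ! j)) = vec_degree (bs ! j)" if "j < ?p" for j
    by (rule vdeg_eq) (use carrier that in auto)
  have sum_bs: "sum_list (map vec_degree cs) = (\<Sum>j<length cs. vdeg ?n (fun_of_vec (cs ! j)))"
    if "set cs \<subseteq> carrier_vec ?n" for cs :: "'a poly vec list"
  proof -
    have "sum_list (map vec_degree cs) = (\<Sum>j<length cs. vec_degree (cs ! j))"
      by (simp add: sum_list_sum_nth atLeast0LessThan)
    also have "\<dots> = (\<Sum>j<length cs. vdeg ?n (fun_of_vec (cs ! j)))"
      by (rule sum.cong) (use that vdeg_eq in \<open>auto simp: subset_iff\<close>)
    finally show ?thesis .
  qed
  show "minimal_rational_basis ?n (poly_kernel H) ?p (\<lambda>j. fun_of_vec (bs ! j))"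
    unfolding minimal_rational_basis_def
  proof (intro conjI allI impI)
    show "rational_basis (poly_kernel H) ?p (\<lambda>j. fun_of_vec (bs ! j))"
      using pb polynomial_null_basis_iff_rational_basis[OF carrier dist] by simp
    fix b' assume b': "rational_basis (poly_kernel H) ?p b'"
    define cs where "cs = map (\<lambda>j. vec ?n (b' j)) [0..<?p]"
    have len: "length cs = ?p" by (simp add: cs_def)
    have cs_c: "set cs \<subseteq> carrier_vec ?n" by (auto simp: cs_def)
    have supp: "supp_below ?n (b' j)" if "j < ?p" for j
      using b' that by (auto simp: rational_basis_def poly_kernel_def)
    have cs_fun: "fun_of_vec (cs ! j) = b' j" if "j < ?p" for j
      using that supp by (simp add: cs_def fun_of_vec_vec)
    have inj_b': "b' i \<noteq> b' j" if "i < ?p" "j < ?p" "i \<noteq> j" for i j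
    proof
      assume eq: "b' i = b' j"
      define q where "q l = (if l = i then 1 else if l = j then - 1 else 0 :: 'a poly)" for l
      have "(\<Sum>l<?p. q l * b' l m) = 0" for m
      proof -
        have "(\<Sum>l<?p. q l * b' l m) = (\<Sum>l\<in>{i, j}. q l * b' l m)"
          by (rule sum.mono_neutral_right) (use that in \<open>auto simp: q_def\<close>)
        also have "\<dots> = q i * b' i m + q j * b' j m" using that(3) by simp
        also have "\<dots> = 0" unfolding eq using that(3) by (simp add: q_def)
        finally show ?thesis .
      qed
      from rational_basis_independent[where q = q, OF b' this that(1)] have "q i = 0" .
      then show False by (simp add: q_def)
    qed
    then have dist_cs: "distinct cs"
      unfolding distinct_conv_nth len
    proof (intro allI impI)
      fix i j assume "i < ?p" "j < ?p" "i \<noteq> j"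
      then have "fun_of_vec (cs ! i) \<noteq> fun_of_vec (cs ! j)"
        using inj_b'[of i j] cs_fun[of i] cs_fun[of j] by metis
      then show "cs ! i \<noteq> cs ! j" by auto
    qed
    have "rational_basis (poly_kernel H) (length cs) (\<lambda>j. fun_of_vec (cs ! j))"
      unfolding len by (rule rational_basis_cong[THEN iffD2, OF cs_fun b'])
    then have "polynomial_null_basis H cs"
      using polynomial_null_basis_iff_rational_basis[OF cs_c dist_cs] by simp
    then have "sum_list (map vec_degree bs) \<le> sum_list (map vec_degree cs)"
      using bs by (simp add: minimal_null_basis_def)
    also have "sum_list (map vec_degree cs) = (\<Sum>j<?p. vdeg ?n (b' j))"
      unfolding sum_bs[OF cs_c] len by (rule sum.cong) (simp_all add: cs_fun)
    finally show "(\<Sum>j<?p. vdeg ?n (fun_of_vec (bs ! j))) \<le> (\<Sum>j<?p. vdeg ?n (b' j))"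
      unfolding sum_bs[OF carrier] .
  qed
qed

section \<open>Rank and nullity\<close>

text \<open>
  Padding with zero equations makes the system square and its determinant zero.
\<close>

lemma nontrivial_solution:
  fixes C :: "nat \<Rightarrow> nat \<Rightarrow> 'r::idom"
  assumes "q < p"
  shows "\<exists>w. (\<exists>j<p. w j \<noteq> 0) \<and> (\<forall>i<q. (\<Sum>j<p. C i j * w j) = 0)"
proof -
  define M where "M = mat p p (\<lambda>(i, j). (if i < q then 1 else 0) * C i j)"
  have "(\<Prod>i<p. if i < q then 1 else 0 :: 'r) = 0"
    by (rule prod_zero) (use assms in auto)
  then have "det M = 0" unfolding M_def det_scale_rows by simp
  moreover have M: "M \<in> carrier_mat p p" by (simp add: M_def)
  ultimately obtain v where v: "v \<in> carrier_vec p" "v \<noteq> 0\<^sub>v p" "M *\<^sub>v v = 0\<^sub>v p"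
    using det_0_iff_vec_prod_zero[OF M] by blast
  have "(\<Sum>j<p. C i j * v $ j) = 0" if "i < q" for i
  proof -
    have "(\<Sum>j<p. C i j * v $ j) = (M *\<^sub>v v) $ i"
      using that assms v(1) by (auto simp: M_def scalar_prod_def atLeast0LessThan intro!: sum.cong)
    then show ?thesis using v(3) that assms by simp
  qed
  moreover have "\<exists>j<p. v $ j \<noteq> 0" using v(1,2) by (auto simp: vec_eq_iff)
  ultimately show ?thesis by (intro exI[of _ "\<lambda>j. v $ j"]) blast
qed

lemma local_smith_form_normal_rank:
  assumes p: "prime_elem p" and H: "local_smith_form p H r e u"
  shows "normal_rank H = r"
proof -
  have "{k. \<exists>d\<in>minors k H. d \<noteq> 0} = {..r}"
    using local_smith_form_minors(1,3)[OF p H] by (auto simp: not_less[symmetric])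
  then show ?thesis by (simp add: normal_rank_def Max_eq_iff)
qed

text \<open>
  A diagonal form \<open>D = U H V\<close> with \<open>r\<close> nonzero entries has as kernel the vectors that vanish on the
  first \<open>r\<close> coordinates. The adjugate of \<open>V\<close> carries the basis to independent vectors of this kernel,
  so \<open>p \<le> n - r\<close>. Conversely the last \<open>n - r\<close> columns of \<open>V\<close> are independent vectors in the kernel
  of \<open>H\<close>, and they are rational combinations of the basis, so \<open>n - r \<le> p\<close>.
\<close>

theorem rational_basis_card:
  fixes H :: "'a::field poly mat"
  assumes H: "H \<in> carrier_mat m n" and b: "rational_basis (poly_kernel H) p b"
  shows "p + normal_rank H = n"
proof -
  define s where "s = [:0, 1 :: 'a:]"
  have s: "prime_elem s" using prime_elem_linear_factor[of 0] by (simp add: s_def)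
  have "\<exists>k. \<not> s ^ k dvd a" if "a \<noteq> 0" for a
    using linear_factor_power_not_dvd[OF that, of 0] by (simp add: s_def)
  then obtain r e u where sm: "local_smith_form s H r e u" using local_smith_form_exists[OF s] by blast
  have rank: "normal_rank H = r" by (rule local_smith_form_normal_rank[OF s sm])
  define D where "D = mat m n (\<lambda>(i, j). if i = j \<and> i < r then s ^ e i * u i else 0)"
  have r: "r \<le> m" "r \<le> n" using sm H by (auto simp: local_smith_form_def)
  have d_nz: "s ^ e i * u i \<noteq> 0" if "i < r" for i
    using sm that s by (auto simp: local_smith_form_def)
  obtain U V where UV: "U \<in> carrier_mat m m" "V \<in> carrier_mat n n" "\<not> s dvd det U" "\<not> s dvd det V"
      "D = U * H * V"
    using sm H unfolding local_smith_form_def equivalent_off_def D_def by auto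
  have det_nz: "det U \<noteq> 0" "det V \<noteq> 0" using UV by auto
  have Dc: "D \<in> carrier_mat m n" by (simp add: D_def)
  have ker_iff: "x \<in> poly_kernel H \<longleftrightarrow> supp_below n x \<and> H *\<^sub>v vec n x = 0\<^sub>v m" for x
  proof -
    have "(H *\<^sub>v vec n x) $ i = (\<Sum>j<n. H $$ (i, j) * x j)" if "i < m" for i
      using that H by (auto simp: scalar_prod_def atLeast0LessThan intro!: sum.cong)
    then show ?thesis using H by (auto simp: poly_kernel_def vec_eq_iff simp del: index_mult_mat_vec)
  qed
  have b_ker: "b j \<in> poly_kernel H" if "j < p" for j
    using b that unfolding rational_basis_def by blast
  have b_supp: "supp_below n (b j)" if "j < p" for j using b_ker[OF that] ker_iff by blast
  have Dx: "(D *\<^sub>v y) $ i = (if i < r then s ^ e i * u i * y $ i else 0)" if "i < m" "y \<in> carrier_vec n" for i y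
  proof -
    have "(D *\<^sub>v y) $ i = (\<Sum>j\<in>{0..<n}. D $$ (i, j) * y $ j)"
      using that Dc by (auto simp: scalar_prod_def)
    also have "\<dots> = (\<Sum>j\<in>{0..<n}. if j = i then (if i < r then s ^ e i * u i * y $ i else 0) else 0)"
      by (rule sum.cong) (use that in \<open>auto simp: D_def\<close>)
    finally have "(D *\<^sub>v y) $ i
        = (\<Sum>j\<in>{0..<n}. if j = i then (if i < r then s ^ e i * u i * y $ i else 0) else 0)" .
    then show ?thesis using r by auto
  qed
  have adjV: "adj_mat V \<in> carrier_mat n n" "V * adj_mat V = det V \<cdot>\<^sub>m 1\<^sub>m n"
      "adj_mat V * V = det V \<cdot>\<^sub>m 1\<^sub>m n"
    using adj_mat[OF UV(2)] by auto
  have adjU: "adj_mat U \<in> carrier_mat m m" "adj_mat U * U = det U \<cdot>\<^sub>m 1\<^sub>m m"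
    using adj_mat[OF UV(1)] by auto
  have smult_one: "(c \<cdot>\<^sub>m 1\<^sub>m k) *\<^sub>v y = c \<cdot>\<^sub>v y" if "y \<in> carrier_vec k" for c :: "'a poly" and k y
  proof (rule eq_vecI)
    fix i assume "i < dim_vec (c \<cdot>\<^sub>v y)"
    then have i: "i < k" using that by simp
    have "((c \<cdot>\<^sub>m 1\<^sub>m k) *\<^sub>v y) $ i = (\<Sum>j\<in>{0..<k}. (c \<cdot>\<^sub>m 1\<^sub>m k) $$ (i, j) * y $ j)"
      using i that by (auto simp: scalar_prod_def intro!: sum.cong)
    also have "\<dots> = (\<Sum>j\<in>{0..<k}. if j = i then c * y $ i else 0)"
      by (rule sum.cong) (use i in auto)
    finally show "((c \<cdot>\<^sub>m 1\<^sub>m k) *\<^sub>v y) $ i = (c \<cdot>\<^sub>v y) $ i" using i that by simp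
  qed (use that in simp)
  have DV: "D *\<^sub>v y = U *\<^sub>v (H *\<^sub>v (V *\<^sub>v y))" if "y \<in> carrier_vec n" for y
    unfolding UV(5) using that UV H
    by (simp add: assoc_mult_mat_vec[of _ m n _ n] assoc_mult_mat_vec[of _ m m _ n])
  have "p \<le> n - r"
  proof (rule ccontr)
    assume "\<not> p \<le> n - r"
    then have less: "n - r < p" by simp
    define y where "y j = adj_mat V *\<^sub>v vec n (b j)" for j
    have yc: "y j \<in> carrier_vec n" for j using adjV by (simp add: y_def)
    have y0: "y j $ i = 0" if "j < p" "i < r" for i j
    proof -
      have "V *\<^sub>v y j = det V \<cdot>\<^sub>v vec n (b j)"
        unfolding y_def using adjV UV
        by (simp add: assoc_mult_mat_vec[of _ n n _ n, symmetric] smult_one)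
      then have "H *\<^sub>v (V *\<^sub>v y j) = det V \<cdot>\<^sub>v (H *\<^sub>v vec n (b j))"
        using H by (intro eq_vecI) (auto simp: scalar_prod_def sum_distrib_left algebra_simps intro!: sum.cong)
      also have "\<dots> = 0\<^sub>v m" using b_ker[OF that(1)] ker_iff by auto
      finally have "D *\<^sub>v y j = U *\<^sub>v 0\<^sub>v m" using DV[OF yc] by simp
      then have "(D *\<^sub>v y j) $ i = 0"
        using UV(1) that r by (auto simp: scalar_prod_def)
      then show ?thesis using Dx[of i "y j"] yc that r d_nz by auto
    qed
    obtain w where w: "\<exists>j<p. w j \<noteq> 0" "\<forall>i<n - r. (\<Sum>j<p. y j $ (r + i) * w j) = 0"
      using nontrivial_solution[OF less, of "\<lambda>i j. y j $ (r + i)"] by blast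
    have wy: "(\<Sum>j<p. w j * y j $ i) = 0" if "i < n" for i
    proof (cases "i < r")
      case True
      then show ?thesis using y0 by simp
    next
      case False
      then show ?thesis using w(2)[THEN spec[of _ "i - r"]] that by (simp add: mult.commute)
    qed
    have "(\<Sum>j<p. w j * b j i) = 0" for i
    proof (cases "i < n")
      case True
      have Vy: "det V * b j i = (\<Sum>l\<in>{0..<n}. V $$ (i, l) * y j $ l)" if "j < p" for j
      proof -
        have "V *\<^sub>v y j = det V \<cdot>\<^sub>v vec n (b j)"
          unfolding y_def using adjV UV
          by (simp add: assoc_mult_mat_vec[of _ n n _ n, symmetric] smult_one)
        from arg_cong[OF this, of "\<lambda>v :: 'a poly vec. v $ i"]
        show ?thesis using True UV(2) yc[of j] by (auto simp: scalar_prod_def)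
      qed
      have "det V * (\<Sum>j<p. w j * b j i) = (\<Sum>j<p. w j * (det V * b j i))"
        by (simp add: sum_distrib_left algebra_simps)
      also have "\<dots> = (\<Sum>j<p. \<Sum>l\<in>{0..<n}. V $$ (i, l) * (w j * y j $ l))"
        by (rule sum.cong) (auto simp: Vy sum_distrib_left algebra_simps)
      also have "\<dots> = (\<Sum>l\<in>{0..<n}. V $$ (i, l) * (\<Sum>j<p. w j * y j $ l))"
        by (subst sum.swap) (simp add: sum_distrib_left)
      also have "\<dots> = 0" using wy by simp
      finally show ?thesis using det_nz by simp
    next
      case False
      then show ?thesis using b_supp by (auto simp: supp_below_def)
    qed
    then have "w j = 0" if "j < p" for j using rational_basis_independent[where q = w, OF b _ that] by blast
    with w(1) show False by blast
  qed
  moreover have "n - r \<le> p"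
  proof (rule ccontr)
    assume "\<not> n - r \<le> p"
    then have less: "p < n - r" by simp
    define g where "g i = (\<lambda>l. if l < n then V $$ (l, r + i) else 0)" for i
    have g_ker: "g i \<in> poly_kernel H" if i: "i < n - r" for i
    proof -
      have Ve: "V *\<^sub>v unit_vec n (r + i) = vec n (g i)"
        using i UV(2) by (intro eq_vecI) (auto simp: g_def)
      have "D *\<^sub>v unit_vec n (r + i) = 0\<^sub>v m"
        using Dc r i by (intro eq_vecI) (auto simp: Dx unit_vec_def simp del: index_mult_mat_vec)
      then have "U *\<^sub>v (H *\<^sub>v vec n (g i)) = 0\<^sub>v m" using DV[of "unit_vec n (r + i)"] Ve by simp
      then have "adj_mat U *\<^sub>v (U *\<^sub>v (H *\<^sub>v vec n (g i))) = adj_mat U *\<^sub>v 0\<^sub>v m" by simp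
      moreover have "adj_mat U *\<^sub>v (U *\<^sub>v (H *\<^sub>v vec n (g i))) = det U \<cdot>\<^sub>v (H *\<^sub>v vec n (g i))"
        using adjU UV(1) H by (simp add: assoc_mult_mat_vec[of _ m m _ m, symmetric] smult_one)
      moreover have "adj_mat U *\<^sub>v 0\<^sub>v m = 0\<^sub>v m" using adjU(1) by (intro eq_vecI) (auto simp: scalar_prod_def)
      ultimately have "H *\<^sub>v vec n (g i) = 0\<^sub>v m"
        using det_nz H by (auto simp: vec_eq_iff simp del: index_mult_mat_vec)
      then show ?thesis using ker_iff by (auto simp: g_def supp_below_def)
    qed
    have "\<exists>d Q. d \<noteq> 0 \<and> (\<forall>l. d * g i l = (\<Sum>j<p. Q j * b j l))" if "i < n - r" for i
      using b g_ker[OF that] unfolding rational_basis_def by blast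
    then obtain d Q where dQ: "\<And>i. i < n - r \<Longrightarrow> d i \<noteq> 0 \<and> (\<forall>l. d i * g i l = (\<Sum>j<p. Q i j * b j l))"
      by metis
    obtain w where w: "\<exists>i<n - r. w i \<noteq> 0" "\<forall>j<p. (\<Sum>i<n - r. Q i j * w i) = 0"
      using nontrivial_solution[OF less, of "\<lambda>j i. Q i j"] by blast
    \<comment> \<open>The dependency \<open>w\<close> of the coefficient rows, with denominators \<open>d\<close>, read as coordinates with
      respect to the columns of \<open>V\<close>.\<close>
    define z where "z = vec n (\<lambda>l. if l < r then 0 else w (l - r) * d (l - r))"
    have zc: "z \<in> carrier_vec n" by (simp add: z_def)
    have "V *\<^sub>v z = 0\<^sub>v n"
    proof (rule eq_vecI)
      fix l assume "l < dim_vec (0\<^sub>v n :: 'a poly vec)"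
      then have l: "l < n" by simp
      have "(V *\<^sub>v z) $ l = (\<Sum>k\<in>{0..<n}. V $$ (l, k) * z $ k)"
        using l UV(2) by (auto simp: z_def scalar_prod_def)
      also have "\<dots> = (\<Sum>k\<in>{r..<n}. V $$ (l, k) * z $ k)"
        by (rule sum.mono_neutral_right) (auto simp: z_def)
      also have "\<dots> = (\<Sum>i<n - r. V $$ (l, r + i) * z $ (r + i))"
        using r by (intro sum.reindex_bij_witness[of _ "\<lambda>i. r + i" "\<lambda>k. k - r"]) auto
      also have "\<dots> = (\<Sum>i<n - r. w i * (d i * g i l))"
        using l by (intro sum.cong) (auto simp: z_def g_def)
      also have "\<dots> = (\<Sum>i<n - r. \<Sum>j<p. b j l * (Q i j * w i))"
        using dQ by (intro sum.cong) (auto simp: sum_distrib_left algebra_simps)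
      also have "\<dots> = (\<Sum>j<p. b j l * (\<Sum>i<n - r. Q i j * w i))"
        by (subst sum.swap) (simp add: sum_distrib_left)
      also have "\<dots> = 0" using w(2) by simp
      finally show "(V *\<^sub>v z) $ l = 0\<^sub>v n $ l" using l by simp
    qed (use UV(2) in simp)
    then have "z = 0\<^sub>v n"
      using det_nz(2) det_0_iff_vec_prod_zero[OF UV(2)] zc by blast
    moreover obtain i where i: "i < n - r" "w i \<noteq> 0" using w(1) by blast
    ultimately have "z $ (r + i) = 0" by simp
    then show False using i dQ[OF i(1)] by (auto simp: z_def)
  qed
  ultimately show "p + normal_rank H = n" using rank r by simp
qed

section \<open>Homogenization and the Weyr characteristic of the regular part\<close>

text \<open>
  A form of degree \<open>q\<close> in \<open>s\<close> and \<open>t\<close>: the coefficient of the \<open>i\<close>-th power of \<open>s\<close> is a multiple of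
  \<open>t\<close> to the power \<open>q - i\<close>.
\<close>

definition homogeneous_poly :: "nat \<Rightarrow> 'a::field poly poly \<Rightarrow> bool" where
  "homogeneous_poly q f \<longleftrightarrow> (\<forall>i. \<exists>c. coeff f i = (if i \<le> q then monom c (q - i) else 0))"

lemma homogeneous_poly_sum:
  assumes "\<And>a. a \<in> I \<Longrightarrow> homogeneous_poly q (f a)"
  shows "homogeneous_poly q (\<Sum>a\<in>I. f a)"
  unfolding homogeneous_poly_def
proof
  fix i
  have "\<exists>c. a \<in> I \<longrightarrow> coeff (f a) i = (if i \<le> q then monom c (q - i) else 0)" for a
    using assms unfolding homogeneous_poly_def by blast
  then obtain c where c: "\<And>a. a \<in> I \<longrightarrow> coeff (f a) i = (if i \<le> q then monom (c a) (q - i) else 0)"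
    by metis
  have "coeff (\<Sum>a\<in>I. f a) i = (\<Sum>a\<in>I. if i \<le> q then monom (c a) (q - i) else 0)"
    by (simp add: coeff_sum c)
  also have "\<dots> = (if i \<le> q then monom (\<Sum>a\<in>I. c a) (q - i) else 0)"
    by (simp add: monom_sum)
  finally show "\<exists>c. coeff (\<Sum>a\<in>I. f a) i = (if i \<le> q then monom c (q - i) else 0)" by blast
qed

lemma homogeneous_poly_mult:
  assumes "homogeneous_poly a f" "homogeneous_poly b g"
  shows "homogeneous_poly (a + b) (f * g)"
  unfolding homogeneous_poly_def
proof
  fix i
  obtain c d where c: "\<And>i. coeff f i = (if i \<le> a then monom (c i) (a - i) else 0)"
    and d: "\<And>i. coeff g i = (if i \<le> b then monom (d i) (b - i) else 0)"
    using assms unfolding homogeneous_poly_def by metis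
  have "coeff (f * g) i = (\<Sum>j\<le>i. if i \<le> a + b then
      monom (if j \<le> a \<and> i - j \<le> b then c j * d (i - j) else 0) (a + b - i) else 0)"
    unfolding coeff_mult
  proof (rule sum.cong)
    fix j assume "j \<in> {..i}"
    then have "a - j + (b - (i - j)) = a + b - i" if "j \<le> a" "i - j \<le> b" using that by auto
    then show "coeff f j * coeff g (i - j) = (if i \<le> a + b then
      monom (if j \<le> a \<and> i - j \<le> b then c j * d (i - j) else 0) (a + b - i) else 0)"
      by (auto simp: c d mult_monom)
  qed simp
  also have "\<dots> = (if i \<le> a + b then
      monom (\<Sum>j\<le>i. if j \<le> a \<and> i - j \<le> b then c j * d (i - j) else 0) (a + b - i) else 0)"
    by (simp add: monom_sum)
  finally show "\<exists>c. coeff (f * g) i = (if i \<le> a + b then monom c (a + b - i) else 0)" by blast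
qed

lemma homogeneous_poly_const: "homogeneous_poly 0 [:[:c:]:]"
  unfolding homogeneous_poly_def by (auto simp: coeff_pCons monom_0 split: nat.splits)

lemma homogeneous_poly_prod:
  "(\<And>i. i < q \<Longrightarrow> homogeneous_poly 1 (f i)) \<Longrightarrow> homogeneous_poly q (\<Prod>i<q. f i)"
proof (induction q)
  case 0
  show ?case using homogeneous_poly_const[of 1] by (simp add: one_pCons)
next
  case (Suc q)
  then show ?case using homogeneous_poly_mult[of q "\<Prod>i<q. f i" 1 "f q"] by simp
qed

lemma homogeneous_poly_det:
  assumes A: "A \<in> carrier_mat q q" and hom: "\<And>i j. i < q \<Longrightarrow> j < q \<Longrightarrow> homogeneous_poly 1 (A $$ (i, j))"
  shows "homogeneous_poly q (det A)"
  unfolding det_def'[OF A]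
proof (rule homogeneous_poly_sum)
  fix p assume "p \<in> {p. p permutes {0..<q}}"
  then have "p i < q" if "i < q" for i using permutes_in_image[of p "{0..<q}" i] that by simp
  then have "homogeneous_poly q (\<Prod>i = 0..<q. A $$ (i, p i))"
    unfolding atLeast0LessThan by (intro homogeneous_poly_prod hom)
  moreover have "(signof p :: 'a poly poly) = [:[:of_int (sign p):]:]"
    by (simp add: sign_def one_pCons)
  ultimately show "homogeneous_poly q (signof p * (\<Prod>i = 0..<q. A $$ (i, p i)))"
    using homogeneous_poly_mult[OF homogeneous_poly_const, of q _ "of_int (sign p)"] by simp
qed

text \<open>
  The substitution \<open>t = 1\<close>.
\<close>

definition dehomogenize :: "'a::field poly poly \<Rightarrow> 'a poly" where
  "dehomogenize f = map_poly (\<lambda>c. poly c 1) f"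

lemma coeff_dehomogenize: "coeff (dehomogenize f) i = poly (coeff f i) 1"
  by (simp add: dehomogenize_def coeff_map_poly)

global_interpretation dehomogenize: comm_ring_hom dehomogenize
  by unfold_locales
    (auto simp: poly_eq_iff coeff_dehomogenize coeff_mult poly_sum)

text \<open>
  Each power of \<open>s\<close> in a form is accompanied by a single power of \<open>t\<close>, so \<open>t = 1\<close> causes no
  cancellation.
\<close>

lemma dehomogenize_eq_0_iff:
  assumes "homogeneous_poly q f"
  shows "dehomogenize f = 0 \<longleftrightarrow> f = 0"
proof
  assume z: "dehomogenize f = 0"
  show "f = 0"
  proof (rule poly_eqI)
    fix i
    obtain c where c: "coeff f i = (if i \<le> q then monom c (q - i) else 0)"
      using assms unfolding homogeneous_poly_def by blast
    have "poly (coeff f i) 1 = 0" using z coeff_dehomogenize[of f i] by simp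
    then show "coeff f i = coeff 0 i" unfolding c by (auto simp: poly_monom)
  qed
qed (simp add: dehomogenize_def)

definition homogenize_entry :: "'a::field poly \<Rightarrow> 'a poly poly" where
  "homogenize_entry p = [: [:0, coeff p 0:], [:coeff p 1:] :]"

lemma homogenize_index:
  assumes "i < dim_row H" "j < dim_col H"
  shows "homogenize H $$ (i, j) = homogenize_entry (H $$ (i, j))"
  using assms by (simp add: homogenize_def homogenize_entry_def)

lemma homogenize_carrier: "H \<in> carrier_mat m n \<Longrightarrow> homogenize H \<in> carrier_mat m n"
  by (simp add: homogenize_def)

text \<open>
  The minors of the homogenized pencil are forms, and setting \<open>t = 1\<close> in them gives the minors of the
  pencil.
\<close>

lemma minors_homogenize_zero_iff:
  fixes H :: "'a::field poly mat"
  assumes H: "is_pencil m n H"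
  shows "(\<forall>x\<in>minors q (homogenize H). x = 0) \<longleftrightarrow> (\<forall>x\<in>minors q H. x = 0)"
proof -
  have Hc: "H \<in> carrier_mat m n" and deg: "\<And>i j. i < m \<Longrightarrow> j < n \<Longrightarrow> degree (H $$ (i, j)) \<le> 1"
    using H by (auto simp: is_pencil_def)
  note hc = homogenize_carrier[OF Hc]
  have entry: "dehomogenize (homogenize H $$ (i, j)) = H $$ (i, j)"
    "homogeneous_poly 1 (homogenize H $$ (i, j))" if "i < m" "j < n" for i j
  proof -
    have "coeff (H $$ (i, j)) k = 0" if "k > 1" for k
      using deg[OF \<open>i < m\<close> \<open>j < n\<close>] that by (intro coeff_eq_0) simp
    then show "dehomogenize (homogenize H $$ (i, j)) = H $$ (i, j)"
      using that Hc by (auto simp: poly_eq_iff coeff_dehomogenize homogenize_index homogenize_entry_def coeff_pCons split: nat.splits)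
    show "homogeneous_poly 1 (homogenize H $$ (i, j))"
      unfolding homogeneous_poly_def
    proof
      fix k :: nat
      consider "k = 0" | "k = 1" | "k > 1" by (metis less_one linorder_neqE_nat)
      then show "\<exists>c. coeff (homogenize H $$ (i, j)) k = (if k \<le> 1 then monom c (1 - k) else 0)"
        using that Hc by cases (auto simp: homogenize_index homogenize_entry_def coeff_pCons monom_Suc monom_0 split: nat.splits)
    qed
  qed
  have det: "det (mat q q (\<lambda>(i, j). homogenize H $$ (f i, g j))) = 0 \<longleftrightarrow> det (mat q q (\<lambda>(i, j). H $$ (f i, g j))) = 0"
    if fg: "\<forall>i<q. f i < m" "\<forall>j<q. g j < n" for f g
  proof -
    have "map_mat dehomogenize (mat q q (\<lambda>(i, j). homogenize H $$ (f i, g j))) = mat q q (\<lambda>(i, j). H $$ (f i, g j))"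
      using fg entry(1) by (intro eq_matI) auto
    then have "dehomogenize (det (mat q q (\<lambda>(i, j). homogenize H $$ (f i, g j)))) = det (mat q q (\<lambda>(i, j). H $$ (f i, g j)))"
      by (metis dehomogenize.hom_det)
    moreover have "homogeneous_poly q (det (mat q q (\<lambda>(i, j). homogenize H $$ (f i, g j))))"
      by (rule homogeneous_poly_det) (use fg entry(2) in auto)
    ultimately show ?thesis using dehomogenize_eq_0_iff by metis
  qed
  have "(\<forall>x\<in>minors q (homogenize H). 0 dvd x) \<longleftrightarrow> (\<forall>x\<in>minors q H. 0 dvd x)"
    unfolding dvd_minors_iff using hc Hc det by (simp only: carrier_matD dvd_0_left_iff) blast
  then show ?thesis by simp
qed

text \<open>
  At a finite point the form is monic of degree one in \<open>s\<close>, at infinity it is the constant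
  polynomial \<open>t\<close>.
\<close>

lemma prime_elem_linear_form: "prime_elem (linear_form x :: 'a::field poly poly)"
proof (cases x)
  case (Fin l)
  then show ?thesis using prime_elem_linear_factor[of "[:0, l:]"] by simp
next
  case Infty
  have "prime_elem [:0, 1 :: 'a:]" using prime_elem_linear_factor[of "0 :: 'a"] by simp
  then show ?thesis using Infty by (simp add: prime_elem_const_poly_iff)
qed

lemma linear_form_power_not_dvd:
  fixes a :: "'a::field poly poly"
  assumes "a \<noteq> 0"
  shows "\<exists>k. \<not> linear_form x ^ k dvd a"
proof (cases x)
  case (Fin l)
  have "\<not> linear_form x ^ Suc (degree a) dvd a"
  proof
    assume "linear_form x ^ Suc (degree a) dvd a"
    then have "degree (linear_form x ^ Suc (degree a)) \<le> degree a" using assms by (rule dvd_imp_degree_le)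
    then show False using Fin degree_linear_power[of "- [:0, l:]" "Suc (degree a)"] by simp
  qed
  then show ?thesis by blast
next
  case Infty
  obtain i where i: "coeff a i \<noteq> 0" using assms by (auto simp: poly_eq_iff)
  have "\<not> linear_form x ^ Suc (degree (coeff a i)) dvd a"
  proof
    assume "linear_form x ^ Suc (degree (coeff a i)) dvd a"
    then have "[:[:0, 1:] ^ Suc (degree (coeff a i)):] dvd a"
      using Infty by (simp only: linear_form.simps poly_const_pow)
    then have "[:0, 1:] ^ Suc (degree (coeff a i)) dvd coeff a i"
      by (simp add: const_poly_dvd_iff)
    then have "degree ([:0, 1 :: 'a:] ^ Suc (degree (coeff a i))) \<le> degree (coeff a i)"
      using i by (rule dvd_imp_degree_le)
    then show False using degree_linear_power[of "0 :: 'a" "Suc (degree (coeff a i))"] by simp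
  qed
  then show ?thesis by blast
qed

lemma linear_form_not_dvd:
  fixes x y :: "'a::field point"
  assumes "x \<noteq> y"
  shows "\<not> (linear_form x :: 'a poly poly) dvd linear_form y"
proof (cases x)
  case (Fin l)
  have "poly (linear_form y) [:0, l:] \<noteq> 0"
    using assms Fin by (cases y) auto
  then show ?thesis using Fin poly_eq_0_iff_dvd[of "linear_form y" "[:0, l:]"] by simp
next
  case Infty
  then obtain l where "y = Fin l" using assms by (cases y) auto
  then show ?thesis using Infty
    by (auto simp: const_poly_dvd_iff coeff_pCons is_unit_poly_iff split: nat.splits dest!: spec[of _ 1])
qed

lemma linear_form_not_dvd_const: "c \<noteq> 0 \<Longrightarrow> \<not> (linear_form x :: 'a::field poly poly) dvd [:[:c:]:]"
proof
  assume c: "c \<noteq> 0" and dvd: "(linear_form x :: 'a poly poly) dvd [:[:c:]:]"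
  have "[:[:c:]:] dvd (1 :: 'a poly poly)" using c by (simp add: is_unit_const_poly_iff dvd_field_iff)
  with dvd have "(linear_form x :: 'a poly poly) dvd 1" by (rule dvd_trans)
  then show False using prime_elem_linear_form[of x] by (simp add: prime_elem_not_unit)
qed

text \<open>
  The number of diagonal entries is the largest order of a nonzero minor of the homogenized pencil.
\<close>

lemma homogenize_local_smith_form:
  fixes H :: "'a::field poly mat"
  assumes H: "is_pencil m n H"
  shows "\<exists>e u. local_smith_form (linear_form x) (homogenize H) (normal_rank H) e u"
proof -
  obtain r e u where sm: "local_smith_form (linear_form x) (homogenize H) r e u"
    using local_smith_form_exists[OF prime_elem_linear_form linear_form_power_not_dvd] by blast
  have "(\<exists>d\<in>minors k H. d \<noteq> 0) \<longleftrightarrow> k \<le> r" for k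
    using local_smith_form_minors(1,3)[OF prime_elem_linear_form sm, of k] minors_homogenize_zero_iff[OF H, of k]
    by (meson not_le)
  then have "normal_rank H = Max {..r}" by (simp add: normal_rank_def atMost_def)
  then have "normal_rank H = r" by (simp add: Max_eq_iff)
  with sm show ?thesis by blast
qed

text \<open>
  The product of the first \<open>k\<close> invariant factors is the greatest common divisor of the minors of order
  \<open>k\<close>. The linear form at \<open>x\<close> divides the product with multiplicity the sum of the partial
  multiplicities of these factors, and it divides the minors with multiplicity the sum of the first \<open>k\<close>
  exponents. The order of indexing is reversed, as partial multiplicities are numbered from the
  last invariant factor on.
\<close>

lemma partial_multiplicities_eq_smith_exponents:
  fixes H :: "'a::field poly mat"
  assumes z: "partial_multiplicities H z"
    and sm: "local_smith_form (linear_form x) (homogenize H) (normal_rank H) e u"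
    and i: "i < normal_rank H"
  shows "z x (normal_rank H - i) = e i"
proof -
  let ?p = "linear_form x :: 'a poly poly" and ?\<rho> = "normal_rank H"
  note p = prime_elem_linear_form[of x]
  obtain \<pi> where gcd: "\<And>k. k \<le> ?\<rho> \<Longrightarrow> is_gcd_of (\<Prod>i=1..k. \<pi> i) (minors k (homogenize H))"
    and \<pi>: "\<forall>i \<in> {1..?\<rho>}. finite {x. z x i \<noteq> 0} \<and> (\<exists>c. c \<noteq> 0 \<and>
              \<pi> (?\<rho> - i + 1) = [: [:c:] :] * (\<Prod>x | z x i \<noteq> 0. linear_form x ^ z x i))"
    using z unfolding partial_multiplicities_def homogeneous_invariant_factors_def by blast
  have factor: "\<exists>v. \<pi> (Suc l) = ?p ^ z x (?\<rho> - l) * v \<and> \<not> ?p dvd v" if l: "l < ?\<rho>" for l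
  proof -
    define j where "j = ?\<rho> - l"
    have j: "j \<in> {1..?\<rho>}" "?\<rho> - j + 1 = Suc l" using l by (auto simp: j_def)
    then obtain c where c: "finite {x. z x j \<noteq> 0}" "c \<noteq> 0"
        "\<pi> (Suc l) = [: [:c:] :] * (\<Prod>x | z x j \<noteq> 0. linear_form x ^ z x j)"
      using \<pi> by (metis (no_types, lifting))
    define v where "v = [:[:c:]:] * (\<Prod>y\<in>{y. z y j \<noteq> 0} - {x}. linear_form y ^ z y j)"
    have "(\<Prod>x | z x j \<noteq> 0. linear_form x ^ z x j) = ?p ^ z x j * (\<Prod>y\<in>{y. z y j \<noteq> 0} - {x}. linear_form y ^ z y j)"
    proof (cases "z x j = 0")
      case False
      then show ?thesis using c(1) by (subst prod.remove[of _ x]) auto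
    next
      case True
      then have "{y. z y j \<noteq> 0} - {x} = {y. z y j \<noteq> 0}" by auto
      then show ?thesis using True by simp
    qed
    then have "\<pi> (Suc l) = ?p ^ z x j * v" by (simp add: c(3) v_def algebra_simps)
    moreover have "\<not> ?p dvd (\<Prod>y\<in>{y. z y j \<noteq> 0} - {x}. linear_form y ^ z y j)"
    proof (rule prime_elem_not_dvd_prod[OF p])
      fix y assume "y \<in> {y. z y j \<noteq> 0} - {x}"
      then have "\<not> ?p dvd linear_form y" by (intro linear_form_not_dvd) auto
      then show "\<not> ?p dvd linear_form y ^ z y j" using p prime_elem_dvd_power by blast
    qed
    then have "\<not> ?p dvd v"
      using linear_form_not_dvd_const[OF c(2)] p by (simp add: v_def prime_elem_dvd_mult_iff del: mult_pCons_left)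
    ultimately show ?thesis by (auto simp: j_def)
  qed
  then obtain v where v: "\<And>l. l < ?\<rho> \<Longrightarrow> \<pi> (Suc l) = ?p ^ z x (?\<rho> - l) * v l \<and> \<not> ?p dvd v l"
    by metis
  have sums: "(\<Sum>l<k. z x (?\<rho> - l)) = (\<Sum>l<k. e l)" if k: "k \<le> ?\<rho>" for k
  proof -
    have "(\<Prod>i=1..k. \<pi> i) = (\<Prod>l<k. \<pi> (Suc l))"
      by (rule prod.reindex_bij_witness[of _ Suc "\<lambda>i. i - 1"]) auto
    also have "\<dots> = (\<Prod>l<k. ?p ^ z x (?\<rho> - l) * v l)"
      by (rule prod.cong) (use v k in auto)
    also have "\<dots> = ?p ^ (\<Sum>l<k. z x (?\<rho> - l)) * (\<Prod>l<k. v l)"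
      by (simp add: prod.distrib power_sum)
    finally have prod: "(\<Prod>i=1..k. \<pi> i) = ?p ^ (\<Sum>l<k. z x (?\<rho> - l)) * (\<Prod>l<k. v l)" .
    have nd: "\<not> ?p dvd (\<Prod>l<k. v l)"
      by (rule prime_elem_not_dvd_prod[OF p]) (use v k in auto)
    have "j \<le> (\<Sum>l<k. z x (?\<rho> - l)) \<longleftrightarrow> j \<le> (\<Sum>l<k. e l)" for j
    proof -
      have "j \<le> (\<Sum>l<k. z x (?\<rho> - l)) \<longleftrightarrow> ?p ^ j dvd (\<Prod>i=1..k. \<pi> i)"
        unfolding prod using prime_power_dvd_cancel[OF p nd] by (auto intro: dvd_mult2 le_imp_power_dvd)
      also have "\<dots> \<longleftrightarrow> (\<forall>x\<in>minors k (homogenize H). ?p ^ j dvd x)"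
        using gcd[OF k] unfolding is_gcd_of_def by (meson dvd_trans)
      also have "\<dots> \<longleftrightarrow> j \<le> (\<Sum>l<k. e l)"
        by (rule local_smith_form_minors(2)[OF p sm k])
      finally show ?thesis .
    qed
    then show ?thesis by (meson order_antisym order_refl)
  qed
  show ?thesis using sums[of "Suc i"] sums[of i] i by simp
qed

text \<open>
  An exponent either contributes to the \<open>k\<close>-th entry of the Weyr characteristic or is less than
  \<open>k\<close>. The assumption on \<open>k\<close> keeps the infinitely many vanishing partial multiplicities out of
  the count.
\<close>

lemma weyr_eq_rank_minus_card:
  fixes H :: "'a::field poly mat"
  assumes z: "partial_multiplicities H z"
    and sm: "local_smith_form (linear_form x) (homogenize H) (normal_rank H) e u"
    and k: "1 \<le> k"
  shows "conjugate_seq (z x) k + card {i. i < normal_rank H \<and> e i < k} = normal_rank H"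
proof -
  let ?\<rho> = "normal_rank H"
  have big: "z x i = 0" if "?\<rho> < i" for i using z that by (simp add: partial_multiplicities_def)
  have "{i. 1 \<le> i \<and> k \<le> z x i} = (\<lambda>i. ?\<rho> - i) ` {i. i < ?\<rho> \<and> k \<le> e i}"
  proof (intro equalityI subsetI)
    fix i assume "i \<in> {i. 1 \<le> i \<and> k \<le> z x i}"
    then have i: "1 \<le> i" "k \<le> z x i" by auto
    then have "i \<le> ?\<rho>" using big k by (metis not_le le_zero_eq not_one_le_zero)
    then have "z x i = e (?\<rho> - i)"
      using partial_multiplicities_eq_smith_exponents[OF z sm, of "?\<rho> - i"] i by simp
    then show "i \<in> (\<lambda>i. ?\<rho> - i) ` {i. i < ?\<rho> \<and> k \<le> e i}"
      using i \<open>i \<le> ?\<rho>\<close> by (intro image_eqI[of _ _ "?\<rho> - i"]) auto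
  next
    fix i assume "i \<in> (\<lambda>i. ?\<rho> - i) ` {i. i < ?\<rho> \<and> k \<le> e i}"
    then show "i \<in> {i. 1 \<le> i \<and> k \<le> z x i}"
      using partial_multiplicities_eq_smith_exponents[OF z sm] by auto
  qed
  moreover have "inj_on (\<lambda>i. ?\<rho> - i) {i. i < ?\<rho> \<and> k \<le> e i}" by (intro inj_onI) auto
  ultimately have "conjugate_seq (z x) k = card {i. i < ?\<rho> \<and> k \<le> e i}"
    unfolding conjugate_seq_def by (simp add: card_image)
  moreover have "card {..<?\<rho>} = card ({i. i < ?\<rho> \<and> k \<le> e i} \<union> {i. i < ?\<rho> \<and> e i < k})"
    by (rule arg_cong[of _ _ card]) auto
  moreover have "\<dots> = card {i. i < ?\<rho> \<and> k \<le> e i} + card {i. i < ?\<rho> \<and> e i < k}"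
    by (rule card_Un_disjoint) auto
  ultimately show ?thesis by simp
qed

text \<open>
  Homogenization is linear, so it commutes with multiplication by the constant factors.
\<close>

lemma homogenize_rank_one:
  fixes u v :: "nat \<Rightarrow> 'a::field poly"
  assumes "(\<forall>i<m. degree (u i) = 0) \<or> (\<forall>j<n. degree (v j) = 0)"
  shows "\<exists>a b. \<forall>i<m. \<forall>j<n. homogenize_entry (u i * v j) = a i * b j"
  using assms
proof
  let ?h = homogenize_entry
  have const: "?h ([:c:] * q) = [:[:c:]:] * ?h q" for c and q :: "'a poly"
    by (simp add: homogenize_entry_def)
  {
    assume u: "\<forall>i<m. degree (u i) = 0"
    have "?h (u i * v j) = [:[:coeff (u i) 0:]:] * ?h (v j)" if i: "i < m" for i j
    proof -
      obtain c where c: "u i = [:c:]" by (rule degree_eq_zeroE[of "u i"]) (use u i in simp)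
      show ?thesis unfolding c coeff_pCons_0 by (rule const)
    qed
    then have "\<forall>i<m. \<forall>j<n. ?h (u i * v j) = [:[:coeff (u i) 0:]:] * ?h (v j)" by blast
    then show ?thesis by (rule exI[of _ "\<lambda>i. [:[:coeff (u i) 0:]:]", OF exI[of _ "\<lambda>j. ?h (v j)"]])
  next
    assume v: "\<forall>j<n. degree (v j) = 0"
    have "?h (u i * v j) = ?h (u i) * [:[:coeff (v j) 0:]:]" if j: "j < n" for i j
    proof -
      obtain c where c: "v j = [:c:]" by (rule degree_eq_zeroE[of "v j"]) (use v j in simp)
      show ?thesis unfolding c coeff_pCons_0 mult.commute[of "u i"] const by (rule mult.commute)
    qed
    then have "\<forall>i<m. \<forall>j<n. ?h (u i * v j) = ?h (u i) * [:[:coeff (v j) 0:]:]" by blast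
    then show ?thesis by (rule exI[of _ "\<lambda>i. ?h (u i)", OF exI[of _ "\<lambda>j. [:[:coeff (v j) 0:]:]"]])
  }
qed

text \<open>
  By the perturbation lemma for local Smith forms, used in both directions: \<open>H\<close> is itself the
  perturbation of \<open>H + P\<close> by \<open>- P\<close>.
\<close>

theorem rank_one_perturbation_weyr:
  fixes H P :: "'a::field poly mat"
  assumes H: "is_pencil m n H" and P: "is_pencil m n P"
    and uv: "\<forall>i<m. \<forall>j<n. P $$ (i, j) = u i * v j"
    and const: "(\<forall>i<m. degree (u i) = 0) \<or> (\<forall>j<n. degree (v j) = 0)"
    and z: "partial_multiplicities H z" and z': "partial_multiplicities (H + P) z'"
    and k: "1 \<le> k"
  shows "\<bar>(int (conjugate_seq (z' x) k) - int (normal_rank (H + P)))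
      - (int (conjugate_seq (z x) k) - int (normal_rank H))\<bar> \<le> 1"
proof -
  have HP: "is_pencil m n (H + P)"
    using H P by (auto simp: is_pencil_def intro!: degree_add_le)
  have Hc: "H \<in> carrier_mat m n" and Pc: "P \<in> carrier_mat m n" using H P by (auto simp: is_pencil_def)
  obtain e w where sm: "local_smith_form (linear_form x) (homogenize H) (normal_rank H) e w"
    using homogenize_local_smith_form[OF H] by blast
  obtain e' w' where sm': "local_smith_form (linear_form x) (homogenize (H + P)) (normal_rank (H + P)) e' w'"
    using homogenize_local_smith_form[OF HP] by blast
  obtain a b where ab: "\<forall>i<m. \<forall>j<n. homogenize_entry (u i * v j) = a i * b j"
    using homogenize_rank_one[OF const] by blast
  have sum: "homogenize (H + P) $$ (i, j) = homogenize H $$ (i, j) + a i * b j" if ij: "i < m" "j < n" for i j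
  proof -
    have "homogenize (H + P) $$ (i, j)
        = homogenize H $$ (i, j) + homogenize_entry (u i * v j)"
      using ij Hc Pc uv by (simp add: homogenize_index homogenize_entry_def)
    then show ?thesis using ab ij by simp
  qed
  have "card {i. i < normal_rank (H + P) \<and> e' i < k} \<le> card {i. i < normal_rank H \<and> e i < k} + 1"
    by (rule rank_one_perturbation_local_smith_form[OF prime_elem_linear_form homogenize_carrier[OF Hc]
          homogenize_carrier[OF add_carrier_mat[OF Pc]] sum sm sm'])
  moreover have "card {i. i < normal_rank H \<and> e i < k} \<le> card {i. i < normal_rank (H + P) \<and> e' i < k} + 1"
    by (rule rank_one_perturbation_local_smith_form[where a = "\<lambda>i. - a i" and b = b,
          OF prime_elem_linear_form homogenize_carrier[OF add_carrier_mat[OF Pc]] homogenize_carrier[OF Hc] _ sm' sm])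
      (use sum in auto)
  ultimately show ?thesis
    using weyr_eq_rank_minus_card[OF z sm k] weyr_eq_rank_minus_card[OF z' sm' k] by linarith
qed

section \<open>Factorization of a pencil of rank one\<close>

text \<open>
  A nonzero combination of least degree divides every \<open>f j\<close>, since the remainders are combinations too.
\<close>

lemma bezout_combination:
  fixes f :: "nat \<Rightarrow> 'a::field poly"
  assumes "\<exists>j<n. f j \<noteq> 0"
  shows "\<exists>g c. g \<noteq> 0 \<and> g = (\<Sum>j<n. c j * f j) \<and> (\<forall>j<n. g dvd f j)"
proof -
  define I where "I = {g. g \<noteq> 0 \<and> (\<exists>c. g = (\<Sum>j<n. c j * f j))}"
  have in_I: "f j \<in> I" if "j < n" "f j \<noteq> 0" for j
  proof -
    have "f j = (\<Sum>i<n. (if i = j then 1 else 0) * f i)"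
      using that by (subst sum.cong[OF refl, of _ _ "\<lambda>i. if i = j then f i else 0"]) auto
    with that show ?thesis unfolding I_def mem_Collect_eq by (intro conjI exI)
  qed
  then have "I \<noteq> {}" using assms by blast
  then obtain g where g: "g \<in> I" and min: "\<And>h. h \<in> I \<Longrightarrow> degree g \<le> degree h"
    using ex_has_least_nat[of "\<lambda>g. g \<in> I" _ degree] by blast
  from g obtain c where c: "g = (\<Sum>j<n. c j * f j)" and g0: "g \<noteq> 0" by (auto simp: I_def)
  have "g dvd f j" if j: "j < n" for j
  proof (rule ccontr)
    assume "\<not> g dvd f j"
    then have r0: "f j mod g \<noteq> 0" by (simp add: mod_eq_0_iff_dvd)
    have "(\<Sum>i<n. ((if i = j then 1 else 0) - (f j div g) * c i) * f i)
        = (\<Sum>i<n. (if i = j then f i else 0)) - (f j div g) * (\<Sum>i<n. c i * f i)"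
      unfolding sum_distrib_left sum_subtractf[symmetric]
      by (intro sum.cong) (auto simp: algebra_simps)
    also have "\<dots> = f j - (f j div g) * g"
      using j c by (simp add: sum.delta)
    also have "\<dots> = f j mod g" by (simp add: minus_div_mult_eq_mod)
    finally have "f j mod g \<in> I" using r0 unfolding I_def mem_Collect_eq
      by (intro conjI exI[of _ "\<lambda>i. (if i = j then 1 else 0) - (f j div g) * c i"]) simp_all
    then have "degree g \<le> degree (f j mod g)" by (rule min)
    moreover have "degree (f j mod g) < degree g" using degree_mod_less[OF g0, of "f j"] r0 by simp
    ultimately show False by simp
  qed
  with c g0 show ?thesis by blast
qed

text \<open>
  Dividing a nonzero row by its greatest common divisor leaves a row \<open>v\<close> whose entries combine to
  \<open>1\<close>; the same combination of the entries of row \<open>i\<close> is the factor \<open>u i\<close>.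
\<close>

lemma rank_one_factorization:
  fixes P :: "nat \<Rightarrow> nat \<Rightarrow> 'a::field poly"
  assumes minor0: "\<And>i i' j j'. i < m \<Longrightarrow> i' < m \<Longrightarrow> j < n \<Longrightarrow> j' < n \<Longrightarrow> P i j * P i' j' = P i j' * P i' j"
    and nz: "\<exists>i<m. \<exists>j<n. P i j \<noteq> 0"
  shows "\<exists>u v. \<forall>i<m. \<forall>j<n. P i j = u i * v j"
proof -
  obtain i0 where i0: "i0 < m" "\<exists>j<n. P i0 j \<noteq> 0" using nz by blast
  obtain g c where g: "g \<noteq> 0" "g = (\<Sum>j<n. c j * P i0 j)" "\<forall>j<n. g dvd P i0 j"
    using bezout_combination[OF i0(2)] by blast
  define v where "v j = P i0 j div g" for j
  define u where "u i = (\<Sum>k<n. c k * P i k)" for i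
  have v: "P i0 j = g * v j" if "j < n" for j using g that by (simp add: v_def)
  have cross: "P i j * v k = P i k * v j" if "i < m" "j < n" "k < n" for i j k
  proof -
    have "g * (P i j * v k) = g * (P i k * v j)"
      using minor0[OF that(1) i0(1) that(2) that(3)] v that by (simp add: algebra_simps)
    with g show ?thesis by simp
  qed
  have "g * (\<Sum>k<n. c k * v k) = (\<Sum>k<n. c k * P i0 k)"
    by (simp add: sum_distrib_left v algebra_simps)
  then have "g * (\<Sum>k<n. c k * v k) = g * 1" using g(2) by simp
  then have one: "(\<Sum>k<n. c k * v k) = 1" using g(1) by (simp only: mult_cancel_left) simp
  have "P i j = u i * v j" if ij: "i < m" "j < n" for i j
  proof -
    have "P i j = (\<Sum>k<n. c k * v k) * P i j" by (simp add: one)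
    also have "\<dots> = (\<Sum>k<n. c k * (P i j * v k))"
      unfolding sum_distrib_right by (simp add: mult_ac)
    also have "\<dots> = (\<Sum>k<n. c k * (P i k * v j))" using cross ij by simp
    also have "\<dots> = u i * v j"
      unfolding u_def sum_distrib_right by (simp add: mult_ac)
    finally show ?thesis .
  qed
  then show ?thesis by blast
qed

lemma rank_one_degree_one_factorization:
  fixes P :: "nat \<Rightarrow> nat \<Rightarrow> 'a::field poly"
  assumes minor0: "\<And>i i' j j'. i < m \<Longrightarrow> i' < m \<Longrightarrow> j < n \<Longrightarrow> j' < n \<Longrightarrow> P i j * P i' j' = P i j' * P i' j"
    and nz: "\<exists>i<m. \<exists>j<n. P i j \<noteq> 0"
    and deg: "\<And>i j. i < m \<Longrightarrow> j < n \<Longrightarrow> degree (P i j) \<le> 1"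
  shows "\<exists>u v. (\<forall>i<m. \<forall>j<n. P i j = u i * v j) \<and> (\<exists>i<m. u i \<noteq> 0) \<and> (\<exists>j<n. v j \<noteq> 0) \<and>
     ((\<forall>i<m. degree (u i) = 0) \<or> (\<forall>j<n. degree (v j) = 0))"
proof -
  obtain u v where uv: "\<forall>i<m. \<forall>j<n. P i j = u i * v j"
    using rank_one_factorization[OF minor0 nz] by blast
  obtain i0 j0 where ij0: "i0 < m" "j0 < n" "u i0 \<noteq> 0" "v j0 \<noteq> 0" using nz uv by auto
  have sum_le: "degree (u i) + degree (v j) \<le> 1"
    if "i < m" "j < n" "u i \<noteq> 0" "v j \<noteq> 0" for i j
    using deg[OF that(1,2)] uv that by (simp add: degree_mult_eq)
  have "(\<forall>i<m. degree (u i) = 0) \<or> (\<forall>j<n. degree (v j) = 0)"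
  proof (rule ccontr)
    assume "\<not> ?thesis"
    then obtain i j where "i < m" "j < n" "degree (u i) \<noteq> 0" "degree (v j) \<noteq> 0" by blast
    with sum_le[of i j] show False by force
  qed
  then have "(\<forall>i<m. \<forall>j<n. P i j = u i * v j) \<and> (\<exists>i<m. u i \<noteq> 0) \<and> (\<exists>j<n. v j \<noteq> 0) \<and>
     ((\<forall>i<m. degree (u i) = 0) \<or> (\<forall>j<n. degree (v j) = 0))"
    by (intro conjI uv) (use ij0 in blast)+
  then show ?thesis by (intro exI)
qed

text \<open>
  The maximum in the definition of the rank is taken over an initial segment of the natural numbers,
  since a nonzero minor of one order implies nonzero minors of all smaller orders.
\<close>

lemma normal_rank_minors:
  fixes H :: "'a::field poly mat"
  shows "normal_rank H < k \<Longrightarrow> x \<in> minors k H \<Longrightarrow> x = 0"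
    and "k \<le> normal_rank H \<Longrightarrow> \<exists>x\<in>minors k H. x \<noteq> 0"
proof -
  define s where "s = [:0, 1 :: 'a:]"
  have s: "prime_elem s" using prime_elem_linear_factor[of 0] by (simp add: s_def)
  have "\<exists>k. \<not> s ^ k dvd a" if "a \<noteq> 0" for a
    using linear_factor_power_not_dvd[OF that, of 0] by (simp add: s_def)
  then obtain r e u where sm: "local_smith_form s H r e u" using local_smith_form_exists[OF s] by blast
  note minors = local_smith_form_minors[OF s sm, folded local_smith_form_normal_rank[OF s sm]]
  show "normal_rank H < k \<Longrightarrow> x \<in> minors k H \<Longrightarrow> x = 0" by (rule minors(1))
  show "k \<le> normal_rank H \<Longrightarrow> \<exists>x\<in>minors k H. x \<noteq> 0" by (rule minors(3))
qed

lemma normal_rank_transpose: "normal_rank (transpose_mat H) = normal_rank H"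
proof -
  have "(\<exists>d\<in>minors k (transpose_mat H). d \<noteq> 0) \<longleftrightarrow> (\<exists>d\<in>minors k H. d \<noteq> 0)" for k
    using dvd_minors_transpose[of k H 0] by auto
  then show ?thesis by (simp add: normal_rank_def)
qed

lemma is_pencil_transpose: "is_pencil m n H \<Longrightarrow> is_pencil n m (transpose_mat H)"
  by (auto simp: is_pencil_def)

lemma det_2_by_2:
  fixes A :: "'r::comm_ring_1 mat"
  assumes A: "A \<in> carrier_mat 2 2"
  shows "det A = A $$ (0, 0) * A $$ (1, 1) - A $$ (1, 0) * A $$ (0, 1)"
proof -
  have "det A = (\<Sum>i<2. A $$ (i, 0) * cofactor A i 0)"
    by (rule laplace_expansion_column[OF A]) simp
  also have "\<dots> = A $$ (0, 0) * cofactor A 0 0 + A $$ (1, 0) * cofactor A 1 0"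
    by (simp add: numeral_2_eq_2)
  also have "cofactor A 0 0 = A $$ (1, 1)"
    using A by (simp add: cofactor_def det_single mat_delete_def)
  also have "cofactor A 1 0 = - A $$ (0, 1)"
    using A by (simp add: cofactor_def det_single mat_delete_def)
  finally show ?thesis by simp
qed

text \<open>
  All minors of order two vanish, so the rows are proportional.
\<close>

lemma rank_one_pencil_factorization:
  fixes P :: "'a::field poly mat"
  assumes P: "is_pencil m n P" and rank: "normal_rank P = 1"
  shows "\<exists>u v. (\<forall>i<m. \<forall>j<n. P $$ (i, j) = u i * v j) \<and> (\<exists>i<m. u i \<noteq> 0) \<and> (\<exists>j<n. v j \<noteq> 0) \<and>
     ((\<forall>i<m. degree (u i) = 0) \<or> (\<forall>j<n. degree (v j) = 0))"
proof (rule rank_one_degree_one_factorization)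
  have Pc: "P \<in> carrier_mat m n" using P by (simp add: is_pencil_def)
  show "degree (P $$ (i, j)) \<le> 1" if "i < m" "j < n" for i j
    using P that by (simp add: is_pencil_def)
  show "P $$ (i, j) * P $$ (i', j') = P $$ (i, j') * P $$ (i', j)"
    if ij: "i < m" "i' < m" "j < n" "j' < n" for i i' j j'
  proof -
    let ?f = "\<lambda>k. if k = 0 then i else i'" and ?g = "\<lambda>k. if k = 0 then j else j'"
    have "\<forall>x\<in>minors 2 P. 0 dvd x" using normal_rank_minors(1)[of P 2] rank by auto
    note this[unfolded dvd_minors_iff, THEN spec[of _ ?f], THEN spec[of _ ?g]]
    moreover have "\<forall>k<2. ?f k < dim_row P" "\<forall>k<2. ?g k < dim_col P" using ij Pc by auto
    ultimately have "det (mat 2 2 (\<lambda>(k, l). P $$ (?f k, ?g l))) = 0" by (simp only: dvd_0_left_iff) blast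
    then show ?thesis by (subst (asm) det_2_by_2) (auto simp: algebra_simps)
  qed
  show "\<exists>i<m. \<exists>j<n. P $$ (i, j) \<noteq> 0"
  proof (rule ccontr)
    assume not: "\<not> ?thesis"
    have "\<forall>x\<in>minors 1 P. 0 dvd x"
      unfolding dvd_minors_iff
    proof (intro allI impI)
      fix f g :: "nat \<Rightarrow> nat" assume "\<forall>i<1. f i < dim_row P" "\<forall>j<1. g j < dim_col P"
      then have "P $$ (f 0, g 0) = 0" using not Pc by auto
      then show "0 dvd det (mat 1 1 (\<lambda>(i, j). P $$ (f i, g j)))" by (simp add: det_single)
    qed
    then show False using normal_rank_minors(2)[of 1 P] rank by auto
  qed
qed

section \<open>Column minimal indices under a rank-one perturbation\<close>

text \<open>
  Both the rows of a pencil and the vector \<open>v\<close> act on polynomial vectors through such functionals.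
\<close>

definition dot :: "nat \<Rightarrow> (nat \<Rightarrow> 'a::field poly) \<Rightarrow> (nat \<Rightarrow> 'a poly) \<Rightarrow> 'a poly" where
  "dot n a x = (\<Sum>j<n. a j * x j)"

lemma linear_dot: "Vector_Spaces.linear vscale smult (dot n a)"
  by unfold_locales (simp_all add: dot_def vscale_def sum.distrib distrib_left sv.scale_sum_right)

lemma dot_shift: "dot n a (shift x) = [:0, 1:] * dot n a x"
  unfolding dot_def sum_distrib_left shift_def by (rule sum.cong) (simp_all only: mult.left_commute)

lemma deg_below_dot:
  assumes "\<forall>j<n. degree (a j) \<le> d" "\<forall>j. deg_below k (x j)"
  shows "deg_below (k + d) (dot n a x)"
  unfolding dot_def
proof -
  have "deg_below (k + d) (a j * x j)" if "j < n" for j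
  proof (cases k)
    case 0
    then have "x j = 0" using assms(2) by (auto simp: deg_below_def poly_eq_iff)
    then show ?thesis by (simp add: deg_below_def)
  next
    case (Suc k')
    then have "degree (x j) \<le> k'" using assms(2) by (simp add: deg_below_Suc_iff)
    moreover have "degree (a j) \<le> d" using assms(1) that by blast
    ultimately have "degree (a j * x j) \<le> k' + d"
      using degree_mult_le[of "a j" "x j"] by linarith
    then show ?thesis using Suc by (simp add: deg_below_Suc_iff)
  qed
  then show "deg_below (k + d) (\<Sum>j<n. a j * x j)"
    by (auto simp: deg_below_def coeff_sum intro!: sum.neutral)
qed

lemma poly_kernel_dot:
  assumes "H \<in> carrier_mat m n"
  shows "poly_kernel H = {x. supp_below n x \<and> (\<forall>i<m. dot n (\<lambda>j. H $$ (i, j)) x = 0)}"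
  using assms by (auto simp: poly_kernel_def dot_def)

lemma poly_submodule_poly_kernel:
  fixes H :: "'a::field poly mat"
  assumes H: "H \<in> carrier_mat m n"
  shows "poly_submodule n (poly_kernel H)"
  unfolding poly_kernel_dot[OF H] poly_submodule_def pv.subspace_def
  by (auto simp: pv_sv.linear_0[OF linear_dot] pv_sv.linear_add[OF linear_dot]
      pv_sv.linear_scale[OF linear_dot] dot_shift)
    (auto simp: supp_below_def vscale_def shift_def)

text \<open>
  The number of minimal indices that are at most \<open>k\<close>: entry \<open>k + 1\<close> of the partition counts those
  that are larger.
\<close>

definition brunovsky_counts :: "(nat \<Rightarrow> nat) \<Rightarrow> nat \<Rightarrow> int" where
  "brunovsky_counts r k = int (r 0) - int (r (Suc k))"

lemma conjugate_list_rev_sort: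
  "conjugate_list (rev (sort xs)) k = card {j. j < length xs \<and> k \<le> xs ! j}"
proof -
  have "conjugate_list (rev (sort xs)) k = length (filter (\<lambda>x. k \<le> x) (rev (sort xs)))"
    unfolding conjugate_list_def length_filter_conv_card by simp
  also have "\<dots> = size (filter_mset (\<lambda>x. k \<le> x) (mset (rev (sort xs))))"
    by (simp only: mset_filter[symmetric] size_mset)
  also have "\<dots> = length (filter (\<lambda>x. k \<le> x) xs)"
    by (simp only: mset_rev mset_sort mset_filter[symmetric] size_mset)
  finally show ?thesis by (simp add: length_filter_conv_card)
qed

text \<open>
  The sum serves as a bound for all members, also for the empty list.
\<close>

lemma conjugate_list_eventually_0: "sum_list c < k \<Longrightarrow> conjugate_list c k = 0"
proof -
  assume k: "sum_list c < k"
  have "{i. i < length c \<and> k \<le> c ! i} = {}"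
    using k member_le_sum_list[of _ c] nth_mem by (fastforce simp: not_le)
  then show ?thesis by (simp add: conjugate_list_def)
qed

lemma brunovsky_size:
  fixes c :: "nat list" and d :: nat
  defines "r \<equiv> brunovsky d c"
  shows "partition_size r = 0 \<longleftrightarrow> (\<forall>i\<ge>1. r i = 0)"
    and "(\<Sum>j\<le>k. r (Suc j)) \<le> partition_size r"
proof -
  have zero: "r i = 0" if "sum_list c < i" for i
    using that conjugate_list_eventually_0[OF that] by (simp add: r_def brunovsky_def)
  have sub: "{i. 1 \<le> i \<and> r i \<noteq> 0} \<subseteq> {..sum_list c}" 
  proof
    fix i assume "i \<in> {i. 1 \<le> i \<and> r i \<noteq> 0}"
    then show "i \<in> {..sum_list c}" using zero[of i] by (cases "sum_list c < i") auto
  qed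
  then have fin: "finite {i. 1 \<le> i \<and> r i \<noteq> 0}" by (rule finite_subset) simp
  show "partition_size r = 0 \<longleftrightarrow> (\<forall>i\<ge>1. r i = 0)"
    unfolding partition_size_def using fin by auto
  have "(\<Sum>j\<le>k. r (Suc j)) = (\<Sum>i\<in>{1..Suc k}. r i)"
    by (rule sum.reindex_bij_witness[of _ "\<lambda>i. i - 1" Suc]) auto
  also have "\<dots> = (\<Sum>i\<in>{i \<in> {1..Suc k}. r i \<noteq> 0}. r i)"
    by (rule sum.mono_neutral_right) auto
  also have "\<dots> \<le> partition_size r"
    unfolding partition_size_def by (rule sum_mono2[OF fin]) auto
  finally show "(\<Sum>j\<le>k. r (Suc j)) \<le> partition_size r" .
qed

text \<open>
  Connects the three descriptions of the minimal indices: degrees of a minimal basis, entries of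
  the Brunovsky partition, and growth of the dimension of the polynomial kernel.
\<close>

lemma column_minimal_indices_counts:
  fixes H :: "'a::field poly mat"
  assumes H: "H \<in> carrier_mat m n" and c: "column_minimal_indices H c"
    and r: "r = brunovsky (n - normal_rank H) c"
  shows "int (top_dim (poly_kernel H) k) = brunovsky_counts r k"
    and "r 0 + normal_rank H = n"
proof -
  obtain bs where bs: "minimal_null_basis H bs" and c_eq: "c = rev (sort (map vec_degree bs))"
    using c unfolding column_minimal_indices_def by blast
  let ?p = "length bs"
  note basis = minimal_null_basis_imp_minimal_rational_basis[OF bs]
  have dim: "dim_col H = n" using H by simp
  have card: "?p + normal_rank H = n"
    by (rule rational_basis_card[OF H, of _ "\<lambda>j. fun_of_vec (bs ! j)"])
      (use basis(1) in \<open>simp add: minimal_rational_basis_def\<close>)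
  have r0: "r 0 = ?p" using card by (simp add: r brunovsky_def)
  show "r 0 + normal_rank H = n" using card r0 by simp
  have "top_dim (poly_kernel H) k = card {j. j < ?p \<and> vdeg n (fun_of_vec (bs ! j)) \<le> k}"
    by (rule minimal_rational_basis_top_dim[OF poly_submodule_poly_kernel[OF H]])
      (use basis(1) dim in simp)
  also have "{j. j < ?p \<and> vdeg n (fun_of_vec (bs ! j)) \<le> k} = {j. j < ?p \<and> vec_degree (bs ! j) \<le> k}"
    using basis(2) dim by auto
  finally have top: "top_dim (poly_kernel H) k = card {j. j < ?p \<and> vec_degree (bs ! j) \<le> k}" .
  have "r (Suc k) = card {j. j < ?p \<and> Suc k \<le> vec_degree (bs ! j)}"
    unfolding r brunovsky_def c_eq conjugate_list_rev_sort by (auto intro!: arg_cong[of _ _ card])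
  moreover have "card {..<?p} = card ({j. j < ?p \<and> vec_degree (bs ! j) \<le> k} \<union> {j. j < ?p \<and> Suc k \<le> vec_degree (bs ! j)})"
    by (rule arg_cong[of _ _ card]) auto
  moreover have "\<dots> = card {j. j < ?p \<and> vec_degree (bs ! j) \<le> k} + card {j. j < ?p \<and> Suc k \<le> vec_degree (bs ! j)}"
    by (rule card_Un_disjoint) auto
  ultimately show "int (top_dim (poly_kernel H) k) = brunovsky_counts r k"
    using top r0 by (simp add: brunovsky_counts_def)
qed

text \<open>
  If \<open>u\<close> is constant with \<open>u i0 \<noteq> 0\<close>, then \<open>H x\<close> and \<open>(H + P) x\<close> are proportional to \<open>u\<close> for the same
  vectors \<open>x\<close>. These form the module \<open>M\<close>, given by the matrix \<open>G\<close> of eliminated rows, and each kernel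
  is cut out of \<open>M\<close> by the coordinate \<open>i0\<close> of \<open>H x\<close> or \<open>(H + P) x\<close>, of degree at most one in the
  coefficients. If \<open>v\<close> is constant, \<open>H\<close> and \<open>H + P\<close> agree on the vectors orthogonal to \<open>v\<close>.
\<close>

theorem rank_one_perturbation_counts:
  fixes H P :: "'a::field poly mat"
  assumes H: "is_pencil m n H" and P: "is_pencil m n P"
    and uv: "\<forall>i<m. \<forall>j<n. P $$ (i, j) = u i * v j" and u_nz: "\<exists>i<m. u i \<noteq> 0"
    and const: "(\<forall>i<m. degree (u i) = 0) \<or> (\<forall>j<n. degree (v j) = 0)"
    and c: "column_minimal_indices H c" and r: "r = brunovsky (n - normal_rank H) c"
    and c': "column_minimal_indices (H + P) c'" and r': "r' = brunovsky (n - normal_rank (H + P)) c'"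
    and near: "\<bar>int (r' 0) - int (r 0)\<bar> \<le> 1"
  shows "count_change_bounds (int (r 0)) (int (r' 0)) (int (partition_size r))
      (brunovsky_counts r) (brunovsky_counts r')"
proof -
  have Hc: "H \<in> carrier_mat m n" and Pc: "P \<in> carrier_mat m n" and HPc: "H + P \<in> carrier_mat m n"
    using H P by (auto simp: is_pencil_def)
  note H_counts = column_minimal_indices_counts[OF Hc c r]
  note HP_counts = column_minimal_indices_counts[OF HPc c' r']
  let ?a = "\<lambda>k. int (top_dim (poly_kernel H) k)" and ?b = "\<lambda>k. int (top_dim (poly_kernel (H + P)) k)"
  have a_eq: "brunovsky_counts r = ?a" and b_eq: "brunovsky_counts r' = ?b"
    using H_counts(1) HP_counts(1) by auto
  define L where "L = max (sum_list c) (sum_list c')"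
  have tail: "r (Suc k) = 0" "r' (Suc k) = 0" if "L \<le> k" for k
    using that conjugate_list_eventually_0[of c "Suc k"] conjugate_list_eventually_0[of c' "Suc k"]
    by (auto simp: r r' brunovsky_def L_def)
  have a_ev: "?a k = int (r 0)" and b_ev: "?b k = int (r' 0)" if "L \<le> k" for k
    using tail[OF that] unfolding H_counts(1) HP_counts(1) by (simp_all add: brunovsky_counts_def)
  have a_le: "?a k \<le> int (r 0)" and b_le: "?b k \<le> int (r' 0)" for k
    unfolding H_counts(1) HP_counts(1) by (simp_all add: brunovsky_counts_def)
  have S: "(\<Sum>j\<le>k. int (r 0) - ?a j) \<le> int (partition_size r)" for k
  proof -
    have "(\<Sum>j\<le>k. int (r 0) - ?a j) = int (\<Sum>j\<le>k. r (Suc j))"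
      unfolding H_counts(1) by (simp add: brunovsky_counts_def)
    also have "\<dots> \<le> int (partition_size r)"
      using brunovsky_size(2)[of "n - normal_rank H" c k] by (simp only: r of_nat_le_iff)
    finally show ?thesis .
  qed
  have mono: "mono (\<lambda>k. int (top_dim M k))" if "poly_submodule n M" for M :: "(nat \<Rightarrow> 'a poly) set"
    using mono_top_dim[OF that] by (auto simp: mono_def)
  note ker_H = poly_submodule_poly_kernel[OF Hc] and ker_HP = poly_submodule_poly_kernel[OF HPc]
  have row_HP: "dot n (\<lambda>j. (H + P) $$ (i, j)) x = dot n (\<lambda>j. H $$ (i, j)) x + u i * dot n v x" if "i < m" for i x
    using that Hc Pc by (simp add: dot_def uv sum.distrib sum_distrib_left algebra_simps)
  show ?thesis
    unfolding a_eq b_eq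
    using const
  proof
    assume u_const: "\<forall>i<m. degree (u i) = 0"
    obtain i0 where i0: "i0 < m" "u i0 \<noteq> 0" using u_nz by blast
    define G where "G = mat m n (\<lambda>(i, j). u i0 * H $$ (i, j) - u i * H $$ (i0, j))"
    define M where "M = poly_kernel G"
    have Gc: "G \<in> carrier_mat m n" by (simp add: G_def)
    have M: "poly_submodule n M" unfolding M_def by (rule poly_submodule_poly_kernel[OF Gc])
    have row_G: "dot n (\<lambda>j. G $$ (i, j)) x
        = u i0 * dot n (\<lambda>j. H $$ (i, j)) x - u i * dot n (\<lambda>j. H $$ (i0, j)) x" if "i < m" for i x
      using that by (simp add: dot_def G_def sum_subtractf sum_distrib_left algebra_simps)
    have ker_H_eq: "poly_kernel H = {x \<in> M. dot n (\<lambda>j. H $$ (i0, j)) x = 0}"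
      unfolding M_def poly_kernel_dot[OF Hc] poly_kernel_dot[OF Gc] using i0 row_G by auto
    have ker_HP_eq: "poly_kernel (H + P) = {x \<in> M. dot n (\<lambda>j. (H + P) $$ (i0, j)) x = 0}"
    proof -
      have "dot n (\<lambda>j. G $$ (i, j)) x = u i0 * dot n (\<lambda>j. (H + P) $$ (i, j)) x
          - u i * dot n (\<lambda>j. (H + P) $$ (i0, j)) x" if "i < m" for i x
        unfolding row_G[OF that] row_HP[OF that] row_HP[OF i0(1)] by (simp add: algebra_simps)
      then show ?thesis
        unfolding M_def poly_kernel_dot[OF HPc] poly_kernel_dot[OF Gc] using i0 by auto
    qed
    have drop: "corank_one_drop 1 (\<lambda>k. int (top_dim M k) - int (top_dim {x \<in> M. dot n (\<lambda>j. A $$ (i0, j)) x = 0} k))"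
      if A: "\<forall>j<n. degree (A $$ (i0, j)) \<le> 1" for A
    proof -
      have "deg_below (k + 1) (dot n (\<lambda>j. A $$ (i0, j)) x)" if "\<forall>i. deg_below k (x i)" for k x
        by (rule deg_below_dot[OF A that])
      from corank_one_drop_top_dim[OF M linear_dot dot_shift this refl] show ?thesis by simp
    qed
    show "count_change_bounds (int (r 0)) (int (r' 0)) (int (partition_size r)) ?a ?b"
    proof (rule count_change_bounds_common_supermodule[OF mono[OF M] mono[OF ker_H] mono[OF ker_HP]
          a_le a_ev b_le b_ev _ S _ _ near])
      show "corank_one_drop 1 (\<lambda>k. int (top_dim M k) - ?a k)"
        unfolding ker_H_eq by (rule drop) (use H i0 in \<open>auto simp: is_pencil_def\<close>)
      show "corank_one_drop 1 (\<lambda>k. int (top_dim M k) - ?b k)"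
        unfolding ker_HP_eq
        by (rule drop) (use H P i0 in \<open>auto simp: is_pencil_def intro!: degree_add_le\<close>)
    qed simp_all
  next
    assume v_const: "\<forall>j<n. degree (v j) = 0"
    define N where "N = {x \<in> poly_kernel H. dot n v x = 0}"
    have N: "poly_submodule n N"
      unfolding N_def by (rule poly_submodule_kernel[OF ker_H linear_dot dot_shift])
    have N_HP: "N = {x \<in> poly_kernel (H + P). dot n v x = 0}"
      unfolding N_def poly_kernel_dot[OF Hc] poly_kernel_dot[OF HPc] using row_HP by auto
    have deg: "deg_below (k + 0) (dot n v x)" if "\<forall>i. deg_below k (x i)" for k x
      by (rule deg_below_dot[OF _ that]) (use v_const in simp)
    show "count_change_bounds (int (r 0)) (int (r' 0)) (int (partition_size r)) ?a ?b"
    proof (rule count_change_bounds_common_submodule[OF mono[OF N] mono[OF ker_H]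
          a_le a_ev b_le b_ev S _ _ near])
      show "corank_one_drop 0 (\<lambda>k. ?a k - int (top_dim N k))"
        using corank_one_drop_top_dim[OF ker_H linear_dot dot_shift deg N_def] by simp
      show "corank_one_drop 0 (\<lambda>k. ?b k - int (top_dim N k))"
        using corank_one_drop_top_dim[OF ker_HP linear_dot dot_shift deg N_HP] by simp
    qed simp_all
  qed
qed

section \<open>Rank-one perturbations of pencils\<close>

theorem corollary3p6:
  fixes H P :: "'a::alg_closed_field poly mat"
    and m n :: nat
    and W W' :: "'a point \<Rightarrow> nat \<Rightarrow> nat"
    and r s r' s' :: "nat \<Rightarrow> nat"
  assumes "is_pencil m n H"
    and "is_pencil m n P"
    and "normal_rank P = 1"
    and "weyr_characteristic H W r s"
    and "weyr_characteristic (H + P) W' r' s'"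
  shows
    "(normal_rank (H + P) = normal_rank H \<longrightarrow>
        (\<forall>x. \<forall>i\<ge>1. - 1 \<le> int (W' x i) - int (W x i) \<and> int (W' x i) - int (W x i) \<le> 1) \<and>
        ((\<forall>i\<ge>1. r i = 0) \<longrightarrow>
           (\<forall>i. 0 \<le> int (r' i) - int (r i) \<and> int (r' i) - int (r i) \<le> 2)) \<and>
        (\<not> (\<forall>i\<ge>1. r i = 0) \<longrightarrow>
           (\<forall>i. min (- isqrt (real (partition_size r)) - 1) (- isqrt (real (starred_size r)))
                  \<le> int (r' i) - int (r i) \<and>
                int (r' i) - int (r i)
                  \<le> max (isqrt (real (partition_size r) - 1) + 2) (isqrt (real (starred_size r))))) \<and>
        ((\<forall>i\<ge>1. s i = 0) \<longrightarrow>
           (\<forall>i. 0 \<le> int (s' i) - int (s i) \<and> int (s' i) - int (s i) \<le> 2)) \<and>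
        (\<not> (\<forall>i\<ge>1. s i = 0) \<longrightarrow>
           (\<forall>i. min (- isqrt (real (partition_size s)) - 1) (- isqrt (real (starred_size s)))
                  \<le> int (s' i) - int (s i) \<and>
                int (s' i) - int (s i)
                  \<le> max (isqrt (real (partition_size s) - 1) + 2) (isqrt (real (starred_size s)))))) \<and>
     (int (normal_rank (H + P)) = int (normal_rank H) - 1 \<longrightarrow>
        (\<forall>x. \<forall>i\<ge>1. - 2 \<le> int (W' x i) - int (W x i) \<and> int (W' x i) - int (W x i) \<le> 0) \<and>
        (\<forall>i. min (1 - isqrt (real (starred_size r) + 1)) (- isqrt (real (partition_size r)))
               \<le> int (r' i) - int (r i) \<and>
             int (r' i) - int (r i) \<le> 1) \<and>
        (\<forall>i. min (1 - isqrt (real (starred_size s) + 1)) (- isqrt (real (partition_size s)))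
               \<le> int (s' i) - int (s i) \<and>
             int (s' i) - int (s i) \<le> 1)) \<and>
     (normal_rank (H + P) = normal_rank H + 1 \<longrightarrow>
        (\<forall>x. \<forall>i\<ge>1. 0 \<le> int (W' x i) - int (W x i) \<and> int (W' x i) - int (W x i) \<le> 2) \<and>
        (\<forall>i. - 1 \<le> int (r' i) - int (r i) \<and>
             int (r' i) - int (r i)
               \<le> max (- 1 + isqrt (real (starred_size r))) (isqrt (real (partition_size r) + 1))) \<and>
        (\<forall>i. - 1 \<le> int (s' i) - int (s i) \<and>
             int (s' i) - int (s i)
               \<le> max (- 1 + isqrt (real (starred_size s))) (isqrt (real (partition_size s) + 1))))"
proof -
  have Hc: "H \<in> carrier_mat m n" and Pc: "P \<in> carrier_mat m n"
    using assms(1,2) by (auto simp: is_pencil_def)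
  obtain u v where uv: "\<forall>i<m. \<forall>j<n. P $$ (i, j) = u i * v j"
    and nz: "\<exists>i<m. u i \<noteq> 0" "\<exists>j<n. v j \<noteq> 0"
    and const: "(\<forall>i<m. degree (u i) = 0) \<or> (\<forall>j<n. degree (v j) = 0)"
    using rank_one_pencil_factorization[OF assms(2,3)] by blast
  obtain z c d where H: "partial_multiplicities H z" "\<forall>x. \<forall>i\<ge>1. W x i = conjugate_seq (z x) i"
      "column_minimal_indices H c" "r = brunovsky (n - normal_rank H) c"
      "row_minimal_indices H d" "s = brunovsky (m - normal_rank H) d"
    using assms(4) Hc unfolding weyr_characteristic_def by (elim conjE exE) simp
  have HP_dim: "dim_row (H + P) = m" "dim_col (H + P) = n" using Pc by auto
  obtain z' c' d' where HP: "partial_multiplicities (H + P) z'"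
      "\<forall>x. \<forall>i\<ge>1. W' x i = conjugate_seq (z' x) i"
      "column_minimal_indices (H + P) c'" "r' = brunovsky (n - normal_rank (H + P)) c'"
      "row_minimal_indices (H + P) d'" "s' = brunovsky (m - normal_rank (H + P)) d'"
    using assms(5) unfolding weyr_characteristic_def HP_dim by (elim conjE exE) simp
  have W: "\<bar>(int (W' x i) - int (normal_rank (H + P))) - (int (W x i) - int (normal_rank H))\<bar> \<le> 1"
    if "i \<ge> 1" for x i
    using rank_one_perturbation_weyr[OF assms(1,2) uv const H(1) HP(1) that, of x] H(2) HP(2) that
    by simp
  have T: "\<forall>j<n. \<forall>i<m. transpose_mat P $$ (j, i) = v j * u i"
    using uv Pc by (simp add: mult.commute)
  have const_T: "(\<forall>j<n. degree (v j) = 0) \<or> (\<forall>i<m. degree (u i) = 0)"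
    using const by blast
  have sum_T: "transpose_mat H + transpose_mat P = transpose_mat (H + P)"
    by (rule transpose_add[OF Hc Pc, symmetric])
  note indices = column_minimal_indices_counts(2)[OF Hc H(3,4)]
    column_minimal_indices_counts(2)[OF add_carrier_mat[OF Pc] HP(3,4)]
    column_minimal_indices_counts(2)[OF transpose_carrier_mat[THEN iffD2, OF Hc],
      unfolded normal_rank_transpose, folded row_minimal_indices_def, OF H(5,6)]
    column_minimal_indices_counts(2)[OF transpose_carrier_mat[THEN iffD2, OF add_carrier_mat[OF Pc]],
      unfolded normal_rank_transpose, folded row_minimal_indices_def, OF HP(5,6)]
  have sizes: "partition_size r = 0 \<longleftrightarrow> (\<forall>i\<ge>1. r i = 0)" "partition_size s = 0 \<longleftrightarrow> (\<forall>i\<ge>1. s i = 0)"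
    unfolding H(4,6) by (rule brunovsky_size(1))+
  show ?thesis
  proof (cases "\<bar>int (normal_rank (H + P)) - int (normal_rank H)\<bar> \<le> 1")
    case False
    then show ?thesis by auto
  next
    case True
    then have near: "\<bar>int (r' 0) - int (r 0)\<bar> \<le> 1" "\<bar>int (s' 0) - int (s 0)\<bar> \<le> 1"
      using indices by linarith+
    note columns = count_change_bounds_imp_sqrt_bounds[OF rank_one_perturbation_counts[OF assms(1,2) uv nz(1)
          const H(3,4) HP(3,4) near(1), unfolded brunovsky_counts_def[abs_def]] sizes(1)]
    note rows = count_change_bounds_imp_sqrt_bounds[OF rank_one_perturbation_counts[OF
          is_pencil_transpose[OF assms(1)] is_pencil_transpose[OF assms(2)] T nz(2) const_T,
          unfolded sum_T normal_rank_transpose, folded row_minimal_indices_def,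
          OF H(5,6) HP(5,6) near(2), unfolded brunovsky_counts_def[abs_def]] sizes(2)]
    have W_eq: "- 1 \<le> int (W' x i) - int (W x i) \<and> int (W' x i) - int (W x i) \<le> 1"
      if "normal_rank (H + P) = normal_rank H" "1 \<le> i" for x i
      using W[OF that(2), of x] that(1) by linarith
    have W_less: "- 2 \<le> int (W' x i) - int (W x i) \<and> int (W' x i) - int (W x i) \<le> 0"
      if "int (normal_rank (H + P)) = int (normal_rank H) - 1" "1 \<le> i" for x i
      using W[OF that(2), of x] that(1) by linarith
    have W_greater: "0 \<le> int (W' x i) - int (W x i) \<and> int (W' x i) - int (W x i) \<le> 2"
      if "normal_rank (H + P) = normal_rank H + 1" "1 \<le> i" for x i
      using W[OF that(2), of x] that(1) by linarith
    show ?thesis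
      by (intro conjI impI; intro allI impI; rule W_eq W_less W_greater columns rows;
          (assumption | use indices in linarith))
  qed
qed

end
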